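(* Let $(M^2,D,\Omega)$ be an equi-affine $2$-manifold and let $\gamma(t)$ $(|t|<\delta)$ be a regular $C^\infty$ curve in $M^2$ with a generic inflection point at $t=0$. Let $s_A$ be its affine arclength parameter. Then $\tau=\operatorname{sgn}(t)|s_A|^{3/4}$ can be taken to be a coordinate of $\gamma$ at $t=0$ (the $3/4$-arclength parameter), and $f:=(s_A)^2\kappa_A$ is a $C^\infty$-function of $t$ (and of $\tau$) at $t=0$. Moreover, $f$ satisfies (dots on $f$ denoting $d/dt$) $$-\frac97\left(\frac{[\dot\gamma(0),\gamma^{(4)}(0)]+[\ddot\gamma(0),\gamma^{(3)}(0)]}{[\dot\gamma(0),\gamma^{(3)}(0)]}\right)\dot f(0)+32\,\dot f(0)^2+9\,\ddot f(0)=0,$$ and $$\lim_{t\to0}(s_A)^2\kappa_A\;(=f(0))=-\frac5{16},\qquad \lim_{t\to0}\frac{(s_A)^2\kappa_A+5/16}{\tau}=-\frac{3\sqrt[4]{3}}{28\sqrt2}\,\mu_I,$$ where $\mu_I$ is the affine inflectional curvature at $t=0$. Furthermore, if $t=\tau$, then the first identity reduces to $$32\left(\frac{df}{d\tau}(0)\right)^2+9\,\frac{d^2f}{d\tau^2}(0)=0.\qquad( * )$$ Conversely, for any $C^\infty$-function $f(\tau)$ (defined near $\tau=0$) satisfying $f(0)=-5/16$ and $( * )$, there exists a regular curve in $(M^2,D,\Omega)$ with a generic inflection point at $\tau=0$ whose normalized affine curvature function $(s_A)^2\kappa_A$ is $f(\tau)$ with respect to the $3/4$-arclength parameter $\ta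u$.
   Context: An equi-affine $2$-manifold is a triple $(M^2,D,\Omega)$ where $M^2$ is an oriented $2$-manifold, $D$ is an affine connection on $M^2$ (not necessarily torsion free, with no symmetry assumption on its Ricci tensor), and $\Omega$ is a non-vanishing positively oriented $2$-form on $M^2$ which is parallel with respect to $D$. Write $[v,w]=\Omega(v,w)$ for $v,w\in T_pM^2$. Along a curve $\gamma(t)$ put $\ddot\gamma=D_t\dot\gamma$, $\gamma^{(3)}=D_t\ddot\gamma$, $\gamma^{(4)}=D_t\gamma^{(3)}$. A point $t=0$ of a regular curve $\gamma$ is an inflection point if $[\dot\gamma(0),\ddot\gamma(0)]=0$; it is generic if moreover $[\dot\gamma(0),\gamma^{(3)}(0)]\ne0$. The affine arclength is $s_A(t)=\int_0^t\bigl|[\dot\gamma(u),\ddot\gamma(u)]\bigr|^{1/3}du$, and the affine curvature (for $t\ne0$ near $0$) is $$\kappa_A=\frac{3[\dot\gamma,\ddot\gamma]\,[\dot\gamma,\gamma^{(4)}]+12[\dot\gamma,\ddot\gamma]\,[\ddot\gamma,\gamma^{(3)}]-5[\dot\gamma,\gamma^{(3)}]^2}{9\,\bigl|[\dot\gamma,\ddot\gamma]\bigr|^{8/3}}.$$ The affine inflectional curvature at a generic inflection point $t=0$ is $$\mu_I=\epsilon_I\,\frac{[\dot\gamma(0),\gamma^{(4)}(0)]-6[\ddot\gamma(0),\gamma^{(3)}(0)]}{\bigl|[\dot\gamma(0),\gamma^{(3)}(0)]\bigr|^{5/4}},\qquad \epsilon_I=\operatorname{sgn}[\dot\gamma(0),\gamma^{(3)}(0)].$$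 Smoothness at $t=0$ concerns germs at $t=0$, functions being extended across $t=0$. *)

theory Defs
  imports "HOL-Analysis.Analysis"
begin

section \<open>Smooth maps on open sets\<close>

primrec higher_differentiable_on ::
  "'a::real_normed_vector set \<Rightarrow> ('a \<Rightarrow> 'b::real_normed_vector) \<Rightarrow> nat \<Rightarrow> bool" where
  "higher_differentiable_on S f 0 \<longleftrightarrow> continuous_on S f"
| "higher_differentiable_on S f (Suc n) \<longleftrightarrow>
     (\<forall>x\<in>S. f differentiable (at x)) \<and>
     (\<forall>v. higher_differentiable_on S (\<lambda>x. frechet_derivative f (at x) v) n)"

text \<open>To be used for open \<open>S\<close> in a finite-dimensional space only: there it says that all
  iterated directional derivatives exist and are continuous on \<open>S\<close>.\<close>

definition smooth_on ::
  "'a::real_normed_vector set \<Rightarrow> ('a \<Rightarrow> 'b::real_normed_vector) \<Rightarrow> bool" where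
  "smooth_on S f \<longleftrightarrow> (\<forall>n. higher_differentiable_on S f n)"


section \<open>Equi-affine 2-manifolds\<close>

text \<open>The structure is given in an atlas indexed by \<open>charts\<close>. In the chart \<open>i\<close>, and at the point
  with coordinates \<open>x\<close>, the connection is \<open>D\<^sub>v W = dW(v) + christoffel M i x v W\<close> for a vector
  \<open>v\<close> at \<open>x\<close> and a vector field \<open>W\<close>, and the 2-form is \<open>area M i x\<close>. The map \<open>chart M i\<close> is
  relevant on \<open>dom M i\<close> only.\<close>

record ('m, 'i) equi_affine =
  space_of :: "'m topology"
  charts :: "'i set"
  dom :: "'i \<Rightarrow> 'm set"
  chart :: "'i \<Rightarrow> 'm \<Rightarrow> real^2"
  christoffel :: "'i \<Rightarrow> real^2 \<Rightarrow> real^2 \<Rightarrow> real^2 \<Rightarrow> real^2"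
  area :: "'i \<Rightarrow> real^2 \<Rightarrow> real^2 \<Rightarrow> real^2 \<Rightarrow> real"

definition transition :: "('m, 'i) equi_affine \<Rightarrow> 'i \<Rightarrow> 'i \<Rightarrow> real^2 \<Rightarrow> real^2" where
  "transition M i j = chart M j \<circ> inv_into (dom M i) (chart M i)"

definition overlap :: "('m, 'i) equi_affine \<Rightarrow> 'i \<Rightarrow> 'i \<Rightarrow> (real^2) set" where
  "overlap M i j = chart M i ` (dom M i \<inter> dom M j)"

abbreviation dtransition ::
  "('m, 'i) equi_affine \<Rightarrow> 'i \<Rightarrow> 'i \<Rightarrow> real^2 \<Rightarrow> real^2 \<Rightarrow> real^2" where
  "dtransition M i j x \<equiv> frechet_derivative (transition M i j) (at x)"

text \<open>The orientation is the one for which all charts of the atlas are positive.\<close>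

definition oriented_2_manifold :: "('m, 'i) equi_affine \<Rightarrow> bool" where
  "oriented_2_manifold M \<longleftrightarrow>
     topspace (space_of M) \<noteq> {} \<and>
     Hausdorff_space (space_of M) \<and> second_countable (space_of M) \<and>
     (\<Union>i\<in>charts M. dom M i) = topspace (space_of M) \<and>
     (\<forall>i\<in>charts M. openin (space_of M) (dom M i) \<and> open (chart M i ` dom M i) \<and>
        homeomorphic_map (subtopology (space_of M) (dom M i))
          (top_of_set (chart M i ` dom M i)) (chart M i)) \<and>
     (\<forall>i\<in>charts M. \<forall>j\<in>charts M.
        smooth_on (overlap M i j) (transition M i j) \<and>
        (\<forall>x\<in>overlap M i j. det (matrix (dtransition M i j x)) > 0))"

text \<open>The second condition is the transformation law of the Christoffel symbols. No symmetry of
  \<open>christoffel M i x\<close> is required, so torsion is allowed.\<close>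

definition affine_connection :: "('m, 'i) equi_affine \<Rightarrow> bool" where
  "affine_connection M \<longleftrightarrow>
     (\<forall>i\<in>charts M.
        (\<forall>x\<in>chart M i ` dom M i. bilinear (christoffel M i x)) \<and>
        (\<forall>v w. smooth_on (chart M i ` dom M i) (\<lambda>x. christoffel M i x v w))) \<and>
     (\<forall>i\<in>charts M. \<forall>j\<in>charts M. \<forall>x\<in>overlap M i j. \<forall>v w.
        dtransition M i j x (christoffel M i x v w) =
          frechet_derivative (\<lambda>y. dtransition M i j y w) (at x) v +
          christoffel M j (transition M i j x) (dtransition M i j x v) (dtransition M i j x w))"

definition positive_area_form :: "('m, 'i) equi_affine \<Rightarrow> bool" where
  "positive_area_form M \<longleftrightarrow>
     (\<forall>i\<in>charts M.
        (\<forall>x\<in>chart M i ` dom M i. bilinear (area M i x) \<and> (\<forall>v. area M i x v v = 0) \<and>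
           area M i x (axis 1 1) (axis 2 1) > 0) \<and>
        (\<forall>v w. smooth_on (chart M i ` dom M i) (\<lambda>x. area M i x v w))) \<and>
     (\<forall>i\<in>charts M. \<forall>j\<in>charts M. \<forall>x\<in>overlap M i j. \<forall>v w.
        area M j (transition M i j x) (dtransition M i j x v) (dtransition M i j x w) =
          area M i x v w)"

text \<open>This is \<open>(D\<^sub>u \<Omega>)(v, w) = 0\<close>, evaluated on fields \<open>v\<close>, \<open>w\<close> that are constant in the chart.\<close>

definition parallel_area_form :: "('m, 'i) equi_affine \<Rightarrow> bool" where
  "parallel_area_form M \<longleftrightarrow>
     (\<forall>i\<in>charts M. \<forall>x\<in>chart M i ` dom M i. \<forall>u v w.
        frechet_derivative (\<lambda>y. area M i y v w) (at x) u
          - area M i x (christoffel M i x u v) w - area M i x v (christoffel M i x u w) = 0)"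

definition equi_affine_2_manifold :: "('m, 'i) equi_affine \<Rightarrow> bool" where
  "equi_affine_2_manifold M \<longleftrightarrow> oriented_2_manifold M \<and> affine_connection M \<and>
     positive_area_form M \<and> parallel_area_form M"


section \<open>Tangent vectors\<close>

text \<open>A tangent vector at \<open>p\<close> is the family of its components in the charts around \<open>p\<close>
  (and \<open>0\<close> at all other indices).\<close>

definition tangent_vector :: "('m, 'i) equi_affine \<Rightarrow> 'm \<Rightarrow> ('i \<Rightarrow> real^2) \<Rightarrow> bool" where
  "tangent_vector M p v \<longleftrightarrow>
     (\<forall>i. i \<notin> charts M \<or> p \<notin> dom M i \<longrightarrow> v i = 0) \<and>
     (\<forall>i\<in>charts M. \<forall>j\<in>charts M. p \<in> dom M i \<and> p \<in> dom M j \<longrightarrow>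
        v j = dtransition M i j (chart M i p) (v i))"

definition bracket ::
  "('m, 'i) equi_affine \<Rightarrow> 'm \<Rightarrow> ('i \<Rightarrow> real^2) \<Rightarrow> ('i \<Rightarrow> real^2) \<Rightarrow> real" where
  "bracket M p v w =
     (let i = (SOME i. i \<in> charts M \<and> p \<in> dom M i) in area M i (chart M i p) (v i) (w i))"

text \<open>The value does not depend on the chart.\<close>

lemma bracket_in_chart:
  assumes M: "equi_affine_2_manifold M" and v: "tangent_vector M p v" and w: "tangent_vector M p w"
    and j: "j \<in> charts M" "p \<in> dom M j"
  shows "bracket M p v w = area M j (chart M j p) (v j) (w j)"
proof -
  define i where "i = (SOME i. i \<in> charts M \<and> p \<in> dom M i)"
  have i: "i \<in> charts M" "p \<in> dom M i"
    using someI[of "\<lambda>i. i \<in> charts M \<and> p \<in> dom M i" j] j unfolding i_def by auto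
  have "homeomorphic_map (subtopology (space_of M) (dom M i))
      (top_of_set (chart M i ` dom M i)) (chart M i)" and "openin (space_of M) (dom M i)"
    using M i unfolding equi_affine_2_manifold_def oriented_2_manifold_def by blast+
  then have "inj_on (chart M i) (dom M i)"
    using homeomorphic_imp_injective_map openin_subset
    by (metis topspace_subtopology_subset)
  then have "transition M i j (chart M i p) = chart M j p"
    using i by (simp add: transition_def)
  moreover have "chart M i p \<in> overlap M i j"
    using i j by (auto simp: overlap_def)
  ultimately have "area M j (chart M j p) (v j) (w j) = area M i (chart M i p) (v i) (w i)"
    using M i j v w unfolding equi_affine_2_manifold_def positive_area_form_def tangent_vector_def
    by metis
  then show ?thesis
    by (simp add: bracket_def i_def[symmetric] Let_def)
qed


section \<open>Curves\<close>

definition velocity :: "('m, 'i) equi_affine \<Rightarrow> (real \<Rightarrow> 'm) \<Rightarrow> real \<Rightarrow> 'i \<Rightarrow> real^2" where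
  "velocity M \<gamma> t i =
     (if i \<in> charts M \<and> \<gamma> t \<in> dom M i then vector_derivative (chart M i \<circ> \<gamma>) (at t) else 0)"

definition cov_deriv :: "('m, 'i) equi_affine \<Rightarrow> (real \<Rightarrow> 'm) \<Rightarrow>
    (real \<Rightarrow> 'i \<Rightarrow> real^2) \<Rightarrow> real \<Rightarrow> 'i \<Rightarrow> real^2" where
  "cov_deriv M \<gamma> X t i =
     (if i \<in> charts M \<and> \<gamma> t \<in> dom M i
      then vector_derivative (\<lambda>s. X s i) (at t)
             + christoffel M i (chart M i (\<gamma> t)) (velocity M \<gamma> t i) (X t i)
      else 0)"

text \<open>For \<open>k \<ge> 1\<close>, \<open>curve_deriv M \<gamma> k\<close> is the \<open>k\<close>-th derivative: the velocity for \<open>k = 1\<close>,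
  differentiated covariantly \<open>k - 1\<close> times.\<close>

definition curve_deriv ::
  "('m, 'i) equi_affine \<Rightarrow> (real \<Rightarrow> 'm) \<Rightarrow> nat \<Rightarrow> real \<Rightarrow> 'i \<Rightarrow> real^2" where
  "curve_deriv M \<gamma> k = (cov_deriv M \<gamma> ^^ (k - 1)) (velocity M \<gamma>)"

definition br :: "('m, 'i) equi_affine \<Rightarrow> (real \<Rightarrow> 'm) \<Rightarrow> nat \<Rightarrow> nat \<Rightarrow> real \<Rightarrow> real" where
  "br M \<gamma> j k t = bracket M (\<gamma> t) (curve_deriv M \<gamma> j t) (curve_deriv M \<gamma> k t)"

definition smooth_curve :: "('m, 'i) equi_affine \<Rightarrow> (real \<Rightarrow> 'm) \<Rightarrow> real set \<Rightarrow> bool" where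
  "smooth_curve M \<gamma> I \<longleftrightarrow> continuous_map (top_of_set I) (space_of M) \<gamma> \<and>
     (\<forall>i\<in>charts M. smooth_on {t \<in> I. \<gamma> t \<in> dom M i} (chart M i \<circ> \<gamma>))"

definition regular_curve :: "('m, 'i) equi_affine \<Rightarrow> (real \<Rightarrow> 'm) \<Rightarrow> real set \<Rightarrow> bool" where
  "regular_curve M \<gamma> I \<longleftrightarrow> smooth_curve M \<gamma> I \<and>
     (\<forall>t\<in>I. \<forall>i\<in>charts M. \<gamma> t \<in> dom M i \<longrightarrow> velocity M \<gamma> t i \<noteq> 0)"

definition generic_inflection :: "('m, 'i) equi_affine \<Rightarrow> (real \<Rightarrow> 'm) \<Rightarrow> real \<Rightarrow> bool" where
  "generic_inflection M \<gamma> t \<longleftrightarrow> br M \<gamma> 1 2 t = 0 \<and> br M \<gamma> 1 3 t \<noteq> 0"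

definition affine_arclength :: "('m, 'i) equi_affine \<Rightarrow> (real \<Rightarrow> 'm) \<Rightarrow> real \<Rightarrow> real" where
  "affine_arclength M \<gamma> t = (LBINT u=0..ereal t. \<bar>br M \<gamma> 1 2 u\<bar> powr (1/3))"

definition arclength34 :: "('m, 'i) equi_affine \<Rightarrow> (real \<Rightarrow> 'm) \<Rightarrow> real \<Rightarrow> real" where
  "arclength34 M \<gamma> t = sgn t * \<bar>affine_arclength M \<gamma> t\<bar> powr (3/4)"

definition affine_curvature :: "('m, 'i) equi_affine \<Rightarrow> (real \<Rightarrow> 'm) \<Rightarrow> real \<Rightarrow> real" where
  "affine_curvature M \<gamma> t =
     (3 * br M \<gamma> 1 2 t * br M \<gamma> 1 4 t + 12 * br M \<gamma> 1 2 t * br M \<gamma> 2 3 t - 5 * (br M \<gamma> 1 3 t)\<^sup>2)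
       / (9 * \<bar>br M \<gamma> 1 2 t\<bar> powr (8/3))"

text \<open>Meaningful where \<open>br M \<gamma> 1 2 t \<noteq> 0\<close>.\<close>

definition normalized_curvature :: "('m, 'i) equi_affine \<Rightarrow> (real \<Rightarrow> 'm) \<Rightarrow> real \<Rightarrow> real" where
  "normalized_curvature M \<gamma> t = (affine_arclength M \<gamma> t)\<^sup>2 * affine_curvature M \<gamma> t"

definition inflectional_curvature :: "('m, 'i) equi_affine \<Rightarrow> (real \<Rightarrow> 'm) \<Rightarrow> real" where
  "inflectional_curvature M \<gamma> =
     sgn (br M \<gamma> 1 3 0) * (br M \<gamma> 1 4 0 - 6 * br M \<gamma> 2 3 0) / \<bar>br M \<gamma> 1 3 0\<bar> powr (5/4)"

text \<open>\<open>\<tau>\<close> is a smooth coordinate on \<open>I\<close>: a diffeomorphism onto an open set, with inverse \<open>\<theta>\<close>.\<close>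

definition coordinate_on :: "real set \<Rightarrow> (real \<Rightarrow> real) \<Rightarrow> (real \<Rightarrow> real) \<Rightarrow> bool" where
  "coordinate_on I \<tau> \<theta> \<longleftrightarrow> smooth_on I \<tau> \<and> open (\<tau> ` I) \<and> smooth_on (\<tau> ` I) \<theta> \<and>
     (\<forall>t\<in>I. \<theta> (\<tau> t) = t)"

end

theory Submission
  imports Defs
begin

text \<open>Write \<open>\<gamma>\<^sub>k\<close> for the \<open>k\<close>-th derivative of \<open>\<gamma>\<close>, and put \<open>a = [\<gamma>\<^sub>1, \<gamma>\<^sub>2]\<close>, \<open>b = [\<gamma>\<^sub>2, \<gamma>\<^sub>3]\<close>. Because
  \<open>\<Omega>\<close> is parallel, brackets along \<open>\<gamma>\<close> obey the Leibniz rule, so \<open>a' = [\<gamma>\<^sub>1, \<gamma>\<^sub>3]\<close> and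
  \<open>a'' = b + [\<gamma>\<^sub>1, \<gamma>\<^sub>4]\<close>: the affine curvature depends only on the two functions \<open>a\<close> and \<open>b\<close>. At a generic
  inflection point \<open>a\<close> has a simple zero, and the Pluecker relation between four vectors of a plane
  gives the constraint \<open>a' b' = b (a'' - b)\<close> there. The quadratic identity for the normalized curvature
  expresses this constraint, and there is no other one.

  Write \<open>a = \<sigma> t g\<^sup>3\<close> with \<open>\<sigma> = 1\<close> or \<open>\<sigma> = -1\<close> and \<open>g > 0\<close> smooth. The substitution \<open>u = t v\<close> in the
  arclength integral gives \<open>s = t * \<bar>t\<bar> powr (1/3) * k\<close>, where \<open>k(t)\<close> is the integral of
  \<open>v powr (1/3) * g(t v)\<close> over \<open>0 \<le> v \<le> 1\<close>. Hence the \<open>3/4\<close>-arclength is \<open>t * k powr (3/4)\<close>, which is a smooth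
  coordinate, and in the normalized curvature all fractional powers of \<open>t\<close> cancel. The function \<open>k\<close> solves
  \<open>4/3 k + t k' = g\<close>, which determines its Taylor coefficients. In the first two derivatives of the
  normalized curvature at \<open>0\<close>, the third derivative of \<open>a\<close> cancels and \<open>b'\<close> is eliminated by the constraint; both are
  then expressed by \<open>a'\<close>, \<open>a''\<close> and \<open>b\<close>, and the quadratic identity can be read off. This is
  \<open>normalized_curvature_at_inflection\<close>, with the algebra in \<open>curvature_jet_identity\<close>.

  Conversely, the parameter \<open>t\<close> is the \<open>3/4\<close>-arclength if \<open>a = (4/3)\<^sup>3 t\<close>, and then the prescribed curvature
  determines a smooth \<open>b\<close>. Solving for \<open>\<gamma>\<^sub>3\<close> in terms of \<open>\<gamma>\<^sub>1\<close> and \<open>\<gamma>\<^sub>2\<close> would be singular at the inflection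
  point, where these two vectors are dependent. Instead, the curve is constructed together with a field
  \<open>e\<^sub>2\<close> such that \<open>[\<gamma>\<^sub>1, e\<^sub>2] = 1\<close>, from \<open>D \<gamma>\<^sub>1 = \<kappa> \<gamma>\<^sub>1 + a e\<^sub>2\<close> and \<open>D e\<^sub>2 = \<mu> \<gamma>\<^sub>1 - \<kappa> e\<^sub>2\<close>. For such a frame with
  constant \<open>\<kappa>\<close> one has \<open>b = \<kappa> a' - a (\<kappa>\<^sup>2 + a \<mu>)\<close>, and the quadratic identity for \<open>f\<close> is exactly the condition
  under which this equation can be solved for \<open>\<kappa>\<close> and a smooth \<open>\<mu>\<close> (\<open>frame_coefficients\<close>). The frame
  exists by the theorem of Picard and Lindeloef (\<open>moving_frame_exists\<close>).\<close>

section \<open>Calculus of smooth maps\<close>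

lemma higher_differentiable_on_cong:
  assumes "open S" "\<And>x. x \<in> S \<Longrightarrow> f x = g x" "higher_differentiable_on S f n"
  shows "higher_differentiable_on S g n"
  using assms(2,3)
proof (induction n arbitrary: f g)
  case 0
  then show ?case using continuous_on_eq by fastforce
next
  case (Suc n)
  have der: "(g has_derivative frechet_derivative f (at x)) (at x)" if "x \<in> S" for x
    using Suc.prems that assms(1)
    by (intro has_derivative_transform_within_open[of f _ x UNIV S g])
       (auto simp: frechet_derivative_works)
  have "frechet_derivative g (at x) = frechet_derivative f (at x)" if "x \<in> S" for x
    using frechet_derivative_at[OF der[OF that]] by simp
  then have "higher_differentiable_on S (\<lambda>x. frechet_derivative g (at x) v) n" for v
    using Suc.IH[of "\<lambda>x. frechet_derivative f (at x) v" "\<lambda>x. frechet_derivative g (at x) v"]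
      Suc.prems(2) by simp
  then show ?case using der by (auto simp: differentiable_def)
qed

lemma higher_differentiable_on_SucI:
  assumes "open S" "\<And>x. x \<in> S \<Longrightarrow> (f has_derivative f' x) (at x)"
    "\<And>v. higher_differentiable_on S (\<lambda>x. f' x v) n"
  shows "higher_differentiable_on S f (Suc n)"
proof -
  have "higher_differentiable_on S (\<lambda>x. frechet_derivative f (at x) v) n" for v
    by (rule higher_differentiable_on_cong[OF assms(1) _ assms(3)[of v]])
       (simp add: frechet_derivative_at[OF assms(2), symmetric])
  then show ?thesis using assms(2) by (auto simp: differentiable_def)
qed

lemma higher_differentiable_on_SucD:
  assumes "higher_differentiable_on S f (Suc n)"
  shows "higher_differentiable_on S f n"
  using assms
proof (induction n arbitrary: f)
  case 0
  then show ?case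
    by (simp add: continuous_at_imp_continuous_on differentiable_imp_continuous_within)
next
  case (Suc n)
  have "higher_differentiable_on S (\<lambda>x. frechet_derivative f (at x) v) (Suc n)" for v
    using Suc.prems by (subst (asm) higher_differentiable_on.simps) blast
  from Suc.IH[OF this] show ?case using Suc.prems by simp
qed

lemma smooth_on_cong:
  assumes "open S" "\<And>x. x \<in> S \<Longrightarrow> f x = g x" "smooth_on S f"
  shows "smooth_on S g"
  using higher_differentiable_on_cong[OF assms(1,2)] assms(3) by (auto simp: smooth_on_def)

lemma higher_differentiable_on_subset:
  "higher_differentiable_on S f n \<Longrightarrow> T \<subseteq> S \<Longrightarrow> higher_differentiable_on T f n"
  by (induction n arbitrary: f) (auto intro: continuous_on_subset)

lemma smooth_on_subset: "smooth_on S f \<Longrightarrow> T \<subseteq> S \<Longrightarrow> smooth_on T f"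
  unfolding smooth_on_def using higher_differentiable_on_subset by blast

lemma smooth_on_has_derivative:
  "smooth_on S f \<Longrightarrow> x \<in> S \<Longrightarrow> (f has_derivative frechet_derivative f (at x)) (at x)"
  unfolding smooth_on_def
  by (metis frechet_derivative_works higher_differentiable_on.simps(2))

lemma smooth_on_frechet_derivative:
  "smooth_on S f \<Longrightarrow> smooth_on S (\<lambda>x. frechet_derivative f (at x) v)"
  unfolding smooth_on_def by (metis higher_differentiable_on.simps(2))

lemma smooth_on_continuous: "smooth_on S f \<Longrightarrow> continuous_on S f"
  unfolding smooth_on_def by (metis higher_differentiable_on.simps(1))

lemma higher_differentiable_on_const: "higher_differentiable_on S (\<lambda>x. c) n"
  by (induction n arbitrary: c) (auto simp: frechet_derivative_const)

lemma higher_differentiable_on_linear: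
  assumes "bounded_linear L" "open S" "higher_differentiable_on S f n"
  shows "higher_differentiable_on S (\<lambda>x. L (f x)) n"
  using assms(3)
proof (induction n arbitrary: f)
  case 0
  then show ?case using bounded_linear.continuous_on[OF assms(1)] by auto
next
  case (Suc n)
  have "((\<lambda>x. L (f x)) has_derivative (\<lambda>v. L (frechet_derivative f (at x) v))) (at x)" if "x \<in> S" for x
    using Suc.prems that
    by (intro bounded_linear.has_derivative[OF assms(1)]) (auto simp: frechet_derivative_works)
  then show ?case
    by (rule higher_differentiable_on_SucI[OF assms(2)]) (use Suc in auto)
qed

lemma higher_differentiable_on_add:
  assumes "open S" "higher_differentiable_on S f n" "higher_differentiable_on S g n"
  shows "higher_differentiable_on S (\<lambda>x. f x + g x) n"
  using assms(2,3)
proof (induction n arbitrary: f g)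
  case 0
  then show ?case by (auto intro: continuous_on_add)
next
  case (Suc n)
  have "((\<lambda>x. f x + g x) has_derivative
      (\<lambda>v. frechet_derivative f (at x) v + frechet_derivative g (at x) v)) (at x)" if "x \<in> S" for x
    using Suc.prems that by (intro has_derivative_add) (auto simp: frechet_derivative_works)
  then show ?case
    by (rule higher_differentiable_on_SucI[OF assms(1)]) (use Suc in auto)
qed

lemma higher_differentiable_on_bilinear:
  assumes "bounded_bilinear B" "open S" "higher_differentiable_on S f n" "higher_differentiable_on S g n"
  shows "higher_differentiable_on S (\<lambda>x. B (f x) (g x)) n"
  using assms(3,4)
proof (induction n arbitrary: f g)
  case 0
  then show ?case using bounded_bilinear.continuous_on[OF assms(1)] by auto
next
  case (Suc n)
  have "((\<lambda>x. B (f x) (g x)) has_derivative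
      (\<lambda>v. B (f x) (frechet_derivative g (at x) v) + B (frechet_derivative f (at x) v) (g x))) (at x)"
    if "x \<in> S" for x
    using Suc.prems that
    by (intro bounded_bilinear.FDERIV[OF assms(1)]) (auto simp: frechet_derivative_works)
  then show ?case
  proof (rule higher_differentiable_on_SucI[OF assms(2)])
    fix v
    have "higher_differentiable_on S (\<lambda>x. B (f x) (frechet_derivative g (at x) v)) n"
      by (rule Suc.IH) (use Suc.prems higher_differentiable_on_SucD[OF Suc.prems(1)] in auto)
    moreover have "higher_differentiable_on S (\<lambda>x. B (frechet_derivative f (at x) v) (g x)) n"
      by (rule Suc.IH) (use Suc.prems higher_differentiable_on_SucD[OF Suc.prems(2)] in auto)
    ultimately show "higher_differentiable_on S (\<lambda>x. B (f x) (frechet_derivative g (at x) v)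
        + B (frechet_derivative f (at x) v) (g x)) n"
      by (rule higher_differentiable_on_add[OF assms(2)])
  qed
qed

lemma higher_differentiable_on_sum:
  assumes "open S" "\<And>i. i \<in> A \<Longrightarrow> higher_differentiable_on S (f i) n"
  shows "higher_differentiable_on S (\<lambda>x. \<Sum>i\<in>A. f i x) n"
  using assms(2)
  by (induction A rule: infinite_finite_induct)
     (auto intro: higher_differentiable_on_const higher_differentiable_on_add[OF assms(1)])

lemma linear_basis_expansion:
  fixes f :: "'a::euclidean_space \<Rightarrow> 'b::real_normed_vector"
  assumes "linear f"
  shows "f w = (\<Sum>b\<in>Basis. (w \<bullet> b) *\<^sub>R f b)"
proof -
  have "f w = f (\<Sum>b\<in>Basis. (w \<bullet> b) *\<^sub>R b)" by (simp only: euclidean_representation)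
  also have "\<dots> = (\<Sum>b\<in>Basis. (w \<bullet> b) *\<^sub>R f b)"
    by (simp add: linear_sum[OF assms] linear_cmul[OF assms])
  finally show ?thesis .
qed

text \<open>The chain rule expresses a directional derivative of \<open>g \<circ> f\<close> through the partial derivatives
  of \<open>g\<close>, which are again composed with \<open>f\<close>; hence the induction over all \<open>g\<close> at once.\<close>

lemma higher_differentiable_on_compose:
  fixes f :: "'a::real_normed_vector \<Rightarrow> 'b::euclidean_space"
  assumes "open S" "open T" "f ` S \<subseteq> T"
    "higher_differentiable_on S f n" "higher_differentiable_on T g n"
  shows "higher_differentiable_on S (\<lambda>x. g (f x)) n"
  using assms(4,5)
proof (induction n arbitrary: g)
  case 0
  then show ?case using continuous_on_compose2[of T g S f] assms(3) by auto
next
  case (Suc n)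
  let ?G = "\<lambda>x. frechet_derivative g (at (f x))" and ?F = "\<lambda>x. frechet_derivative f (at x)"
  have der: "((\<lambda>x. g (f x)) has_derivative (\<lambda>v. \<Sum>b\<in>Basis. (?F x v \<bullet> b) *\<^sub>R ?G x b)) (at x)"
    if "x \<in> S" for x
  proof -
    have G: "(g has_derivative ?G x) (at (f x))" and F: "(f has_derivative ?F x) (at x)"
      using Suc.prems that assms(3) by (auto simp: frechet_derivative_works)
    have lin: "linear (?G x)"
      using G by (rule has_derivative_linear)
    have "((\<lambda>x. g (f x)) has_derivative (\<lambda>v. ?G x (?F x v))) (at x)"
      by (rule has_derivative_compose[OF F G])
    also have "(\<lambda>v. ?G x (?F x v)) = (\<lambda>v. \<Sum>b\<in>Basis. (?F x v \<bullet> b) *\<^sub>R ?G x b)"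
      by (rule ext) (rule linear_basis_expansion[OF lin])
    finally show ?thesis .
  qed
  show ?case
  proof (rule higher_differentiable_on_SucI[OF assms(1) der])
    fix v
    show "higher_differentiable_on S (\<lambda>x. \<Sum>b\<in>Basis. (?F x v \<bullet> b) *\<^sub>R ?G x b) n"
    proof (rule higher_differentiable_on_sum[OF assms(1)])
      fix b :: 'b
      have "higher_differentiable_on S (\<lambda>x. ?F x v \<bullet> b) n"
        by (rule higher_differentiable_on_linear[OF bounded_linear_inner_left assms(1)])
           (use Suc.prems in auto)
      moreover have "higher_differentiable_on S (\<lambda>x. ?G x b) n"
        by (rule Suc.IH) (use Suc.prems higher_differentiable_on_SucD[OF Suc.prems(1)] in auto)
      ultimately show "higher_differentiable_on S (\<lambda>x. (?F x v \<bullet> b) *\<^sub>R ?G x b) n"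
        by (rule higher_differentiable_on_bilinear[OF bounded_bilinear_scaleR assms(1)])
    qed
  qed
qed

lemma smooth_on_const [simp]: "smooth_on S (\<lambda>x. c)"
  by (simp add: smooth_on_def higher_differentiable_on_const)

lemma higher_differentiable_on_ident: "open S \<Longrightarrow> higher_differentiable_on S (\<lambda>x. x) n"
  by (cases n) (auto simp: frechet_derivative_ident higher_differentiable_on_const)

lemma smooth_on_ident: "open S \<Longrightarrow> smooth_on S (\<lambda>x. x)"
  by (simp add: smooth_on_def higher_differentiable_on_ident)

lemma smooth_on_linear: "bounded_linear L \<Longrightarrow> open S \<Longrightarrow> smooth_on S f \<Longrightarrow> smooth_on S (\<lambda>x. L (f x))"
  by (simp add: smooth_on_def higher_differentiable_on_linear)

lemma smooth_on_add:
  "open S \<Longrightarrow> smooth_on S f \<Longrightarrow> smooth_on S g \<Longrightarrow> smooth_on S (\<lambda>x. f x + g x)"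
  by (simp add: smooth_on_def higher_differentiable_on_add)

lemma smooth_on_sum:
  "open S \<Longrightarrow> (\<And>i. i \<in> A \<Longrightarrow> smooth_on S (f i)) \<Longrightarrow> smooth_on S (\<lambda>x. \<Sum>i\<in>A. f i x)"
  by (simp add: smooth_on_def higher_differentiable_on_sum)

lemma smooth_on_scaleR:
  "open S \<Longrightarrow> smooth_on S f \<Longrightarrow> smooth_on S g \<Longrightarrow> smooth_on S (\<lambda>x. f x *\<^sub>R g x)"
  by (simp add: smooth_on_def higher_differentiable_on_bilinear[OF bounded_bilinear_scaleR])

lemma smooth_on_mult:
  fixes f g :: "'a::real_normed_vector \<Rightarrow> real"
  shows "open S \<Longrightarrow> smooth_on S f \<Longrightarrow> smooth_on S g \<Longrightarrow> smooth_on S (\<lambda>x. f x * g x)"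
  using smooth_on_scaleR[of S f g] by simp

lemma smooth_on_minus: "open S \<Longrightarrow> smooth_on S f \<Longrightarrow> smooth_on S (\<lambda>x. - f x)"
  using smooth_on_linear[OF bounded_linear_minus[OF bounded_linear_ident]] by blast

lemma smooth_on_diff:
  "open S \<Longrightarrow> smooth_on S f \<Longrightarrow> smooth_on S g \<Longrightarrow> smooth_on S (\<lambda>x. f x - g x)"
  using smooth_on_add[of S f "\<lambda>x. - g x"] smooth_on_minus[of S g] by simp

lemma smooth_on_power:
  fixes f :: "'a::real_normed_vector \<Rightarrow> real"
  shows "open S \<Longrightarrow> smooth_on S f \<Longrightarrow> smooth_on S (\<lambda>x. f x ^ n)"
  by (induction n) (auto intro: smooth_on_mult)

lemma smooth_on_compose:
  fixes f :: "'a::real_normed_vector \<Rightarrow> 'b::euclidean_space"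
  shows "open S \<Longrightarrow> open T \<Longrightarrow> f ` S \<subseteq> T \<Longrightarrow> smooth_on S f \<Longrightarrow> smooth_on T g
    \<Longrightarrow> smooth_on S (\<lambda>x. g (f x))"
  unfolding smooth_on_def using higher_differentiable_on_compose by blast

lemma smooth_on_Pair:
  assumes "open S" "smooth_on S f" "smooth_on S g"
  shows "smooth_on S (\<lambda>x. (f x, g x))"
proof -
  have "smooth_on S (\<lambda>x. (f x, 0) + (0, g x))"
    using smooth_on_linear[OF bounded_linear_Pair[OF bounded_linear_ident bounded_linear_zero], of S f]
      smooth_on_linear[OF bounded_linear_Pair[OF bounded_linear_zero bounded_linear_ident], of S g] assms
    by (intro smooth_on_add) auto
  then show ?thesis by simp
qed

text \<open>For functions of a real variable this lets regularity be bootstrapped: whatever makes the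
  derivative as regular as the function itself makes the function smooth.\<close>

lemma higher_differentiable_on_vector_derivativeI:
  assumes "open S" "\<And>t. t \<in> S \<Longrightarrow> (f has_vector_derivative f' t) (at t)"
    "higher_differentiable_on S f' n"
  shows "higher_differentiable_on S f (Suc n)"
proof (rule higher_differentiable_on_SucI[where f' = "\<lambda>t h. h *\<^sub>R f' t", OF assms(1)])
  show "(f has_derivative (\<lambda>h. h *\<^sub>R f' t)) (at t)" if "t \<in> S" for t
    using assms(2)[OF that] by (simp add: has_vector_derivative_def)
  show "higher_differentiable_on S (\<lambda>t. v *\<^sub>R f' t) n" for v
    by (rule higher_differentiable_on_linear[OF bounded_linear_scaleR_right assms(1,3)])
qed

lemma smooth_on_vector_derivative:
  assumes "open S" "smooth_on S f"
  shows "smooth_on S (\<lambda>t. vector_derivative f (at t))"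
    and "t \<in> S \<Longrightarrow> (f has_vector_derivative vector_derivative f (at t)) (at t)"
proof -
  have d: "(f has_vector_derivative frechet_derivative f (at t) 1) (at t)" if "t \<in> S" for t
  proof -
    let ?D = "frechet_derivative f (at t)"
    have D: "(f has_derivative ?D) (at t)"
      using smooth_on_has_derivative[OF assms(2) that] .
    have "?D h = h *\<^sub>R ?D 1" for h
      using linear_cmul[OF has_derivative_linear[OF D], of h 1] by simp
    then have "?D = (\<lambda>h. h *\<^sub>R ?D 1)" ..
    with D show ?thesis
      unfolding has_vector_derivative_def by simp
  qed
  show "t \<in> S \<Longrightarrow> (f has_vector_derivative vector_derivative f (at t)) (at t)"
    using d vector_derivative_works differentiableI_vector by blast
  show "smooth_on S (\<lambda>t. vector_derivative f (at t))"
    by (rule smooth_on_cong[OF assms(1) _ smooth_on_frechet_derivative[OF assms(2), of 1]])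
       (metis d vector_derivative_at)
qed

lemma smooth_on_deriv:
  fixes f :: "real \<Rightarrow> real"
  assumes "open S" "smooth_on S f"
  shows "smooth_on S (deriv f)"
    and "t \<in> S \<Longrightarrow> (f has_field_derivative deriv f t) (at t)"
proof -
  show d: "t \<in> S \<Longrightarrow> (f has_field_derivative deriv f t) (at t)" for t
    using smooth_on_vector_derivative(2)[OF assms] 
    by (metis DERIV_imp_deriv has_real_derivative_iff_has_vector_derivative)
  show "smooth_on S (deriv f)"
    by (rule smooth_on_cong[OF assms(1) _ smooth_on_vector_derivative(1)[OF assms]])
      (metis d has_real_derivative_iff_has_vector_derivative vector_derivative_at)
qed

lemma higher_differentiable_on_powr: "higher_differentiable_on {0<..} (\<lambda>x::real. x powr a) n"
proof (induction n arbitrary: a)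
  case 0
  then show ?case by (auto intro!: continuous_intros)
next
  case (Suc n)
  have "((\<lambda>x. x powr a) has_vector_derivative a * x powr (a - 1)) (at x)" if "x \<in> {0<..}" for x :: real
    using has_real_derivative_powr[of x a] that has_real_derivative_iff_has_vector_derivative by auto
  then show ?case
    by (rule higher_differentiable_on_vector_derivativeI[rotated])
      (auto intro: higher_differentiable_on_linear[OF bounded_linear_mult_right _ Suc.IH])
qed

lemma smooth_on_powr:
  fixes f :: "'a::real_normed_vector \<Rightarrow> real"
  assumes "open S" "smooth_on S f" "\<And>x. x \<in> S \<Longrightarrow> f x > 0"
  shows "smooth_on S (\<lambda>x. f x powr a)"
  using assms higher_differentiable_on_powr
  by (intro smooth_on_compose[of S "{0<..}" f "\<lambda>x. x powr a"]) (auto simp: smooth_on_def)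

lemma smooth_on_divide:
  fixes f g :: "'a::real_normed_vector \<Rightarrow> real"
  assumes "open S" "smooth_on S f" "smooth_on S g" "\<And>x. x \<in> S \<Longrightarrow> g x > 0"
  shows "smooth_on S (\<lambda>x. f x / g x)"
proof (rule smooth_on_cong[OF assms(1)])
  show "smooth_on S (\<lambda>x. f x * g x powr - 1)"
    using assms by (intro smooth_on_mult smooth_on_powr) auto
  show "f x * g x powr - 1 = f x / g x" if "x \<in> S" for x
    using assms(4)[OF that] by (simp add: powr_minus_divide)
qed

section \<open>Moment integrals and Hadamard quotients\<close>

lemma shrink_mem:
  fixes t :: real
  assumes "t \<in> {-d<..<d}" "v \<in> {0..1}"
  shows "t * v \<in> {-d<..<d}"
proof -
  have "\<bar>t * v\<bar> \<le> \<bar>t\<bar>"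
    using assms by (auto simp: abs_mult intro: mult_left_le)
  then show ?thesis using assms by auto
qed

lemma has_real_derivative_shrink:
  assumes "smooth_on {-d<..<d} f" "t \<in> {-d<..<d}" "v \<in> {0..1}"
  shows "((\<lambda>t. f (t * v)) has_real_derivative v * deriv f (t * v)) (at t)"
    and "((\<lambda>v. f (t * v)) has_real_derivative t * deriv f (t * v)) (at v)"
proof -
  have f: "(f has_real_derivative deriv f (t * v)) (at (t * v))"
    using smooth_on_deriv(2)[OF _ assms(1) shrink_mem[OF assms(2,3)]] by simp
  have A: "((\<lambda>t. t * v) has_real_derivative v) (at t)" "((\<lambda>v. t * v) has_real_derivative t) (at v)"
    by (auto intro!: derivative_eq_intros)
  show "((\<lambda>t. f (t * v)) has_real_derivative v * deriv f (t * v)) (at t)"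
    using DERIV_chain2[where f = f and g = "\<lambda>t. t * v" and x = t, OF f A(1)] by (simp add: mult.commute)
  show "((\<lambda>v. f (t * v)) has_real_derivative t * deriv f (t * v)) (at v)"
    using DERIV_chain2[where f = f and g = "\<lambda>v. t * v" and x = v, OF f A(2)] by (simp add: mult.commute)
qed

text \<open>Differentiating under the integral sign replaces the weight \<open>w v\<close> by \<open>v * w v\<close> and \<open>f\<close> by its
  derivative, so one induction over all continuous weights gives smoothness.\<close>

lemma has_real_derivative_moment:
  fixes f w :: "real \<Rightarrow> real"
  assumes w: "continuous_on {0..1} w" and f: "smooth_on {-d<..<d} f" and t: "t \<in> {-d<..<d}"
  shows "((\<lambda>t. integral {0..1} (\<lambda>v. w v * f (t * v))) has_real_derivative
    integral {0..1} (\<lambda>v. v * w v * deriv f (t * v))) (at t)"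
proof -
  let ?I = "{-d<..<d}"
  note mem = shrink_mem[of _ d]
  have f': "continuous_on ?I (deriv f)" "continuous_on ?I f"
    using smooth_on_continuous smooth_on_deriv(1)[OF _ f] f by auto
  have "((\<lambda>x. integral (cbox 0 1) (\<lambda>v. w v * f (x * v))) has_real_derivative
      integral (cbox 0 1) (\<lambda>v. v * w v * deriv f (t * v))) (at t within ?I)"
  proof (rule leibniz_rule_field_derivative)
    show "((\<lambda>x. w v * f (x * v)) has_real_derivative v * w v * deriv f (x * v)) (at x within ?I)"
      if "x \<in> ?I" "v \<in> cbox 0 1" for x v
      using has_field_derivative_at_within[OF
          DERIV_cmult[OF has_real_derivative_shrink(1)[OF f that(1)], of v "w v"]] that
      by (simp add: mult_ac)
    show "(\<lambda>v. w v * f (x * v)) integrable_on cbox 0 1" if "x \<in> ?I" for x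
      unfolding box_real using that mem
      by (intro integrable_continuous_real continuous_intros w continuous_on_compose2[OF f'(2)]) auto
    show "continuous_on (?I \<times> cbox 0 1) (\<lambda>(x, v). v * w v * deriv f (x * v))"
      unfolding split_beta box_real using mem
      by (intro continuous_intros continuous_on_compose2[OF w] continuous_on_compose2[OF f'(1)]) auto
  qed (use t in auto)
  then show ?thesis
    using t at_within_open[of t ?I] by simp
qed

lemma smooth_on_moment:
  fixes f w :: "real \<Rightarrow> real"
  assumes "continuous_on {0..1} w" "smooth_on {-d<..<d} f"
  shows "smooth_on {-d<..<d} (\<lambda>t. integral {0..1} (\<lambda>v. w v * f (t * v)))"
proof -
  have "higher_differentiable_on {-d<..<d} (\<lambda>t. integral {0..1} (\<lambda>v. w v * f (t * v))) n" for n
    using assms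
  proof (induction n arbitrary: w f)
    case 0
    then have "isCont (\<lambda>t. integral {0..1} (\<lambda>v. w v * f (t * v))) t" if "t \<in> {-d<..<d}" for t
      using has_real_derivative_moment[of w d f] that DERIV_isCont by blast
    then show ?case by (simp add: continuous_at_imp_continuous_on)
  next
    case (Suc n)
    have "((\<lambda>t. integral {0..1} (\<lambda>v. w v * f (t * v))) has_vector_derivative
        integral {0..1} (\<lambda>v. v * w v * deriv f (t * v))) (at t)" if "t \<in> {-d<..<d}" for t
      using has_real_derivative_moment[OF Suc.prems that]
      by (simp add: has_real_derivative_iff_has_vector_derivative)
    then show ?case
    proof (rule higher_differentiable_on_vector_derivativeI[rotated])
      show "higher_differentiable_on {-d<..<d} (\<lambda>t. integral {0..1} (\<lambda>v. v * w v * deriv f (t * v))) n"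
        using Suc.prems smooth_on_deriv(1)
        by (intro Suc.IH) (auto intro!: continuous_intros)
    qed auto
  qed
  then show ?thesis by (simp add: smooth_on_def)
qed

text \<open>The quotient is the average of \<open>f'\<close> over the segment from \<open>0\<close> to \<open>t\<close>.\<close>

lemma hadamard_quotient:
  fixes f :: "real \<Rightarrow> real"
  assumes f: "smooth_on {-d<..<d} f"
  obtains g where "smooth_on {-d<..<d} g" "\<And>t. t \<in> {-d<..<d} \<Longrightarrow> f t = f 0 + t * g t"
proof
  let ?g = "\<lambda>t. integral {0..1} (\<lambda>v. 1 * deriv f (t * v))"
  show "smooth_on {-d<..<d} ?g"
    using f smooth_on_deriv(1) by (intro smooth_on_moment) auto
  fix t assume t: "t \<in> {-d<..<d}"
  have "((\<lambda>v. f (t * v)) has_vector_derivative t * deriv f (t * v)) (at v within {0..1})"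
    if v: "v \<in> {0..1}" for v
    using has_real_derivative_shrink(2)[OF f t v]
    by (simp add: has_real_derivative_iff_has_vector_derivative has_vector_derivative_at_within)
  then have "((\<lambda>v. t * deriv f (t * v)) has_integral f (t * 1) - f (t * 0)) {0..1}"
    by (intro fundamental_theorem_of_calculus) auto
  from integral_unique[OF this] show "f t = f 0 + t * ?g t"
    by simp
qed

section \<open>Arclength and curvature near an inflection point\<close>

text \<open>The weight \<open>v powr (1/3)\<close> is what the substitution \<open>u = t * v\<close> produces from the arclength
  integrand \<open>\<bar>u\<bar> powr (1/3) * g u\<close>.\<close>

definition cube_root_moment :: "(real \<Rightarrow> real) \<Rightarrow> real \<Rightarrow> real" where
  "cube_root_moment g t = integral {0..1} (\<lambda>v. v powr (1/3) * g (t * v))"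

lemma continuous_on_cube_root_weight: "continuous_on {0..1::real} (\<lambda>v. v powr (1/3))"
  by (intro continuous_on_powr' continuous_intros) auto

lemma smooth_on_cube_root_moment:
  "smooth_on {-d<..<d} g \<Longrightarrow> smooth_on {-d<..<d} (cube_root_moment g)"
  unfolding cube_root_moment_def[abs_def]
  by (rule smooth_on_moment[OF continuous_on_cube_root_weight])

text \<open>Integration by parts turns the moment integral into a first-order linear equation, from which
  its Taylor coefficients at \<open>0\<close> can be read off.\<close>

lemma cube_root_moment_ode:
  assumes g: "smooth_on {-d<..<d} g" and t: "t \<in> {-d<..<d}"
  shows "4/3 * cube_root_moment g t + t * deriv (cube_root_moment g) t = g t"
proof -
  note mem = shrink_mem[OF t]
  note cw = continuous_on_cube_root_weight
  have cg: "continuous_on {0..1} (\<lambda>v. g (t * v))" "continuous_on {0..1} (\<lambda>v. deriv g (t * v))"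
    using mem smooth_on_continuous[OF g] smooth_on_continuous[OF smooth_on_deriv(1)[OF _ g]]
    by (auto intro!: continuous_on_compose2[of "{-d<..<d}" _ "{0..1}" "\<lambda>v. t * v"] continuous_intros)
  have "((\<lambda>v. 4/3 * (v powr (1/3) * g (t * v)) + t * (v * v powr (1/3) * deriv g (t * v)))
      has_integral 1 * 1 powr (1/3) * g (t * 1) - 0 * 0 powr (1/3) * g (t * 0)) {0..1}"
  proof (rule fundamental_theorem_of_calculus_interior)
    show "continuous_on {0..1} (\<lambda>v. v * v powr (1/3) * g (t * v))"
      by (intro continuous_intros cg cw)
    fix v :: real assume v: "v \<in> {0<..<1}"
    have *: "((\<lambda>v. v * v powr (1/3)) has_real_derivative 4/3 * v powr (1/3)) (at v)"
    proof -
      have "((\<lambda>v. v * v powr (1/3)) has_real_derivative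
          1 * v powr (1/3) + (1/3) * v powr (1/3 - 1) * v) (at v)"
        using v by (intro DERIV_mult DERIV_ident has_real_derivative_powr) auto
      moreover have "v powr (1/3 - 1) * v = v powr (1/3)"
        using v powr_mult_base[of v "1/3 - 1"] by (simp add: mult.commute)
      ultimately show ?thesis by (simp add: mult.assoc)
    qed
    from DERIV_mult[OF * has_real_derivative_shrink(2)[OF g t]] v
    show "((\<lambda>v. v * v powr (1/3) * g (t * v)) has_vector_derivative
        4/3 * (v powr (1/3) * g (t * v)) + t * (v * v powr (1/3) * deriv g (t * v))) (at v)"
      unfolding has_real_derivative_iff_has_vector_derivative[symmetric] by (simp add: mult_ac add_ac)
  qed auto
  from integral_unique[OF this] have 1: "integral {0..1} (\<lambda>v. 4/3 * (v powr (1/3) * g (t * v)) +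
      t * (v * v powr (1/3) * deriv g (t * v))) = g t"
    by simp
  have "(\<lambda>v. v powr (1/3) * g (t * v)) integrable_on {0..1}"
    "(\<lambda>v. v * v powr (1/3) * deriv g (t * v)) integrable_on {0..1}"
    by (intro integrable_continuous_real continuous_intros cg cw)+
  then have "integral {0..1} (\<lambda>v. 4/3 * (v powr (1/3) * g (t * v)) +
      t * (v * v powr (1/3) * deriv g (t * v))) = 4/3 * cube_root_moment g t
      + t * integral {0..1} (\<lambda>v. v * v powr (1/3) * deriv g (t * v))"
    unfolding cube_root_moment_def
    by (subst integral_add) (auto intro: integrable_on_mult_right)
  also have "integral {0..1} (\<lambda>v. v * v powr (1/3) * deriv g (t * v)) = deriv (cube_root_moment g) t"
    unfolding cube_root_moment_def[abs_def]
    by (rule DERIV_imp_deriv[symmetric], rule has_real_derivative_moment[OF cw g t])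
  finally show ?thesis using 1 by simp
qed

lemma cube_root_moment_pos:
  assumes g: "smooth_on {-d<..<d} g" and t: "t \<in> {-d<..<d}" and pos: "\<And>u. u \<in> {-d<..<d} \<Longrightarrow> g u > 0"
  shows "cube_root_moment g t > 0"
proof -
  note mem = shrink_mem[OF t]
  have c: "continuous_on {0..1} (\<lambda>v. v powr (1/3) * g (t * v))"
  proof (rule continuous_on_mult[OF continuous_on_cube_root_weight])
    show "continuous_on {0..1} (\<lambda>v. g (t * v))"
      using mem by (intro continuous_on_compose2[OF smooth_on_continuous[OF g], of "{0..1}" "\<lambda>v. t * v"])
        (auto intro: continuous_intros)
  qed
  have nonneg: "0 \<le> v powr (1/3) * g (t * v)" if "v \<in> {0..1}" for v
    using pos[OF mem[OF that]] by simp
  have "cube_root_moment g t \<ge> 0"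
    unfolding cube_root_moment_def
    using nonneg by (intro integral_nonneg integrable_continuous_real c) auto
  moreover have "cube_root_moment g t \<noteq> 0"
  proof
    assume "cube_root_moment g t = 0"
    then have "((\<lambda>v. v powr (1/3) * g (t * v)) has_integral 0) (cbox 0 1)"
      unfolding cube_root_moment_def box_real
      using integrable_integral[OF integrable_continuous_real[OF c]] by simp
    then have "1 powr (1/3) * g (t * 1) = 0"
      using has_integral_0_cbox_imp_0[of 0 1 "\<lambda>v. v powr (1/3) * g (t * v)" 1] c nonneg by auto
    then show False using pos[OF t] by simp
  qed
  ultimately show ?thesis by linarith
qed

text \<open>The function is \<open>sgn t * \<bar>t\<bar> powr (4/3)\<close>; in this form the derivative is given by one expression
  on both sides of \<open>0\<close> and at \<open>0\<close>.\<close>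

lemma has_real_derivative_signed_four_thirds:
  "((\<lambda>t::real. t * \<bar>t\<bar> powr (1/3)) has_real_derivative 4/3 * \<bar>t\<bar> powr (1/3)) (at t)"
proof (cases "t = 0")
  case True
  have "((\<lambda>h::real. \<bar>h\<bar> powr (1/3)) \<longlongrightarrow> \<bar>0\<bar> powr (1/3)) (at 0)"
    by (intro tendsto_powr' tendsto_intros) auto
  then have "((\<lambda>h::real. \<bar>h\<bar> powr (1/3)) \<longlongrightarrow> 0) (at 0)"
    by simp
  then have "((\<lambda>h::real. (h * \<bar>h\<bar> powr (1/3)) / h) \<longlongrightarrow> 0) (at 0)"
    by (rule Lim_transform_eventually) (auto simp: eventually_at_filter)
  then show ?thesis using True by (simp add: DERIV_def)
next
  case False
  define s where "s = sgn t"
  define S where "S = {u. s * u > 0}"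
  have "open S"
    unfolding S_def by (intro open_Collect_less continuous_intros)
  have s: "s * u = \<bar>u\<bar>" if "u \<in> S" for u
    using that False by (auto simp: S_def s_def sgn_if zero_less_mult_iff split: if_splits)
  have t: "t \<in> S" using False by (auto simp: S_def s_def sgn_if)
  have "((\<lambda>u. (s * u) powr (1/3)) has_real_derivative (1/3) * (s * t) powr (1/3 - 1) * s) (at t)"
    using t by (intro DERIV_chain2[OF has_real_derivative_powr])
      (auto simp: S_def intro!: derivative_eq_intros)
  from DERIV_mult[OF DERIV_ident this]
  have "((\<lambda>u. u * (s * u) powr (1/3)) has_real_derivative
      (s * t) powr (1/3) + (1/3) * (s * t * (s * t) powr (1/3 - 1))) (at t)"
    by (simp add: mult_ac)
  also have "s * t * (s * t) powr (1/3 - 1) = (s * t) powr (1/3)"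
    using t powr_mult_base[of "s * t" "1/3 - 1"] by (simp add: S_def)
  finally have "((\<lambda>u. u * (s * u) powr (1/3)) has_real_derivative 4/3 * \<bar>t\<bar> powr (1/3)) (at t)"
    using s[OF t] by simp
  then show ?thesis
    by (rule has_field_derivative_transform_within_open[OF _ \<open>open S\<close> t]) (simp add: s)
qed

lemma LBINT_cube_root:
  assumes g: "smooth_on {-d<..<d} g" and t: "t \<in> {-d<..<d}"
  shows "(LBINT u=0..ereal t. \<bar>u\<bar> powr (1/3) * g u) = t * \<bar>t\<bar> powr (1/3) * cube_root_moment g t"
proof -
  let ?k = "cube_root_moment g"
  let ?J = "{min 0 t..max 0 t}"
  have J: "?J \<subseteq> {-d<..<d}" using t by auto
  have "(LBINT u=ereal 0..ereal t. \<bar>u\<bar> powr (1/3) * g u) =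
      t * \<bar>t\<bar> powr (1/3) * ?k t - 0 * \<bar>0\<bar> powr (1/3) * ?k 0"
  proof (rule interval_integral_FTC_finite)
    show "continuous_on ?J (\<lambda>u. \<bar>u\<bar> powr (1/3) * g u)"
      by (intro continuous_intros continuous_on_powr' continuous_on_subset[OF smooth_on_continuous[OF g] J]) auto
    fix x assume "min 0 t \<le> x" "x \<le> max 0 t"
    then have x: "x \<in> {-d<..<d}" using J by auto
    have "(?k has_real_derivative deriv ?k x) (at x)"
      using smooth_on_deriv(2)[OF _ smooth_on_cube_root_moment[OF g]] x by simp
    from DERIV_mult[OF has_real_derivative_signed_four_thirds this]
    have "((\<lambda>x. x * \<bar>x\<bar> powr (1/3) * ?k x) has_real_derivative
        \<bar>x\<bar> powr (1/3) * (4/3 * ?k x + x * deriv ?k x)) (at x)"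
      by (simp add: algebra_simps)
    then show "((\<lambda>x. x * \<bar>x\<bar> powr (1/3) * ?k x) has_vector_derivative \<bar>x\<bar> powr (1/3) * g x)
        (at x within ?J)"
      using cube_root_moment_ode[OF g x] 
      by (simp add: has_real_derivative_iff_has_vector_derivative has_vector_derivative_at_within)
  qed
  then show ?thesis by (simp add: zero_ereal_def)
qed

text \<open>When the bracket is \<open>t\<close> times a cube up to sign, its cube root in the arclength integrand is smooth
  apart from the factor \<open>\<bar>u\<bar> powr (1/3)\<close>.\<close>

lemma affine_arclength_cube:
  assumes "smooth_on {-d<..<d} g" "\<And>u. u \<in> {-d<..<d} \<Longrightarrow> g u > 0"
    and a: "\<And>u. u \<in> {-d<..<d} \<Longrightarrow> \<bar>br M \<gamma> 1 2 u\<bar> = \<bar>u\<bar> * g u ^ 3" and t: "t \<in> {-d<..<d}"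
  shows "affine_arclength M \<gamma> t = t * \<bar>t\<bar> powr (1/3) * cube_root_moment g t"
    and "arclength34 M \<gamma> t = t * cube_root_moment g t powr (3/4)"
proof -
  have "affine_arclength M \<gamma> t = (LBINT u=0..ereal t. \<bar>u\<bar> powr (1/3) * g u)"
    unfolding affine_arclength_def
  proof (rule interval_integral_cong)
    fix u assume "u \<in> einterval (min 0 (ereal t)) (max 0 (ereal t))"
    then have u: "u \<in> {-d<..<d}"
      using t by (auto simp: einterval_def min_def max_def zero_ereal_def split: if_splits)
    have "(g u ^ 3) powr (1/3) = g u"
      using assms(2)[OF u] by (simp add: powr_powr flip: powr_numeral)
    then show "\<bar>br M \<gamma> 1 2 u\<bar> powr (1/3) = \<bar>u\<bar> powr (1/3) * g u"
      using a[OF u] assms(2)[OF u] by (simp add: powr_mult)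
  qed
  then show *: "affine_arclength M \<gamma> t = t * \<bar>t\<bar> powr (1/3) * cube_root_moment g t"
    using LBINT_cube_root[OF assms(1) t] by simp
  have k: "cube_root_moment g t > 0"
    by (rule cube_root_moment_pos[OF assms(1) t assms(2)])
  have "\<bar>t\<bar> * \<bar>t\<bar> powr (1/3) = \<bar>t\<bar> powr (4/3)"
    using powr_mult_base[of "\<bar>t\<bar>" "1/3"] by simp
  then have "\<bar>affine_arclength M \<gamma> t\<bar> = \<bar>t\<bar> powr (4/3) * cube_root_moment g t"
    using k by (simp add: * abs_mult)
  then have e: "\<bar>affine_arclength M \<gamma> t\<bar> powr (3/4) = \<bar>t\<bar> * cube_root_moment g t powr (3/4)"
    using k by (simp add: powr_mult powr_powr)
  then show "arclength34 M \<gamma> t = t * cube_root_moment g t powr (3/4)"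
    unfolding arclength34_def e by (simp add: mult_sgn_abs flip: mult.assoc)
qed

text \<open>The square of the arclength and the denominator of the affine curvature share the factor
  \<open>\<bar>t\<bar> powr (8/3)\<close>. What is left is smooth across \<open>t = 0\<close>.\<close>

lemma normalized_curvature_cube:
  assumes "smooth_on {-d<..<d} g" "\<And>u. u \<in> {-d<..<d} \<Longrightarrow> g u > 0"
    and a: "\<And>u. u \<in> {-d<..<d} \<Longrightarrow> \<bar>br M \<gamma> 1 2 u\<bar> = \<bar>u\<bar> * g u ^ 3" and t: "t \<in> {-d<..<d}" "t \<noteq> 0"
  shows "normalized_curvature M \<gamma> t = (cube_root_moment g t)\<^sup>2 *
    (3 * br M \<gamma> 1 2 t * br M \<gamma> 1 4 t + 12 * br M \<gamma> 1 2 t * br M \<gamma> 2 3 t - 5 * (br M \<gamma> 1 3 t)\<^sup>2)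
      / (9 * g t ^ 8)"
proof -
  have g: "g t > 0" using assms(2) t(1) .
  have "\<bar>t * \<bar>t\<bar> powr (1/3)\<bar> = \<bar>t\<bar> powr (4/3)"
    using powr_mult_base[of "\<bar>t\<bar>" "1/3"] by (simp add: abs_mult)
  then have "(t * \<bar>t\<bar> powr (1/3))\<^sup>2 = (\<bar>t\<bar> powr (4/3))\<^sup>2"
    by (metis power2_abs)
  also have "\<dots> = \<bar>t\<bar> powr (8/3)"
    by (simp add: power2_eq_square flip: powr_add)
  finally have "(t * \<bar>t\<bar> powr (1/3))\<^sup>2 = \<bar>t\<bar> powr (8/3)" .
  then have s: "(affine_arclength M \<gamma> t)\<^sup>2 = \<bar>t\<bar> powr (8/3) * (cube_root_moment g t)\<^sup>2"
  proof -
    have "affine_arclength M \<gamma> t = t * \<bar>t\<bar> powr (1/3) * cube_root_moment g t"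
      by (rule affine_arclength_cube(1)[where d = d]) (use assms in auto)
    with \<open>(t * \<bar>t\<bar> powr (1/3))\<^sup>2 = \<bar>t\<bar> powr (8/3)\<close> show ?thesis
      by (simp only: power_mult_distrib)
  qed
  have "(g t ^ 3) powr (8/3) = g t ^ 8"
    using g by (simp add: powr_powr flip: powr_numeral)
  then have "\<bar>br M \<gamma> 1 2 t\<bar> powr (8/3) = \<bar>t\<bar> powr (8/3) * g t ^ 8"
    using a[OF t(1)] g by (simp add: powr_mult)
  then show ?thesis
    using t(2) g unfolding normalized_curvature_def affine_curvature_def s by (simp add: field_simps)
qed

text \<open>The derivative of the inverse is \<open>1 / \<tau>'\<close> composed with the inverse itself, so its regularity
  is bootstrapped.\<close>

lemma coordinate_onI:
  assumes sm: "smooth_on {-e<..<e} \<tau>" and pos: "\<And>t. t \<in> {-e<..<e} \<Longrightarrow> deriv \<tau> t > 0"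
  obtains \<theta> where "coordinate_on {-e<..<e} \<tau> \<theta>"
proof -
  let ?J = "{-e<..<e}"
  have d: "(\<tau> has_real_derivative deriv \<tau> t) (at t)" if "t \<in> ?J" for t
    using smooth_on_deriv(2)[OF _ sm] that by simp
  have "\<tau> x < \<tau> y" if "x \<in> ?J" "y \<in> ?J" "x < y" for x y
  proof (rule DERIV_pos_imp_increasing[OF that(3)])
    fix z assume "x \<le> z" "z \<le> y"
    then have "z \<in> ?J" using that by auto
    then show "\<exists>D. (\<tau> has_real_derivative D) (at z) \<and> D > 0" using d pos by blast
  qed
  then have inj: "inj_on \<tau> ?J"
    by (metis (no_types, lifting) inj_onI linorder_neqE_linordered_idom less_irrefl)
  have cont: "continuous_on ?J \<tau>" using sm by (rule smooth_on_continuous)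
  have op: "open (\<tau> ` ?J)" using invariance_of_domain[OF cont _ inj] by simp
  obtain \<theta> where hom: "homeomorphism ?J (\<tau> ` ?J) \<tau> \<theta>"
    using invariance_of_domain_homeomorphism[OF _ cont _ inj] by auto
  have \<theta>J: "\<theta> s \<in> ?J" if "s \<in> \<tau> ` ?J" for s
    using hom that unfolding homeomorphism_def by blast
  have \<theta>: "(\<theta> has_real_derivative 1 / deriv \<tau> (\<theta> s)) (at s)" if s: "s \<in> \<tau> ` ?J" for s
  proof -
    obtain r where r: "r > 0" "ball s r \<subseteq> \<tau> ` ?J" using op s open_contains_ball by blast
    have "DERIV \<theta> s :> inverse (deriv \<tau> (\<theta> s))"
    proof (rule DERIV_inverse_function[where f = \<tau> and g = \<theta> and x = s and a = "s - r" and b = "s + r"])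
      show "\<tau> (\<theta> y) = y" if "s - r < y" "y < s + r" for y
      proof -
        have "y \<in> \<tau> ` ?J" using r that by (auto simp: ball_def dist_real_def subset_iff)
        then show ?thesis using hom unfolding homeomorphism_def by blast
      qed
      show "isCont \<theta> s"
        using hom op s continuous_on_eq_continuous_at[OF op] by (metis homeomorphism_cont2)
    qed (use d[OF \<theta>J[OF s]] pos[OF \<theta>J[OF s]] r in auto)
    then show ?thesis by (simp add: inverse_eq_divide)
  qed
  have "higher_differentiable_on (\<tau> ` ?J) \<theta> n" for n
  proof (induction n)
    case 0
    show ?case using hom by (simp add: homeomorphism_def)
  next
    case (Suc n)
    have "smooth_on ?J (\<lambda>t. 1 / deriv \<tau> t)"
      using sm pos by (intro smooth_on_divide smooth_on_deriv(1)) auto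
    moreover have "\<theta> ` (\<tau> ` ?J) \<subseteq> ?J" using \<theta>J by blast
    ultimately have "higher_differentiable_on (\<tau> ` ?J) (\<lambda>s. 1 / deriv \<tau> (\<theta> s)) n"
      using higher_differentiable_on_compose[OF op open_greaterThanLessThan _ Suc, of "-e" e "\<lambda>t. 1 / deriv \<tau> t"]
      unfolding smooth_on_def by blast
    then show ?case
      using \<theta> by (intro higher_differentiable_on_vector_derivativeI[OF op])
        (auto simp: has_real_derivative_iff_has_vector_derivative)
  qed
  then have "coordinate_on ?J \<tau> \<theta>"
    using sm op hom unfolding coordinate_on_def smooth_on_def homeomorphism_def by auto
  then show thesis by (rule that)
qed

section \<open>Second-order jets\<close>

text \<open>The value and the first two derivatives at \<open>0\<close>, as a relation: its rules for products and
  compositions can be chained by resolution, without side conditions about differentiability.\<close>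

definition jet2 :: "(real \<Rightarrow> real) \<Rightarrow> real \<Rightarrow> real \<Rightarrow> real \<Rightarrow> bool" where
  "jet2 f a b c \<longleftrightarrow> f 0 = a \<and> (\<exists>f'. (\<forall>\<^sub>F t in nhds 0. (f has_real_derivative f' t) (at t)) \<and>
     f' 0 = b \<and> (f' has_real_derivative c) (at 0))"

lemma jet2_unique:
  assumes "jet2 f a b c"
  shows "f 0 = a" "deriv f 0 = b" "deriv (deriv f) 0 = c" "(f has_real_derivative b) (at 0)"
proof -
  obtain f' where f': "\<forall>\<^sub>F t in nhds 0. (f has_real_derivative f' t) (at t)"
    "f' 0 = b" "(f' has_real_derivative c) (at 0)"
    using assms unfolding jet2_def by blast
  show "f 0 = a" using assms by (simp add: jet2_def)
  show d: "(f has_real_derivative b) (at 0)"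
    using eventually_nhds_x_imp_x[OF f'(1)] f'(2) by simp
  then show "deriv f 0 = b" by (rule DERIV_imp_deriv)
  have "\<forall>\<^sub>F t in nhds 0. deriv f t = f' t"
    using f'(1) by eventually_elim (rule DERIV_imp_deriv)
  then have "(deriv f has_real_derivative c) (at 0)"
    using f'(3) DERIV_cong_ev[of 0 0 "deriv f" f' c c] by simp
  then show "deriv (deriv f) 0 = c" by (rule DERIV_imp_deriv)
qed

lemma jet2_smooth:
  assumes "open S" "0 \<in> S" "smooth_on S f"
  shows "jet2 f (f 0) (deriv f 0) (deriv (deriv f) 0)"
  unfolding jet2_def
proof (intro conjI exI[of _ "deriv f"])
  show "\<forall>\<^sub>F t in nhds 0. (f has_real_derivative deriv f t) (at t)"
    using smooth_on_deriv(2)[OF assms(1,3)] eventually_nhds_in_open[OF assms(1,2)]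
    by (auto elim: eventually_mono)
  show "(deriv f has_real_derivative deriv (deriv f) 0) (at 0)"
    using smooth_on_deriv(2)[OF assms(1) smooth_on_deriv(1)[OF assms(1,3)] assms(2)] .
qed auto

lemma jet2_cong:
  assumes "open S" "0 \<in> S" "\<And>t. t \<in> S \<Longrightarrow> f t = g t" "jet2 f a b c"
  shows "jet2 g a b c"
proof -
  obtain f' where f': "\<forall>\<^sub>F t in nhds 0. (f has_real_derivative f' t) (at t)"
    "f' 0 = b" "(f' has_real_derivative c) (at 0)" and "f 0 = a"
    using assms(4) unfolding jet2_def by blast
  have "\<forall>\<^sub>F t in nhds 0. (g has_real_derivative f' t) (at t)"
    using f'(1) eventually_nhds_in_open[OF assms(1,2)]
    by eventually_elim (auto intro: has_field_derivative_transform_within_open[OF _ assms(1) _ assms(3)])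
  then show ?thesis
    using f' \<open>f 0 = a\<close> assms(2,3) unfolding jet2_def by auto
qed

lemma jet2_eqI: "jet2 f a b c \<Longrightarrow> a = a' \<Longrightarrow> b = b' \<Longrightarrow> c = c' \<Longrightarrow> jet2 f a' b' c'"
  by simp

lemma jet2_ident: "jet2 (\<lambda>t. t) 0 1 0"
  unfolding jet2_def by (intro conjI exI[of _ "\<lambda>t. 1"]) auto

lemma jet2_add:
  assumes "jet2 f a b c" "jet2 g a' b' c'"
  shows "jet2 (\<lambda>t. f t + g t) (a + a') (b + b') (c + c')"
proof -
  obtain f' g' where f': "\<forall>\<^sub>F t in nhds 0. (f has_real_derivative f' t) (at t)"
    "f' 0 = b" "(f' has_real_derivative c) (at 0)" "f 0 = a"
    and g': "\<forall>\<^sub>F t in nhds 0. (g has_real_derivative g' t) (at t)"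
    "g' 0 = b'" "(g' has_real_derivative c') (at 0)" "g 0 = a'"
    using assms unfolding jet2_def by blast
  have "\<forall>\<^sub>F t in nhds 0. ((\<lambda>t. f t + g t) has_real_derivative f' t + g' t) (at t)"
    using f'(1) g'(1) by eventually_elim (rule DERIV_add)
  then show ?thesis
    unfolding jet2_def using f' g' DERIV_add[OF f'(3) g'(3)]
    by (intro conjI exI[of _ "\<lambda>t. f' t + g' t"]) auto
qed

lemma jet2_mult:
  assumes "jet2 f a b c" "jet2 g a' b' c'"
  shows "jet2 (\<lambda>t. f t * g t) (a * a') (b * a' + a * b') (c * a' + 2 * b * b' + a * c')"
proof -
  obtain f' g' where f': "\<forall>\<^sub>F t in nhds 0. (f has_real_derivative f' t) (at t)"
    "f' 0 = b" "(f' has_real_derivative c) (at 0)" "f 0 = a"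
    and g': "\<forall>\<^sub>F t in nhds 0. (g has_real_derivative g' t) (at t)"
    "g' 0 = b'" "(g' has_real_derivative c') (at 0)" "g 0 = a'"
    using assms unfolding jet2_def by blast
  have 1: "\<forall>\<^sub>F t in nhds 0. ((\<lambda>t. f t * g t) has_real_derivative f' t * g t + g' t * f t) (at t)"
    using f'(1) g'(1) by eventually_elim (rule DERIV_mult)
  have "((\<lambda>t. f' t * g t + g' t * f t) has_real_derivative
      c * g 0 + b' * f' 0 + (c' * f 0 + b * g' 0)) (at 0)"
    using f' g' jet2_unique(4)[OF assms(1)] jet2_unique(4)[OF assms(2)]
    by (intro DERIV_add DERIV_mult) auto
  then have "((\<lambda>t. f' t * g t + g' t * f t) has_real_derivative c * a' + 2 * b * b' + a * c') (at 0)"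
    using f' g' by (simp add: algebra_simps)
  then show ?thesis
    unfolding jet2_def using f' g' 1
    by (intro conjI exI[of _ "\<lambda>t. f' t * g t + g' t * f t"]) (auto simp: mult.commute)
qed

lemma jet2_cmult:
  assumes "jet2 f a b c"
  shows "jet2 (\<lambda>t. s * f t) (s * a) (s * b) (s * c)"
proof -
  have "jet2 (\<lambda>t. s) s 0 0"
    unfolding jet2_def by (intro conjI exI[of _ "\<lambda>t. 0"]) auto
  from jet2_mult[OF this assms] show ?thesis by simp
qed

lemma jet2_square: "jet2 f a b c \<Longrightarrow> jet2 (\<lambda>t. (f t)\<^sup>2) (a\<^sup>2) (2 * a * b) (2 * b\<^sup>2 + 2 * a * c)"
  unfolding power2_eq_square by (rule jet2_eqI[OF jet2_mult]) (assumption | simp add: algebra_simps)+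

lemma jet2_cube:
  assumes "jet2 f a b c"
  shows "jet2 (\<lambda>t. f t ^ 3) (a ^ 3) (3 * a\<^sup>2 * b) (6 * a * b\<^sup>2 + 3 * a\<^sup>2 * c)"
proof -
  have "jet2 (\<lambda>t. f t * (f t)\<^sup>2) (a ^ 3) (3 * a\<^sup>2 * b) (6 * a * b\<^sup>2 + 3 * a\<^sup>2 * c)"
    by (rule jet2_eqI[OF jet2_mult[OF assms jet2_square[OF assms]]])
      (simp_all add: power2_eq_square power3_eq_cube algebra_simps)
  then show ?thesis by (simp add: power2_eq_square power3_eq_cube mult.assoc)
qed

lemma jet2_compose:
  assumes f: "jet2 f a b c" and g: "jet2 g 0 b' c'"
  shows "jet2 (\<lambda>t. f (g t)) a (b * b') (c * b'\<^sup>2 + b * c')"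
proof -
  obtain f' g' where f': "\<forall>\<^sub>F t in nhds 0. (f has_real_derivative f' t) (at t)"
    "f' 0 = b" "(f' has_real_derivative c) (at 0)" "f 0 = a"
    and g': "\<forall>\<^sub>F t in nhds 0. (g has_real_derivative g' t) (at t)"
    "g' 0 = b'" "(g' has_real_derivative c') (at 0)" "g 0 = 0"
    using assms unfolding jet2_def by blast
  have "isCont g 0" using jet2_unique(4)[OF g] by (rule DERIV_isCont)
  then have "filterlim g (nhds (g 0)) (nhds 0)"
    unfolding isCont_def tendsto_at_iff_tendsto_nhds .
  then have "filterlim g (nhds 0) (nhds 0)"
    using g'(4) by simp
  then have "\<forall>\<^sub>F t in nhds 0. (f has_real_derivative f' (g t)) (at (g t))"
    using f'(1) by (rule eventually_compose_filterlim[rotated])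
  then have 1: "\<forall>\<^sub>F t in nhds 0. ((\<lambda>t. f (g t)) has_real_derivative f' (g t) * g' t) (at t)"
    using g'(1) by eventually_elim (rule DERIV_chain2)
  have "((\<lambda>t. f' (g t)) has_real_derivative c * b') (at 0)"
    using f'(3) g'(4) jet2_unique(4)[OF g] DERIV_chain2[of f' c g 0 b'] by simp
  from DERIV_mult[OF this g'(3)] have "((\<lambda>t. f' (g t) * g' t) has_real_derivative c * b'\<^sup>2 + b * c') (at 0)"
    using g' f' by (simp add: power2_eq_square algebra_simps)
  then show ?thesis
    unfolding jet2_def using f' g' 1
    by (intro conjI exI[of _ "\<lambda>t. f' (g t) * g' t"]) auto
qed

text \<open>The equation \<open>4/3 k + t k' = g\<close> says that the \<open>n\<close>-th derivatives at \<open>0\<close> satisfy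
  \<open>(4/3 + n) k\<^sub>n = g\<^sub>n\<close>.\<close>

lemma jet2_cube_root_moment:
  assumes "smooth_on {-d<..<d} g" "0 < d" "jet2 g g0 g1 g2"
  shows "jet2 (cube_root_moment g) (3/4 * g0) (3/7 * g1) (3/10 * g2)"
proof -
  let ?k = "cube_root_moment g"
  have k: "smooth_on {-d<..<d} ?k" by (rule smooth_on_cube_root_moment[OF assms(1)])
  have 1: "jet2 ?k (?k 0) (deriv ?k 0) (deriv (deriv ?k) 0)"
    using k assms(2) by (intro jet2_smooth[of "{-d<..<d}"]) auto
  have 2: "jet2 (deriv ?k) (deriv ?k 0) (deriv (deriv ?k) 0) (deriv (deriv (deriv ?k)) 0)"
    using smooth_on_deriv(1)[OF _ k] assms(2) by (intro jet2_smooth[of "{-d<..<d}"]) auto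
  have "jet2 (\<lambda>t. 4/3 * ?k t + t * deriv ?k t) (4/3 * ?k 0) (7/3 * deriv ?k 0) (10/3 * deriv (deriv ?k) 0)"
    by (rule jet2_eqI[OF jet2_add[OF jet2_cmult[OF 1] jet2_mult[OF jet2_ident 2]]]) simp_all
  then have "jet2 g (4/3 * ?k 0) (7/3 * deriv ?k 0) (10/3 * deriv (deriv ?k) 0)"
    using cube_root_moment_ode[OF assms(1)] assms(2) by (intro jet2_cong[of "{-d<..<d}" _ g]) auto
  from jet2_unique(1-3)[OF this] jet2_unique(1-3)[OF assms(3)] 
  show ?thesis by (intro jet2_eqI[OF 1]) simp_all
qed

text \<open>The hypotheses \<open>e0\<close>, \<open>e1\<close>, \<open>e2\<close> are the equation \<open>9 g\<^sup>8 F = k\<^sup>2 N\<close> and its first two derivatives at the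
  inflection point. In terms of the ratios \<open>x\<close>, \<open>y\<close>, \<open>\<rho>\<close> all powers of \<open>g0\<close> cancel. The coefficient of \<open>y\<close> in
  \<open>F2\<close> turns out to vanish, and \<open>r1\<close> is quadratic in \<open>x\<close> and \<open>\<rho>\<close> up to the factor \<open>q0\<close>; so \<open>F1\<close> is a linear and \<open>F2\<close> a
  quadratic form in \<open>x\<close> and \<open>\<rho>\<close>.\<close>

lemma curvature_jet_identity:
  fixes \<sigma> g0 g1 g2 q0 q1 q2 r0 r1 F0 F1 F2 :: real
  assumes g0: "g0 > 0" and \<sigma>: "\<sigma>\<^sup>2 = 1"
    and q: "q0 = \<sigma> * g0 ^ 3" "q1 = 6 * \<sigma> * g0\<^sup>2 * g1" "q2 = \<sigma> * (18 * g0 * g1\<^sup>2 + 9 * g0\<^sup>2 * g2)"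
    and r1: "q0 * r1 = r0 * (q1 - r0)"
    and N: "N0 = - 5 * q0\<^sup>2" "N1 = 9 * q0 * r0 - 7 * q0 * q1"
      "N2 = 9 * q1 * r0 + 18 * q0 * r1 - 7 * q1\<^sup>2 - 4 * q0 * q2"
    and k: "k0 = 3/4 * g0" "k1 = 3/7 * g1" "k2 = 3/10 * g2"
    and e0: "9 * g0 ^ 8 * F0 = k0\<^sup>2 * N0"
    and e1: "9 * (8 * g0 ^ 7 * g1 * F0 + g0 ^ 8 * F1) = 2 * k0 * k1 * N0 + k0\<^sup>2 * N1"
    and e2: "9 * ((56 * g0 ^ 6 * g1\<^sup>2 + 8 * g0 ^ 7 * g2) * F0 + 2 * (8 * g0 ^ 7 * g1) * F1 + g0 ^ 8 * F2)
      = (2 * k1\<^sup>2 + 2 * k0 * k2) * N0 + 2 * (2 * k0 * k1) * N1 + k0\<^sup>2 * N2"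
  shows "F0 = - 5/16" "F1 = - (9/112) * (q1 - 7 * r0) / q0"
    "- (9/7) * (q1 / q0) * F1 + 32 * F1\<^sup>2 + 9 * F2 = 0" "q1 / q0 = 6 * g1 / g0"
proof -
  define x y \<rho> where "x = g1 / g0" and "y = g2 / g0" and "\<rho> = r0 / q0"
  have nz: "g0 \<noteq> 0" "q0 \<noteq> 0" using g0 \<sigma> q by auto
  have sub: "g1 = g0 * x" "g2 = g0 * y" "r0 = q0 * \<rho>" "q1 = 6 * q0 * x" "q2 = q0 * (18 * x\<^sup>2 + 9 * y)"
    using nz by (auto simp: x_def y_def \<rho>_def q field_simps power2_eq_square power3_eq_cube)
  have "q0 * r1 = q0 * (q0 * \<rho> * (6 * x - \<rho>))"
    using r1 by (simp add: sub algebra_simps)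
  then have r1': "r1 = q0 * \<rho> * (6 * x - \<rho>)" using nz by simp
  have q02: "q0\<^sup>2 = g0 ^ 6" by (simp add: q power_mult_distrib \<sigma>)
  have N': "N0 = - 5 * g0 ^ 6" "N1 = g0 ^ 6 * (9 * \<rho> - 42 * x)"
    "N2 = g0 ^ 6 * (54 * x * \<rho> + 18 * \<rho> * (6 * x - \<rho>) - 252 * x\<^sup>2 - 72 * x\<^sup>2 - 36 * y)"
    unfolding N q02[symmetric] sub r1' by (simp_all add: power2_eq_square algebra_simps)
  have cancel: "u = v" if "9 * g0 ^ 8 * u = 9 * g0 ^ 8 * v" for u v
    using that nz by (metis mult_left_cancel power_not_zero zero_neq_numeral mult_eq_0_iff)
  have "9 * g0 ^ 8 * F0 = 9 * g0 ^ 8 * (- 5/16)"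
    using e0 by (simp add: k N' power2_eq_square eval_nat_numeral)
  then show F0: "F0 = - 5/16" by (rule cancel)
  have "9 * g0 ^ 8 * F1 = 9 * g0 ^ 8 * (- (9/112) * (6 * x - 7 * \<rho>))"
    using e1 unfolding k N' sub F0 by algebra
  then have F1: "F1 = - (9/112) * (6 * x - 7 * \<rho>)" by (rule cancel)
  have "9 * (-(9/7) * 6 * x * F1 + 32 * F1\<^sup>2 + 9 * F2) * g0 ^ 8 = 0"
    using e2 unfolding k N' sub F0 F1 by algebra
  then have F2: "-(9/7) * 6 * x * F1 + 32 * F1\<^sup>2 + 9 * F2 = 0" using nz by simp
  show "F1 = - (9/112) * (q1 - 7 * r0) / q0"
    using nz by (simp add: F1 sub field_simps)
  show "- (9/7) * (q1 / q0) * F1 + 32 * F1\<^sup>2 + 9 * F2 = 0"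
    using F2 nz by (simp add: sub)
  show "q1 / q0 = 6 * g1 / g0" using nz by (simp add: sub)
qed

section \<open>The normalized curvature at a generic inflection point\<close>

lemma positive_near_0:
  fixes f :: "real \<Rightarrow> real"
  assumes "continuous_on {-d<..<d} f" "0 < d" "f 0 > 0"
  obtains e where "0 < e" "e \<le> d" "\<And>t. t \<in> {-e<..<e} \<Longrightarrow> f t > 0"
proof -
  have "isCont f 0"
    using assms(1,2) by (simp add: continuous_on_eq_continuous_at)
  then have "\<forall>\<^sub>F t in nhds 0. f t > 0"
    using assms(3) unfolding isCont_def tendsto_at_iff_tendsto_nhds by (rule order_tendstoD(1))
  then obtain r where "r > 0" "\<And>t. dist t 0 < r \<Longrightarrow> f t > 0"
    unfolding eventually_nhds_metric by blast
  then show thesis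
    using assms(2) by (intro that[of "min r d"]) (auto simp: dist_real_def abs_less_iff)
qed

text \<open>The curve enters only through the Leibniz rules for its brackets and the Pluecker relation. The
  smooth extension of the normalized curvature is \<open>F = k\<^sup>2 N / (9 g\<^sup>8)\<close>. Its derivatives in the coordinate \<open>\<tau>\<close>
  follow from \<open>F = (F \<circ> \<theta>) \<circ> \<tau>\<close>: the linear term of the identity in \<open>t\<close> is the contribution of the
  second derivative of \<open>\<tau>\<close>.\<close>

lemma normalized_curvature_at_inflection:
  fixes M :: "('m, 'i) equi_affine" and \<gamma> :: "real \<Rightarrow> 'm"
  defines "a \<equiv> br M \<gamma> 1 2" and "q \<equiv> br M \<gamma> 1 3" and "r \<equiv> br M \<gamma> 2 3" and "u \<equiv> br M \<gamma> 1 4"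
  assumes d: "0 < d"
    and sm: "smooth_on {-d<..<d} a" "smooth_on {-d<..<d} r"
    and a': "\<And>t. t \<in> {-d<..<d} \<Longrightarrow> (a has_real_derivative q t) (at t)"
    and q': "\<And>t. t \<in> {-d<..<d} \<Longrightarrow> (q has_real_derivative r t + u t) (at t)"
    and r': "(r has_real_derivative r1) (at 0)"
    and infl: "a 0 = 0" "q 0 \<noteq> 0" and pluecker: "q 0 * r1 = r 0 * u 0"
  shows "\<exists>\<epsilon> F \<theta>. 0 < \<epsilon> \<and> \<epsilon> \<le> d \<and>
      coordinate_on {-\<epsilon><..<\<epsilon>} (arclength34 M \<gamma>) \<theta> \<and>
      (\<forall>t\<in>{-\<epsilon><..<\<epsilon>} - {0}. a t \<noteq> 0 \<and> F t = normalized_curvature M \<gamma> t) \<and>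
      smooth_on {-\<epsilon><..<\<epsilon>} F \<and>
      smooth_on (arclength34 M \<gamma> ` {-\<epsilon><..<\<epsilon>}) (F \<circ> \<theta>) \<and>
      - (9/7) * ((u 0 + r 0) / q 0) * deriv F 0 + 32 * (deriv F 0)\<^sup>2 + 9 * (deriv ^^ 2) F 0 = 0 \<and>
      F 0 = - 5/16 \<and>
      32 * (deriv (F \<circ> \<theta>) 0)\<^sup>2 + 9 * (deriv ^^ 2) (F \<circ> \<theta>) 0 = 0 \<and>
      ((\<forall>\<^sub>F t in nhds 0. arclength34 M \<gamma> t = t) \<longrightarrow>
         32 * (deriv F 0)\<^sup>2 + 9 * (deriv ^^ 2) F 0 = 0)" (is ?A)
    and "(normalized_curvature M \<gamma> \<longlongrightarrow> - 5/16) (at 0)" (is ?B)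
    and "((\<lambda>t. (normalized_curvature M \<gamma> t + 5/16) / arclength34 M \<gamma> t) \<longlongrightarrow>
      - (3 * root 4 3 / (28 * sqrt 2)) * inflectional_curvature M \<gamma>) (at 0)" (is ?C)
proof -
  obtain h where h: "smooth_on {-d<..<d} h" "\<And>t. t \<in> {-d<..<d} \<Longrightarrow> a t = a 0 + t * h t"
    using hadamard_quotient[OF sm(1)] by blast
  have h0: "h 0 = q 0"
  proof -
    have "((\<lambda>t. t * h t) has_real_derivative 1 * h 0 + deriv h 0 * 0) (at 0)"
      using d by (intro DERIV_mult DERIV_ident smooth_on_deriv(2)[OF _ h(1)]) auto
    then have "(a has_real_derivative h 0) (at 0)"
      using has_field_derivative_transform_within_open[of "\<lambda>t. t * h t" "h 0" 0 "{-d<..<d}" a]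
        h(2) infl(1) d by auto
    then show ?thesis using a'[of 0] d DERIV_unique by auto
  qed
  define \<sigma> where "\<sigma> = sgn (q 0)"
  have \<sigma>: "\<sigma>\<^sup>2 = 1" "\<bar>\<sigma>\<bar> = 1" "\<sigma> * q 0 = \<bar>q 0\<bar>" "\<sigma> * \<sigma> = 1"
    using infl(2) by (auto simp: \<sigma>_def sgn_if)
  have "smooth_on {-d<..<d} (\<lambda>t. \<sigma> * h t)"
    using h(1) by (intro smooth_on_mult smooth_on_const) auto
  moreover from this obtain d1 where d1: "0 < d1" "d1 \<le> d" "\<And>t. t \<in> {-d1<..<d1} \<Longrightarrow> \<sigma> * h t > 0"
    using positive_near_0[of d "\<lambda>t. \<sigma> * h t"] smooth_on_continuous d h0 \<sigma>(3) infl(2) by auto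
  ultimately have sh: "smooth_on {-d1<..<d1} (\<lambda>t. \<sigma> * h t)"
    by (auto elim: smooth_on_subset)
  let ?I = "{-d1<..<d1}"
  have Id: "?I \<subseteq> {-d<..<d}" "0 \<in> ?I" "open ?I" using d1 by auto
  define g where "g t = (\<sigma> * h t) powr (1/3)" for t
  have g: "smooth_on ?I g" "\<And>t. t \<in> ?I \<Longrightarrow> g t > 0"
    unfolding g_def[abs_def] using smooth_on_powr[OF _ sh d1(3)] d1(3) by force+
  have g3: "g t ^ 3 = \<sigma> * h t" if "t \<in> ?I" for t
    using d1(3)[OF that] by (simp add: g_def powr_powr flip: powr_numeral)
  have ag: "a t = \<sigma> * (t * g t ^ 3)" if "t \<in> ?I" for t
  proof -
    have "\<sigma> * (t * g t ^ 3) = (\<sigma> * \<sigma>) * (t * h t)" unfolding g3[OF that] by (simp only: mult_ac)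
    then show ?thesis using h(2)[of t] that Id(1) infl(1) by (auto simp: \<sigma>)
  qed
  have absa: "\<bar>br M \<gamma> 1 2 t\<bar> = \<bar>t\<bar> * g t ^ 3" if "t \<in> ?I" for t
    using ag[OF that] g(2)[OF that] by (simp add: a_def abs_mult \<sigma>)
  define k where "k = cube_root_moment g"
  have k: "smooth_on ?I k" "\<And>t. t \<in> ?I \<Longrightarrow> k t > 0"
    unfolding k_def using smooth_on_cube_root_moment[OF g(1)] cube_root_moment_pos[OF g(1) _ g(2)] by auto
  define K where "K t = k t powr (3/4)" for t
  have K: "smooth_on ?I K" "\<And>t. t \<in> ?I \<Longrightarrow> K t > 0"
    unfolding K_def[abs_def] using smooth_on_powr[OF _ k] k(2) by force+
  have K4: "K t ^ 4 = k t ^ 3" if "t \<in> ?I" for t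
    using k(2)[OF that] by (simp add: K_def powr_powr flip: powr_numeral)
  define \<tau> where "\<tau> = arclength34 M \<gamma>"
  have \<tau>K: "\<tau> t = t * K t" if "t \<in> ?I" for t
    unfolding \<tau>_def K_def k_def by (rule affine_arclength_cube(2)[OF g absa that])
  have \<tau>: "smooth_on ?I \<tau>"
    by (rule smooth_on_cong[OF _ \<tau>K[symmetric]]) (auto intro!: smooth_on_mult smooth_on_ident K)

  have qd: "smooth_on ?I q" 
    using smooth_on_cong[OF _ _ smooth_on_deriv(1)[OF _ sm(1)]] DERIV_imp_deriv[OF a']
    by (auto intro: smooth_on_subset[OF _ Id(1)])
  have urd: "r t + u t = deriv q t" if "t \<in> ?I" for t
    using DERIV_imp_deriv[OF q'[of t]] that Id(1) by auto
  have smr: "smooth_on ?I r" using sm(2) Id(1) smooth_on_subset by blast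
  define N where "N t = 3 * (a t * deriv q t) + 9 * (a t * r t) - 5 * (q t)\<^sup>2" for t
  have N: "smooth_on ?I N"
    unfolding N_def[abs_def] using smooth_on_subset[OF sm(1) Id(1)] smr qd
    by (intro smooth_on_diff smooth_on_add smooth_on_mult smooth_on_power smooth_on_const smooth_on_deriv(1)) auto
  define F where "F t = (k t)\<^sup>2 * N t / (9 * g t ^ 8)" for t
  have "9 * g t ^ 8 > 0" if "t \<in> ?I" for t using g(2)[OF that] by simp
  then have F: "smooth_on ?I F"
    unfolding F_def[abs_def]
    by (intro smooth_on_divide smooth_on_mult smooth_on_power smooth_on_const k(1) N g(1) Id(3))
  have Fnc: "F t = normalized_curvature M \<gamma> t" if "t \<in> ?I" "t \<noteq> 0" for t
  proof -
    have "N t = 3 * a t * u t + 12 * a t * r t - 5 * (q t)\<^sup>2"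
      unfolding N_def urd[OF that(1), symmetric] by (simp add: algebra_simps)
    then show ?thesis
      unfolding F_def k_def a_def q_def r_def u_def
      using normalized_curvature_cube[OF g absa that] by simp
  qed

  note jet = jet2_smooth[OF Id(3,2)]
  define g0 g1 g2 where "g0 = g 0" and "g1 = deriv g 0" and "g2 = deriv (deriv g) 0"
  define r0 where "r0 = r 0"
  define q0 q1 q2 where "q0 = q 0" and "q1 = deriv q 0" and "q2 = deriv (deriv q) 0"
  define F0 F1 F2 where "F0 = F 0" and "F1 = deriv F 0" and "F2 = deriv (deriv F) 0"
  have jg: "jet2 g g0 g1 g2" unfolding g0_def g1_def g2_def by (rule jet[OF g(1)])
  have jq: "jet2 q q0 q1 q2" unfolding q0_def q1_def q2_def by (rule jet[OF qd])
  have jF: "jet2 F F0 F1 F2" unfolding F0_def F1_def F2_def by (rule jet[OF F])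
  have jr: "jet2 r r0 r1 (deriv (deriv r) 0)"
    unfolding r0_def using jet[OF smr] DERIV_imp_deriv[OF r'] by simp
  have jq': "jet2 (deriv q) q1 q2 (deriv (deriv (deriv q)) 0)"
    unfolding q1_def q2_def using jet[OF smooth_on_deriv(1)[OF Id(3) qd]] .
  have jk: "jet2 k (3/4 * g0) (3/7 * g1) (3/10 * g2)"
    unfolding k_def by (rule jet2_cube_root_moment[OF g(1) d1(1) jg])
  have "jet2 (\<lambda>t. \<sigma> * (t * g t ^ 3)) 0 (\<sigma> * g0 ^ 3) (6 * \<sigma> * g0\<^sup>2 * g1)"
    by (rule jet2_eqI[OF jet2_cmult[OF jet2_mult[OF jet2_ident jet2_cube[OF jg]]]]) simp_all
  then have ja: "jet2 a 0 (\<sigma> * g0 ^ 3) (6 * \<sigma> * g0\<^sup>2 * g1)"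
    by (rule jet2_cong[OF Id(3,2), rotated]) (simp add: ag)
  have q0: "q0 = \<sigma> * g0 ^ 3"
    using jet2_unique(2)[OF ja] DERIV_imp_deriv[OF a'[of 0]] d by (simp add: q0_def)
  \<comment> \<open>This form expresses the jet of \<open>q\<close> by that of \<open>g\<close> alone: the third derivative of \<open>g\<close> enters only
    with the factor \<open>t\<close>.\<close>
  have qg: "q t = \<sigma> * (g t ^ 3 + t * (3 * ((g t)\<^sup>2 * deriv g t)))" if t: "t \<in> ?I" for t
  proof -
    have "(g has_real_derivative deriv g t) (at t)"
      using smooth_on_deriv(2)[OF Id(3) g(1) t] .
    then have "((\<lambda>t. \<sigma> * (t * g t ^ 3)) has_real_derivative
        \<sigma> * (g t ^ 3 + t * (3 * ((g t)\<^sup>2 * deriv g t)))) (at t)"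
      by (auto intro!: derivative_eq_intros simp: algebra_simps power2_eq_square)
    then have "(a has_real_derivative \<sigma> * (g t ^ 3 + t * (3 * ((g t)\<^sup>2 * deriv g t)))) (at t)"
      by (rule has_field_derivative_transform_within_open[OF _ Id(3) t]) (simp add: ag)
    then show ?thesis using a' t Id(1) DERIV_unique by blast
  qed
  have jg': "jet2 (deriv g) g1 g2 (deriv (deriv (deriv g)) 0)"
    unfolding g1_def g2_def using jet[OF smooth_on_deriv(1)[OF Id(3) g(1)]] .
  have "jet2 (\<lambda>t. \<sigma> * (g t ^ 3 + t * (3 * ((g t)\<^sup>2 * deriv g t)))) (\<sigma> * g0 ^ 3)
      (6 * \<sigma> * g0\<^sup>2 * g1) (\<sigma> * (18 * g0 * g1\<^sup>2 + 9 * g0\<^sup>2 * g2))"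
    by (rule jet2_eqI[OF jet2_cmult[OF jet2_add[OF jet2_cube[OF jg]
          jet2_mult[OF jet2_ident jet2_cmult[OF jet2_mult[OF jet2_square[OF jg] jg']]]]]])
       (simp_all add: algebra_simps power2_eq_square)
  then have "jet2 q (\<sigma> * g0 ^ 3) (6 * \<sigma> * g0\<^sup>2 * g1) (\<sigma> * (18 * g0 * g1\<^sup>2 + 9 * g0\<^sup>2 * g2))"
    by (rule jet2_cong[OF Id(3,2), rotated]) (simp add: qg)
  from jet2_unique[OF this]
  have q12: "q1 = 6 * \<sigma> * g0\<^sup>2 * g1" "q2 = \<sigma> * (18 * g0 * g1\<^sup>2 + 9 * g0\<^sup>2 * g2)"
    by (simp_all add: q1_def q2_def)
  have ja': "jet2 a 0 q0 q1" using ja by (simp add: q0 q12)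
  define N0 N1 N2 where "N0 = - 5 * q0\<^sup>2" and "N1 = 9 * q0 * r0 - 7 * q0 * q1"
    and "N2 = 9 * q1 * r0 + 18 * q0 * r1 - 7 * q1\<^sup>2 - 4 * q0 * q2"
  have "jet2 (\<lambda>t. 3 * (a t * deriv q t) + 9 * (a t * r t) + (- 5) * (q t)\<^sup>2) N0 N1 N2"
    by (rule jet2_eqI[OF jet2_add[OF jet2_add[OF jet2_cmult[OF jet2_mult[OF ja' jq']]
          jet2_cmult[OF jet2_mult[OF ja' jr]]] jet2_cmult[OF jet2_square[OF jq]]]])
       (simp_all add: N0_def N1_def N2_def algebra_simps power2_eq_square)
  then have jN: "jet2 N N0 N1 N2" by (simp add: N_def[abs_def])
  \<comment> \<open>The eighth power is an iterated square because \<open>jet2_square\<close> then computes its jet.\<close>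
  have eqF: "9 * (((((g t)\<^sup>2)\<^sup>2)\<^sup>2) * F t) = (k t)\<^sup>2 * N t" if "t \<in> ?I" for t
    using g(2)[OF that] by (simp add: F_def)
  note jet2_unique(1-3)[OF jet2_cong[OF Id(3,2) eqF
      jet2_cmult[OF jet2_mult[OF jet2_square[OF jet2_square[OF jet2_square[OF jg]]] jF]]]]
  moreover note jet2_unique(1-3)[OF jet2_mult[OF jet2_square[OF jk] jN]]
  ultimately have e:
    "9 * ((((g0)\<^sup>2)\<^sup>2)\<^sup>2 * F0) = (3/4 * g0)\<^sup>2 * N0"
    "9 * (2 * (g0\<^sup>2)\<^sup>2 * (2 * g0\<^sup>2 * (2 * g0 * g1)) * F0 + ((g0\<^sup>2)\<^sup>2)\<^sup>2 * F1) =
       2 * (3/4 * g0) * (3/7 * g1) * N0 + (3/4 * g0)\<^sup>2 * N1"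
    "9 * ((2 * (2 * g0\<^sup>2 * (2 * g0 * g1))\<^sup>2 + 2 * (g0\<^sup>2)\<^sup>2 * (2 * (2 * g0 * g1)\<^sup>2
       + 2 * g0\<^sup>2 * (2 * g1\<^sup>2 + 2 * g0 * g2))) * F0
       + 2 * (2 * (g0\<^sup>2)\<^sup>2 * (2 * g0\<^sup>2 * (2 * g0 * g1))) * F1 + ((g0\<^sup>2)\<^sup>2)\<^sup>2 * F2) =
     (2 * (3/7 * g1)\<^sup>2 + 2 * (3/4 * g0) * (3/10 * g2)) * N0
       + 2 * (2 * (3/4 * g0) * (3/7 * g1)) * N1 + (3/4 * g0)\<^sup>2 * N2"
    by simp_all
  have g0: "g0 > 0" unfolding g0_def using g(2) Id(2) .
  have rel: "q0 * r1 = r0 * (q1 - r0)"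
    using pluecker urd[OF Id(2)] unfolding q0_def q1_def r0_def by simp
  note id = curvature_jet_identity[OF g0 \<sigma>(1) q0 q12 rel N0_def N1_def N2_def refl refl refl]
  have e': "9 * g0 ^ 8 * F0 = (3/4 * g0)\<^sup>2 * N0"
    "9 * (8 * g0 ^ 7 * g1 * F0 + g0 ^ 8 * F1) = 2 * (3/4 * g0) * (3/7 * g1) * N0 + (3/4 * g0)\<^sup>2 * N1"
    "9 * ((56 * g0 ^ 6 * g1\<^sup>2 + 8 * g0 ^ 7 * g2) * F0 + 2 * (8 * g0 ^ 7 * g1) * F1 + g0 ^ 8 * F2)
      = (2 * (3/7 * g1)\<^sup>2 + 2 * (3/4 * g0) * (3/10 * g2)) * N0
        + 2 * (2 * (3/4 * g0) * (3/7 * g1)) * N1 + (3/4 * g0)\<^sup>2 * N2"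
    unfolding e[symmetric] by algebra+
  note id = id[OF e']

  define K0 K1 where "K0 = K 0" and "K1 = deriv K 0"
  have jK: "jet2 K K0 K1 (deriv (deriv K) 0)" unfolding K0_def K1_def by (rule jet[OF K(1)])
  have K0: "K0 > 0" unfolding K0_def using K(2) Id(2) .
  have j\<tau>: "jet2 \<tau> 0 K0 (2 * K1)"
    by (rule jet2_cong[OF Id(3,2) \<tau>K[symmetric]])
      (auto intro: jet2_eqI[OF jet2_mult[OF jet2_ident jK]])
  have K04: "K0 ^ 4 = (3/4 * g0) ^ 3"
    using K4[OF Id(2)] jet2_unique(1)[OF jk] by (simp add: K0_def)
  \<comment> \<open>Comparing the jets of \<open>K\<^sup>4\<close> and \<open>k\<^sup>3\<close> avoids differentiating a fractional power.\<close>
  have "((K t)\<^sup>2)\<^sup>2 = k t ^ 3" if "t \<in> ?I" for t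
    using K4[OF that] by simp
  from jet2_unique(2)[OF jet2_cong[OF Id(3,2) this jet2_square[OF jet2_square[OF jK]]]]
    jet2_unique(2)[OF jet2_cube[OF jk]]
  have "2 * K0\<^sup>2 * (2 * K0 * K1) = 3 * (3/4 * g0)\<^sup>2 * (3/7 * g1)"
    by simp
  then have "K0 ^ 4 * (K1 * (7 * g0)) = K0 ^ 4 * (K0 * (3 * g1))"
    using K04 by algebra
  then have K1: "K1 / K0 = 3/7 * g1 / g0"
    using K0 g0 by (simp add: field_simps)

  obtain \<epsilon> where \<epsilon>: "0 < \<epsilon>" "\<epsilon> \<le> d1" "\<And>t. t \<in> {-\<epsilon><..<\<epsilon>} \<Longrightarrow> deriv \<tau> t > 0"
    using positive_near_0[of d1 "deriv \<tau>"] smooth_on_continuous[OF smooth_on_deriv(1)[OF Id(3) \<tau>]]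
      d1(1) jet2_unique(2)[OF j\<tau>] K0 by metis
  let ?J = "{-\<epsilon><..<\<epsilon>}"
  have JI: "?J \<subseteq> ?I" "0 \<in> ?J" "open ?J" using \<epsilon> by auto
  obtain \<theta> where \<theta>: "coordinate_on ?J \<tau> \<theta>"
    using coordinate_onI[of \<epsilon> \<tau>] smooth_on_subset[OF \<tau> JI(1)] \<epsilon>(3) by blast
  then have \<theta>': "open (\<tau> ` ?J)" "smooth_on (\<tau> ` ?J) \<theta>" "\<And>t. t \<in> ?J \<Longrightarrow> \<theta> (\<tau> t) = t"
    by (auto simp: coordinate_on_def)
  have FJ: "smooth_on ?J F" using F JI(1) by (rule smooth_on_subset)
  have "\<theta> ` \<tau> ` ?J \<subseteq> ?J" using \<theta>'(3) by auto
  then have G: "smooth_on (\<tau> ` ?J) (F \<circ> \<theta>)"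
    using smooth_on_compose[OF \<theta>'(1) JI(3) _ \<theta>'(2) FJ] by (simp add: comp_def)
  define G1 G2 where "G1 = deriv (F \<circ> \<theta>) 0" and "G2 = deriv (deriv (F \<circ> \<theta>)) 0"
  have "0 \<in> \<tau> ` ?J" using JI(2) jet2_unique(1)[OF j\<tau>] by force
  then have jG: "jet2 (F \<circ> \<theta>) ((F \<circ> \<theta>) 0) G1 G2"
    unfolding G1_def G2_def by (rule jet2_smooth[OF \<theta>'(1) _ G])
  have "jet2 F ((F \<circ> \<theta>) 0) (G1 * K0) (G2 * K0\<^sup>2 + G1 * (2 * K1))"
    by (rule jet2_cong[OF JI(3,2) _ jet2_compose[OF jG j\<tau>]]) (simp add: \<theta>'(3))
  from jet2_unique(2,3)[OF this] have FG: "F1 = G1 * K0" "F2 = G2 * K0\<^sup>2 + G1 * (2 * K1)"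
    by (simp_all add: F1_def F2_def)
  have "K0\<^sup>2 * (32 * G1\<^sup>2 + 9 * G2) = 32 * F1\<^sup>2 + 9 * F2 - 18 * (K1 / K0) * F1"
    using K0 by (simp add: FG power_mult_distrib algebra_simps)
  also have "18 * (K1 / K0) * F1 = 9/7 * (q1 / q0) * F1"
    unfolding K1 id(4) by simp
  also have "32 * F1\<^sup>2 + 9 * F2 - \<dots> = 0" using id(3) by simp
  finally have star: "32 * G1\<^sup>2 + 9 * G2 = 0" using K0 by simp
  have star': "32 * F1\<^sup>2 + 9 * F2 = 0" if "\<forall>\<^sub>F t in nhds 0. \<tau> t = t"
  proof -
    obtain U where "open U" "0 \<in> U" "\<And>t. t \<in> U \<Longrightarrow> t = \<tau> t"
      using \<open>\<forall>\<^sub>F t in nhds 0. \<tau> t = t\<close> unfolding eventually_nhds by metis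
    then have "jet2 \<tau> 0 1 0" by (rule jet2_cong[OF _ _ _ jet2_ident])
    then have "K1 = 0" using jet2_unique(3)[OF j\<tau>] jet2_unique(3)[of \<tau>] by fastforce
    then have "g1 = 0" using K1 g0 by auto
    then show ?thesis using id(3) q12(1) by simp
  qed
  have ur0: "u 0 + r 0 = q1"
    using urd[OF Id(2)] by (simp add: q1_def)
  have nz: "\<forall>t\<in>?J - {0}. a t \<noteq> 0 \<and> F t = normalized_curvature M \<gamma> t"
  proof
    fix t assume "t \<in> ?J - {0}"
    then have t: "t \<in> ?I" "t \<noteq> 0" using JI(1) by auto
    then show "a t \<noteq> 0 \<and> F t = normalized_curvature M \<gamma> t"
      using ag[OF t(1)] g(2)[OF t(1)] \<sigma>(4) Fnc[OF t] by auto
  qed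
  have d2: "(deriv ^^ 2) f = deriv (deriv f)" for f :: "real \<Rightarrow> real"
    by (simp add: numeral_2_eq_2)
  show ?A
    unfolding \<tau>_def[symmetric] d2 ur0 q0_def[symmetric]
  proof (rule exI[of _ \<epsilon>], rule exI[of _ F], rule exI[of _ \<theta>], intro conjI)
    show "\<epsilon> \<le> d" using \<epsilon>(2) d1(2) by simp
    show "F 0 = - 5/16" using id(1) by (simp add: F0_def)
  qed (use \<epsilon>(1) \<theta> nz FJ G id(3) star star' in \<open>auto simp: F1_def F2_def G1_def G2_def\<close>)

  have FJ0: "\<forall>\<^sub>F t in at 0. F t = normalized_curvature M \<gamma> t"
    using eventually_at_in_open[OF Id(3,2)] by eventually_elim (auto intro: Fnc)
  have "(F \<longlongrightarrow> F 0) (at 0)"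
    using DERIV_isCont[OF jet2_unique(4)[OF jF]] by (simp add: isCont_def)
  then show ?B
    using Lim_transform_eventually[OF _ FJ0] id(1) by (simp add: F0_def)
  have "((\<lambda>t. (F t - F 0) / t) \<longlongrightarrow> F1) (at 0)" "((\<lambda>t. \<tau> t / t) \<longlongrightarrow> K0) (at 0)"
    using jet2_unique(4)[OF jF] jet2_unique(4)[OF j\<tau>] jet2_unique(1)[OF j\<tau>] by (simp_all add: DERIV_def)
  from tendsto_divide[OF this] have "((\<lambda>t. ((F t - F 0) / t) / (\<tau> t / t)) \<longlongrightarrow> F1 / K0) (at 0)"
    using K0 by simp
  moreover have "\<forall>\<^sub>F t in at 0. ((F t - F 0) / t) / (\<tau> t / t) =
      (normalized_curvature M \<gamma> t + 5/16) / arclength34 M \<gamma> t"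
  proof -
    have "\<forall>\<^sub>F t in at 0. t \<noteq> (0::real)" by (simp add: eventually_at_filter)
    with FJ0 show ?thesis
      by eventually_elim (use id(1) in \<open>auto simp: F0_def \<tau>_def\<close>)
  qed
  ultimately have "((\<lambda>t. (normalized_curvature M \<gamma> t + 5/16) / arclength34 M \<gamma> t) \<longlongrightarrow> F1 / K0) (at 0)"
    by (rule Lim_transform_eventually)
  also have "F1 / K0 = - (3 * root 4 3 / (28 * sqrt 2)) * inflectional_curvature M \<gamma>"
  proof -
    define Q where "Q = \<bar>q0\<bar>"
    have Q: "Q > 0" "Q = g0 ^ 3"
      using infl(2) g0 by (simp_all add: Q_def q0_def) (simp add: q0[unfolded q0_def] abs_mult \<sigma>)
    \<comment> \<open>\<open>A\<close> is \<open>K0 = (3/4 g0) powr (3/4)\<close>, rewritten so that the constant of the limit formula appears.\<close>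
    define A where "A = 3 * Q powr (1/4) / (2 * sqrt 2 * root 4 3)"
    have "(sqrt 2) ^ 4 = 4"
      using power_mult[of "sqrt 2" 2 2] by simp
    moreover have "(Q powr (1/4)) ^ 4 = Q"
      using Q(1) by (simp add: powr_powr flip: powr_numeral)
    moreover have "root 4 3 ^ 4 = 3" by simp
    ultimately have "A ^ 4 = K0 ^ 4"
      by (simp add: A_def K04 power_divide power_mult_distrib Q(2))
    moreover have "A \<ge> 0" by (simp add: A_def)
    ultimately have A: "K0 = A" using K0 power_eq_imp_eq_base[of K0 4 A] by simp
    have "Q powr (5/4) = Q * Q powr (1/4)"
      using powr_mult_base[of Q "1/4"] Q(1) by simp
    moreover have "(q1 - 7 * r0) / q0 = \<sigma> * (q1 - 7 * r0) / Q"
      using infl(2) by (auto simp: Q_def q0_def \<sigma>_def sgn_if abs_if field_simps)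
    moreover have "u 0 - 6 * r 0 = q1 - 7 * r0" using ur0 by (simp add: r0_def)
    ultimately have mu: "inflectional_curvature M \<gamma> = ((q1 - 7 * r0) / q0) / Q powr (1/4)"
      unfolding inflectional_curvature_def by (simp add: Q_def q0_def q_def u_def r_def \<sigma>_def)
    have cA: "(9/112) / A = 3 * root 4 3 / (28 * sqrt 2) / Q powr (1/4)"
      using Q by (simp add: A_def field_simps)
    have "F1 / K0 = - ((9/112) / A) * ((q1 - 7 * r0) / q0)"
      unfolding id(2) A by simp
    also have "\<dots> = - (3 * root 4 3 / (28 * sqrt 2)) * (((q1 - 7 * r0) / q0) / Q powr (1/4))"
      unfolding cA by simp
    finally show ?thesis unfolding mu .
  qed
  finally show ?C .
qed

section \<open>Fields of linear and bilinear maps\<close>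

text \<open>Derivatives of transition maps, Christoffel symbols and area forms are given as functions of the base
  point for each fixed argument \<open>w\<close>. In finite dimension this suffices to differentiate along a varying
  argument, since \<open>A y w\<close> is a finite sum of components of \<open>w\<close> times the functions \<open>\<lambda>y. A y b\<close>.\<close>

lemma has_derivative_linear_field:
  fixes A :: "'c::real_normed_vector \<Rightarrow> 'd::euclidean_space \<Rightarrow> 'b::real_normed_vector"
    and f :: "'e::real_normed_vector \<Rightarrow> 'c"
  assumes U: "open U" "f s \<in> U" and lin: "\<And>y. y \<in> U \<Longrightarrow> linear (A y)"
    and dA: "\<And>w. (\<lambda>y. A y w) differentiable at (f s)"
    and f: "(f has_derivative f') (at s)" and W: "(W has_derivative W') (at s)"
  shows "((\<lambda>s. A (f s) (W s)) has_derivative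
    (\<lambda>h. frechet_derivative (\<lambda>y. A y (W s)) (at (f s)) (f' h) + A (f s) (W' h))) (at s)"
proof -
  let ?D = "\<lambda>w. frechet_derivative (\<lambda>y. A y w) (at (f s))"
  have D: "((\<lambda>y. A y w) has_derivative ?D w) (at (f s))" for w
    using dA by (simp add: frechet_derivative_works[symmetric])
  have "((\<lambda>y. \<Sum>b\<in>Basis. (W s \<bullet> b) *\<^sub>R A y b) has_derivative (\<lambda>k. \<Sum>b\<in>Basis. (W s \<bullet> b) *\<^sub>R ?D b k)) (at (f s))"
    by (intro has_derivative_sum has_derivative_scaleR_right D)
  then have "((\<lambda>y. A y (W s)) has_derivative (\<lambda>k. \<Sum>b\<in>Basis. (W s \<bullet> b) *\<^sub>R ?D b k)) (at (f s))"
    by (rule has_derivative_transform_within_open[OF _ U]) (rule linear_basis_expansion[OF lin, symmetric])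
  from frechet_derivative_at[OF this, symmetric]
  have D_sum: "?D (W s) = (\<lambda>k. \<Sum>b\<in>Basis. (W s \<bullet> b) *\<^sub>R ?D b k)" .
  have "((\<lambda>s. \<Sum>b\<in>Basis. (W s \<bullet> b) *\<^sub>R A (f s) b) has_derivative
      (\<lambda>h. \<Sum>b\<in>Basis. (W s \<bullet> b) *\<^sub>R ?D b (f' h) + (W' h \<bullet> b) *\<^sub>R A (f s) b)) (at s)"
    by (intro has_derivative_sum has_derivative_scaleR has_derivative_inner_left W
        has_derivative_compose[OF f D])
  also have "(\<lambda>h. \<Sum>b\<in>Basis. (W s \<bullet> b) *\<^sub>R ?D b (f' h) + (W' h \<bullet> b) *\<^sub>R A (f s) b) =
      (\<lambda>h. ?D (W s) (f' h) + A (f s) (W' h))"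
    unfolding D_sum by (simp add: sum.distrib linear_basis_expansion[OF lin[OF U(2)], symmetric])
  finally have der: "((\<lambda>s. \<Sum>b\<in>Basis. (W s \<bullet> b) *\<^sub>R A (f s) b) has_derivative
      (\<lambda>h. ?D (W s) (f' h) + A (f s) (W' h))) (at s)" .
  have "\<forall>\<^sub>F s' in nhds s. f s' \<in> U"
    using has_derivative_continuous[OF f] U
    unfolding isCont_def tendsto_at_iff_tendsto_nhds by (auto simp: tendsto_def)
  then obtain V where V: "open V" "s \<in> V" "\<And>s'. s' \<in> V \<Longrightarrow> f s' \<in> U"
    unfolding eventually_nhds by blast
  show ?thesis
    by (rule has_derivative_transform_within_open[OF der V(1,2)])
       (rule linear_basis_expansion[OF lin[OF V(3)], symmetric])
qed

lemma smooth_on_linear_field: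
  fixes A :: "'c::euclidean_space \<Rightarrow> 'd::euclidean_space \<Rightarrow> 'b::real_normed_vector"
    and f :: "'e::real_normed_vector \<Rightarrow> 'c"
  assumes S: "open S" and U: "open U" "f ` S \<subseteq> U" and lin: "\<And>y. y \<in> U \<Longrightarrow> linear (A y)"
    and A: "\<And>w. smooth_on U (\<lambda>y. A y w)" and f: "smooth_on S f" and W: "smooth_on S W"
  shows "smooth_on S (\<lambda>s. A (f s) (W s))"
proof (rule smooth_on_cong[OF S])
  show "smooth_on S (\<lambda>s. \<Sum>b\<in>Basis. (W s \<bullet> b) *\<^sub>R A (f s) b)"
    using smooth_on_compose[OF S U f A] smooth_on_linear[OF bounded_linear_inner_left S W]
    by (intro smooth_on_sum smooth_on_scaleR S) auto
  show "(\<Sum>b\<in>Basis. (W s \<bullet> b) *\<^sub>R A (f s) b) = A (f s) (W s)" if "s \<in> S" for s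
    using U(2) that by (intro linear_basis_expansion[symmetric] lin) auto
qed

lemma smooth_on_bilinear_field:
  fixes B :: "'c::euclidean_space \<Rightarrow> 'd::euclidean_space \<Rightarrow> 'd \<Rightarrow> 'b::real_normed_vector"
    and x :: "'e::euclidean_space \<Rightarrow> 'c"
  assumes S: "open S" and U: "open U" "x ` S \<subseteq> U" and bil: "\<And>y. y \<in> U \<Longrightarrow> bilinear (B y)"
    and B: "\<And>v w. smooth_on U (\<lambda>y. B y v w)" and x: "smooth_on S x"
    and X: "smooth_on S X" and Y: "smooth_on S Y"
  shows "smooth_on S (\<lambda>s. B (x s) (X s) (Y s))"
proof (rule smooth_on_linear_field[where A = "\<lambda>s. B (x s) (X s)" and f = "\<lambda>s. s",
      OF S S _ _ _ smooth_on_ident[OF S] Y])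
  show "smooth_on S (\<lambda>s. B (x s) (X s) w)" for w
    by (rule smooth_on_linear_field[where A = "\<lambda>y v. B y v w" and f = x, OF S U _ B x X])
      (use bil in \<open>simp add: bilinear_def\<close>)
  show "linear (B (x s) (X s))" if "s \<in> S" for s
    using bil U(2) that by (auto simp: bilinear_def)
qed simp

text \<open>The linear case is used twice, the second time with time itself as base point and
  \<open>\<lambda>s. B (x s) (X s)\<close> as the field of linear maps.\<close>

lemma has_vector_derivative_bilinear_field:
  fixes B :: "'c::euclidean_space \<Rightarrow> 'd::euclidean_space \<Rightarrow> 'd \<Rightarrow> 'b::real_normed_vector"
    and x :: "real \<Rightarrow> 'c"
  assumes U: "open U" "x t \<in> U" and bil: "\<And>y. y \<in> U \<Longrightarrow> bilinear (B y)"
    and B: "\<And>v w. smooth_on U (\<lambda>y. B y v w)"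
    and x: "(x has_vector_derivative x') (at t)"
    and X: "(X has_vector_derivative X') (at t)" and Y: "(Y has_vector_derivative Y') (at t)"
  shows "((\<lambda>s. B (x s) (X s) (Y s)) has_vector_derivative
    frechet_derivative (\<lambda>y. B y (X t) (Y t)) (at (x t)) x' + B (x t) X' (Y t) + B (x t) (X t) Y') (at t)"
proof -
  note xXY = x[unfolded has_vector_derivative_def] X[unfolded has_vector_derivative_def]
    Y[unfolded has_vector_derivative_def]
  have dB: "(\<lambda>y. B y v w) differentiable at (x t)" for v w
    using smooth_on_has_derivative[OF B U(2)] by (auto simp: differentiable_def)
  have "((\<lambda>s. B (x s) (X s) w) has_derivative
      (\<lambda>h. frechet_derivative (\<lambda>y. B y (X t) w) (at (x t)) (h *\<^sub>R x') + B (x t) (h *\<^sub>R X') w)) (at t)" for w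
    by (rule has_derivative_linear_field[where A = "\<lambda>y v. B y v w" and f = x and s = t and U = U,
          OF U _ dB xXY(1,2)]) (use bil in \<open>simp add: bilinear_def\<close>)
  note 1 = this
  have "continuous (at t) x"
    using x by (rule has_vector_derivative_continuous)
  then have "\<forall>\<^sub>F s in nhds t. x s \<in> U"
    using U unfolding isCont_def tendsto_at_iff_tendsto_nhds by (auto simp: tendsto_def)
  then obtain V where V: "open V" "t \<in> V" "\<And>s. s \<in> V \<Longrightarrow> x s \<in> U"
    unfolding eventually_nhds by blast
  have "((\<lambda>s. B (x s) (X s) (Y s)) has_derivative
      (\<lambda>h. frechet_derivative (\<lambda>s. B (x s) (X s) (Y t)) (at t) h + B (x t) (X t) (h *\<^sub>R Y'))) (at t)"
  proof (rule has_derivative_linear_field[where A = "\<lambda>s. B (x s) (X s)" and f = "\<lambda>s. s" and s = t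
        and U = V and f' = "\<lambda>h. h", OF V(1,2) _ _ has_derivative_ident xXY(3)])
    show "linear (B (x s) (X s))" if "s \<in> V" for s
      using bil[OF V(3)[OF that]] by (simp add: bilinear_def)
    show "(\<lambda>s. B (x s) (X s) w) differentiable at t" for w
      using 1 by (auto simp: differentiable_def)
  qed
  moreover have "frechet_derivative (\<lambda>s. B (x s) (X s) (Y t)) (at t) =
      (\<lambda>h. frechet_derivative (\<lambda>y. B y (X t) (Y t)) (at (x t)) (h *\<^sub>R x') + B (x t) (h *\<^sub>R X') (Y t))"
    using frechet_derivative_at[OF 1, symmetric] .
  moreover have "frechet_derivative (\<lambda>y. B y (X t) (Y t)) (at (x t)) (h *\<^sub>R x') =
      h *\<^sub>R frechet_derivative (\<lambda>y. B y (X t) (Y t)) (at (x t)) x'" for h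
    using linear_cmul[OF linear_frechet_derivative[OF dB]] .
  ultimately show ?thesis
    unfolding has_vector_derivative_def
    using bilinear_lmul[OF bil[OF U(2)]] bilinear_rmul[OF bil[OF U(2)]]
    by (simp add: scaleR_add_right)
qed

section \<open>Tangent fields along a curve\<close>

context
  fixes M :: "('m, 'i) equi_affine"
  assumes M: "equi_affine_2_manifold M"
begin

lemma chart_open: "i \<in> charts M \<Longrightarrow> openin (space_of M) (dom M i)"
  and chart_image_open: "i \<in> charts M \<Longrightarrow> open (chart M i ` dom M i)"
  and chart_homeo: "i \<in> charts M \<Longrightarrow> homeomorphic_map (subtopology (space_of M) (dom M i))
      (top_of_set (chart M i ` dom M i)) (chart M i)"
  and charts_cover: "(\<Union>i\<in>charts M. dom M i) = topspace (space_of M)"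
  using M unfolding equi_affine_2_manifold_def oriented_2_manifold_def by blast+

lemma chart_inj: "i \<in> charts M \<Longrightarrow> inj_on (chart M i) (dom M i)"
  using homeomorphic_imp_injective_map[OF chart_homeo] openin_subset[OF chart_open]
  by (metis topspace_subtopology_subset)

lemma transition_chart: "i \<in> charts M \<Longrightarrow> p \<in> dom M i \<Longrightarrow> transition M i j (chart M i p) = chart M j p"
  by (simp add: transition_def chart_inj)

lemma overlap_open:
  assumes i: "i \<in> charts M" and j: "j \<in> charts M"
  shows "open (overlap M i j)"
proof -
  have "openin (subtopology (space_of M) (dom M i)) (dom M i \<inter> dom M j)"
    using chart_open[OF j] by (metis Int_commute openin_subtopology_Int)
  then have "openin (top_of_set (chart M i ` dom M i)) (chart M i ` (dom M i \<inter> dom M j))"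
    using homeomorphic_imp_open_map[OF chart_homeo[OF i]] unfolding open_map_def by blast
  then show ?thesis
    using chart_image_open[OF i] unfolding overlap_def by (metis openin_open_eq)
qed

lemma transition_smooth: "i \<in> charts M \<Longrightarrow> j \<in> charts M \<Longrightarrow> smooth_on (overlap M i j) (transition M i j)"
  using M unfolding equi_affine_2_manifold_def oriented_2_manifold_def by blast

lemma transition_has_derivative:
  "i \<in> charts M \<Longrightarrow> j \<in> charts M \<Longrightarrow> x \<in> overlap M i j \<Longrightarrow>
    (transition M i j has_derivative dtransition M i j x) (at x)"
  using smooth_on_has_derivative[OF transition_smooth] .

lemma dtransition_linear:
  "i \<in> charts M \<Longrightarrow> j \<in> charts M \<Longrightarrow> x \<in> overlap M i j \<Longrightarrow> linear (dtransition M i j x)"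
  using transition_has_derivative has_derivative_linear by blast

lemma christoffel_bilinear: "i \<in> charts M \<Longrightarrow> x \<in> chart M i ` dom M i \<Longrightarrow> bilinear (christoffel M i x)"
  and christoffel_smooth: "i \<in> charts M \<Longrightarrow> smooth_on (chart M i ` dom M i) (\<lambda>x. christoffel M i x v w)"
  and christoffel_transform: "i \<in> charts M \<Longrightarrow> j \<in> charts M \<Longrightarrow> x \<in> overlap M i j \<Longrightarrow>
     dtransition M i j x (christoffel M i x v w) =
       frechet_derivative (\<lambda>y. dtransition M i j y w) (at x) v +
       christoffel M j (transition M i j x) (dtransition M i j x v) (dtransition M i j x w)"
  using M unfolding equi_affine_2_manifold_def affine_connection_def by blast+

lemma area_bilinear: "i \<in> charts M \<Longrightarrow> x \<in> chart M i ` dom M i \<Longrightarrow> bilinear (area M i x)"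
  and area_self: "i \<in> charts M \<Longrightarrow> x \<in> chart M i ` dom M i \<Longrightarrow> area M i x v v = 0"
  and area_pos: "i \<in> charts M \<Longrightarrow> x \<in> chart M i ` dom M i \<Longrightarrow> area M i x (axis 1 1) (axis 2 1) > 0"
  and area_smooth: "i \<in> charts M \<Longrightarrow> smooth_on (chart M i ` dom M i) (\<lambda>x. area M i x v w)"
  using M unfolding equi_affine_2_manifold_def positive_area_form_def by blast+

lemma area_parallel:
  assumes "i \<in> charts M" "x \<in> chart M i ` dom M i"
  shows "frechet_derivative (\<lambda>y. area M i y v w) (at x) u =
    area M i x (christoffel M i x u v) w + area M i x v (christoffel M i x u w)"
proof -
  have "frechet_derivative (\<lambda>y. area M i y v w) (at x) u
      - area M i x (christoffel M i x u v) w - area M i x v (christoffel M i x u w) = 0"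
    using M assms unfolding equi_affine_2_manifold_def parallel_area_form_def by blast
  then show ?thesis by linarith
qed

text \<open>All alternating bilinear forms of the plane are multiples of the determinant.\<close>

lemma area_det:
  assumes "i \<in> charts M" "x \<in> chart M i ` dom M i"
  shows "area M i x v w = area M i x (axis 1 1) (axis 2 1) * (v $ 1 * w $ 2 - v $ 2 * w $ 1)"
proof -
  note bil = area_bilinear[OF assms]
  note self = area_self[OF assms]
  have anti: "area M i x (axis 2 1) (axis 1 1) = - area M i x (axis 1 1) (axis 2 1)"
    using self[of "axis 1 1 + axis 2 1"] self[of "axis 1 1"] self[of "axis 2 1"]
    by (simp add: bilinear_ladd[OF bil] bilinear_radd[OF bil])
  have e: "u = u $ 1 *\<^sub>R axis 1 1 + u $ 2 *\<^sub>R axis 2 1" for u :: "real^2"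
    by (simp add: vec_eq_iff forall_2 axis_def)
  show ?thesis
    by (subst e[of v], subst e[of w])
       (simp add: bilinear_ladd[OF bil] bilinear_radd[OF bil] bilinear_lmul[OF bil] bilinear_rmul[OF bil]
         self anti algebra_simps)
qed

lemma in_some_chart:
  assumes "p \<in> topspace (space_of M)"
  obtains i where "i \<in> charts M" "p \<in> dom M i"
  using assms charts_cover by blast

lemma bracket_self:
  assumes "p \<in> topspace (space_of M)" "tangent_vector M p v"
  shows "bracket M p v v = 0"
  using in_some_chart[OF assms(1)] bracket_in_chart[OF M assms(2,2)] area_self
  by (metis image_eqI)

text \<open>By \<open>area_det\<close> the brackets are, up to a common factor, the minors of a matrix with two rows and four columns.\<close>

lemma bracket_pluecker:
  assumes "p \<in> topspace (space_of M)" "tangent_vector M p a" "tangent_vector M p b"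
    "tangent_vector M p c" "tangent_vector M p e"
  shows "bracket M p a b * bracket M p c e - bracket M p a c * bracket M p b e
    + bracket M p a e * bracket M p b c = 0"
proof -
  obtain i where i: "i \<in> charts M" "p \<in> dom M i" using in_some_chart[OF assms(1)] .
  show ?thesis
    unfolding bracket_in_chart[OF M assms(2,3) i] bracket_in_chart[OF M assms(2,4) i]
      bracket_in_chart[OF M assms(2,5) i] bracket_in_chart[OF M assms(3,4) i]
      bracket_in_chart[OF M assms(3,5) i] bracket_in_chart[OF M assms(4,5) i]
      area_det[OF i(1) imageI[OF i(2)], of "_ i"]
    by (simp add: algebra_simps)
qed

definition tangent_field :: "(real \<Rightarrow> 'm) \<Rightarrow> real set \<Rightarrow> (real \<Rightarrow> 'i \<Rightarrow> real^2) \<Rightarrow> bool" where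
  "tangent_field \<gamma> I X \<longleftrightarrow> (\<forall>t\<in>I. tangent_vector M (\<gamma> t) (X t)) \<and>
     (\<forall>i\<in>charts M. smooth_on {t \<in> I. \<gamma> t \<in> dom M i} (\<lambda>t. X t i))"

lemma open_chart_times:
  assumes "open I" "smooth_curve M \<gamma> I" "i \<in> charts M"
  shows "open {t \<in> I. \<gamma> t \<in> dom M i}"
proof -
  have "openin (top_of_set I) {t \<in> topspace (top_of_set I). \<gamma> t \<in> dom M i}"
    using assms(2) chart_open[OF assms(3)] unfolding smooth_curve_def
    by (intro openin_continuous_map_preimage) auto
  then show ?thesis using assms(1) by (simp add: openin_open_eq)
qed

lemma curve_in_space: "smooth_curve M \<gamma> I \<Longrightarrow> t \<in> I \<Longrightarrow> \<gamma> t \<in> topspace (space_of M)"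
  unfolding smooth_curve_def using continuous_map_image_subset_topspace by fastforce

lemma chart_curve_derivative:
  assumes "open I" "smooth_curve M \<gamma> I" "i \<in> charts M" "t \<in> I" "\<gamma> t \<in> dom M i"
  shows "((chart M i \<circ> \<gamma>) has_vector_derivative velocity M \<gamma> t i) (at t)"
proof -
  have "smooth_on {t \<in> I. \<gamma> t \<in> dom M i} (chart M i \<circ> \<gamma>)"
    using assms unfolding smooth_curve_def by blast
  from smooth_on_vector_derivative(2)[OF open_chart_times[OF assms(1-3)] this, of t]
  show ?thesis using assms by (simp add: velocity_def)
qed

lemma tangent_field_velocity:
  assumes I: "open I" and \<gamma>: "smooth_curve M \<gamma> I"
  shows "tangent_field \<gamma> I (velocity M \<gamma>)"
  unfolding tangent_field_def tangent_vector_def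
proof (intro conjI ballI allI impI)
  fix t i assume "t \<in> I" "i \<notin> charts M \<or> \<gamma> t \<notin> dom M i"
  then show "velocity M \<gamma> t i = 0" by (auto simp: velocity_def)
next
  fix t i j assume t: "t \<in> I" and ij: "i \<in> charts M" "j \<in> charts M"
    and dom: "\<gamma> t \<in> dom M i \<and> \<gamma> t \<in> dom M j"
  let ?x = "chart M i (\<gamma> t)"
  have "(transition M i j has_derivative dtransition M i j ?x) (at ((chart M i \<circ> \<gamma>) t))"
    using ij dom transition_has_derivative by (auto simp: overlap_def)
  from vector_derivative_diff_chain_within[OF chart_curve_derivative[OF I \<gamma> ij(1) t]
      has_derivative_at_withinI[OF this]] dom
  have "((\<lambda>s. transition M i j (chart M i (\<gamma> s))) has_vector_derivative
      dtransition M i j ?x (velocity M \<gamma> t i)) (at t)"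
    by (simp add: comp_def)
  then have "((chart M j \<circ> \<gamma>) has_vector_derivative dtransition M i j ?x (velocity M \<gamma> t i)) (at t)"
    by (rule has_vector_derivative_transform_within_open[OF _ open_chart_times[OF I \<gamma> ij(1)]])
       (use t dom ij in \<open>auto simp: transition_chart\<close>)
  then show "velocity M \<gamma> t j = dtransition M i j ?x (velocity M \<gamma> t i)"
    using chart_curve_derivative[OF I \<gamma> ij(2) t] dom vector_derivative_unique_at by blast
next
  fix i assume i: "i \<in> charts M"
  note op = open_chart_times[OF I \<gamma> i]
  have "smooth_on {t \<in> I. \<gamma> t \<in> dom M i} (chart M i \<circ> \<gamma>)"
    using \<gamma> i unfolding smooth_curve_def by blast
  note sm = smooth_on_vector_derivative(1)[OF op this]
  show "smooth_on {t \<in> I. \<gamma> t \<in> dom M i} (\<lambda>t. velocity M \<gamma> t i)"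
    by (rule smooth_on_cong[OF op _ sm])
       (use i in \<open>simp add: velocity_def\<close>)
qed

lemma tangent_field_component_derivative:
  assumes "open I" "smooth_curve M \<gamma> I" "tangent_field \<gamma> I X" "i \<in> charts M" "t \<in> I" "\<gamma> t \<in> dom M i"
  shows "((\<lambda>s. X s i) has_vector_derivative vector_derivative (\<lambda>s. X s i) (at t)) (at t)"
proof -
  have "smooth_on {t \<in> I. \<gamma> t \<in> dom M i} (\<lambda>s. X s i)"
    using assms by (simp add: tangent_field_def)
  from smooth_on_vector_derivative(2)[OF open_chart_times[OF assms(1,2,4)] this, of t]
  show ?thesis using assms by simp
qed

text \<open>Differentiating the components produces a second-derivative term of the change of charts, and
  the transformation law of the Christoffel symbols is made to cancel exactly this term.\<close>

lemma tangent_field_cov_deriv: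
  assumes I: "open I" and \<gamma>: "smooth_curve M \<gamma> I" and X: "tangent_field \<gamma> I X"
  shows "tangent_field \<gamma> I (cov_deriv M \<gamma> X)"
  unfolding tangent_field_def tangent_vector_def
proof (intro conjI ballI allI impI)
  fix t i assume "t \<in> I" "i \<notin> charts M \<or> \<gamma> t \<notin> dom M i"
  then show "cov_deriv M \<gamma> X t i = 0" by (auto simp: cov_deriv_def)
next
  fix t i j assume t: "t \<in> I" and ij: "i \<in> charts M" "j \<in> charts M"
    and dom': "\<gamma> t \<in> dom M i \<and> \<gamma> t \<in> dom M j"
  then have dom: "\<gamma> t \<in> dom M i" "\<gamma> t \<in> dom M j" by auto
  let ?x = "chart M i (\<gamma> t)" and ?dT = "dtransition M i j"
  let ?v = "velocity M \<gamma> t i" and ?X' = "vector_derivative (\<lambda>s. X s i) (at t)"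
  have x: "?x \<in> overlap M i j" using dom by (auto simp: overlap_def)
  have v: "velocity M \<gamma> t j = ?dT ?x ?v"
    using tangent_field_velocity[OF I \<gamma>] t ij dom unfolding tangent_field_def tangent_vector_def by blast
  have Xj: "X s j = ?dT (chart M i (\<gamma> s)) (X s i)"
    if "s \<in> {t \<in> I. \<gamma> t \<in> dom M i} \<inter> {t \<in> I. \<gamma> t \<in> dom M j}" for s
    using X that ij unfolding tangent_field_def tangent_vector_def by blast
  have "((\<lambda>s. ?dT ((chart M i \<circ> \<gamma>) s) (X s i)) has_derivative
      (\<lambda>h. frechet_derivative (\<lambda>y. ?dT y (X t i)) (at ((chart M i \<circ> \<gamma>) t)) (h *\<^sub>R ?v)
        + ?dT ((chart M i \<circ> \<gamma>) t) (h *\<^sub>R ?X'))) (at t)"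
  proof (rule has_derivative_linear_field[OF overlap_open[OF ij]])
    show "(\<lambda>y. ?dT y w) differentiable at ((chart M i \<circ> \<gamma>) t)" for w
      using smooth_on_has_derivative[OF smooth_on_frechet_derivative[OF transition_smooth[OF ij]]] x
      by (auto simp: differentiable_def)
    show "((chart M i \<circ> \<gamma>) has_derivative (\<lambda>h. h *\<^sub>R ?v)) (at t)"
      using chart_curve_derivative[OF I \<gamma> ij(1) t dom(1)] by (simp add: has_vector_derivative_def)
    show "((\<lambda>s. X s i) has_derivative (\<lambda>h. h *\<^sub>R ?X')) (at t)"
      using tangent_field_component_derivative[OF I \<gamma> X ij(1) t dom(1)]
      by (simp add: has_vector_derivative_def)
  qed (use x ij in \<open>auto intro: dtransition_linear\<close>)
  moreover have "linear (frechet_derivative (\<lambda>y. ?dT y (X t i)) (at ?x))"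
    using smooth_on_has_derivative[OF smooth_on_frechet_derivative[OF transition_smooth[OF ij]] x]
    by (rule has_derivative_linear)
  ultimately have "((\<lambda>s. ?dT (chart M i (\<gamma> s)) (X s i)) has_vector_derivative
      frechet_derivative (\<lambda>y. ?dT y (X t i)) (at ?x) ?v + ?dT ?x ?X') (at t)"
    unfolding has_vector_derivative_def using dtransition_linear[OF ij x]
    by (simp add: linear_cmul scaleR_add_right)
  then have "((\<lambda>s. X s j) has_vector_derivative
      frechet_derivative (\<lambda>y. ?dT y (X t i)) (at ?x) ?v + ?dT ?x ?X') (at t)"
    by (rule has_vector_derivative_transform_within_open[OF _
          open_Int[OF open_chart_times[OF I \<gamma> ij(1)] open_chart_times[OF I \<gamma> ij(2)]]])
       (use t dom Xj in auto)
  then have "vector_derivative (\<lambda>s. X s j) (at t) =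
      frechet_derivative (\<lambda>y. ?dT y (X t i)) (at ?x) ?v + ?dT ?x ?X'"
    by (rule vector_derivative_at)
  moreover have "X t j = ?dT ?x (X t i)" using Xj t dom by blast
  ultimately have "cov_deriv M \<gamma> X t j = ?dT ?x ?X' + ?dT ?x (christoffel M i ?x ?v (X t i))"
    using christoffel_transform[OF ij x, of ?v "X t i"] transition_chart[OF ij(1) dom(1), of j] ij dom
    by (simp add: cov_deriv_def v)
  also have "\<dots> = ?dT ?x (cov_deriv M \<gamma> X t i)"
    using linear_add[OF dtransition_linear[OF ij x]] ij dom by (simp add: cov_deriv_def)
  finally show "cov_deriv M \<gamma> X t j = ?dT ?x (cov_deriv M \<gamma> X t i)" .
next
  fix i assume i: "i \<in> charts M"
  let ?S = "{t \<in> I. \<gamma> t \<in> dom M i}"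
  note op = open_chart_times[OF I \<gamma> i]
  have X': "smooth_on ?S (\<lambda>t. X t i)" using X i by (simp add: tangent_field_def)
  have sm: "smooth_on ?S (\<lambda>t. christoffel M i ((chart M i \<circ> \<gamma>) t) (velocity M \<gamma> t i) (X t i))"
  proof (rule smooth_on_bilinear_field[where B = "christoffel M i" and x = "chart M i \<circ> \<gamma>",
        OF op chart_image_open[OF i]])
    show "smooth_on ?S (chart M i \<circ> \<gamma>)" using \<gamma> i unfolding smooth_curve_def by blast
    show "smooth_on ?S (\<lambda>t. velocity M \<gamma> t i)"
      using tangent_field_velocity[OF I \<gamma>] i by (simp add: tangent_field_def)
  qed (use X' christoffel_bilinear[OF i] christoffel_smooth[OF i] in auto)
  show "smooth_on ?S (\<lambda>t. cov_deriv M \<gamma> X t i)"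
    by (rule smooth_on_cong[OF op _ smooth_on_add[OF op smooth_on_vector_derivative(1)[OF op X'] sm]])
       (use i in \<open>simp add: cov_deriv_def\<close>)
qed

lemma bracket_field_in_chart:
  assumes "tangent_field \<gamma> I X" "tangent_field \<gamma> I Y" "i \<in> charts M" "t \<in> I" "\<gamma> t \<in> dom M i"
  shows "bracket M (\<gamma> t) (X t) (Y t) = area M i (chart M i (\<gamma> t)) (X t i) (Y t i)"
  using assms unfolding tangent_field_def by (intro bracket_in_chart[OF M]) auto

lemma smooth_on_bracket:
  assumes I: "open I" and \<gamma>: "smooth_curve M \<gamma> I" and X: "tangent_field \<gamma> I X" and Y: "tangent_field \<gamma> I Y"
    and i: "i \<in> charts M"
  shows "smooth_on {t \<in> I. \<gamma> t \<in> dom M i} (\<lambda>t. bracket M (\<gamma> t) (X t) (Y t))"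
proof (rule smooth_on_cong[OF open_chart_times[OF I \<gamma> i]])
  let ?S = "{t \<in> I. \<gamma> t \<in> dom M i}"
  show "smooth_on ?S (\<lambda>t. area M i ((chart M i \<circ> \<gamma>) t) (X t i) (Y t i))"
  proof (rule smooth_on_bilinear_field[where B = "area M i" and x = "chart M i \<circ> \<gamma>",
        OF open_chart_times[OF I \<gamma> i] chart_image_open[OF i]])
    show "smooth_on ?S (chart M i \<circ> \<gamma>)" using \<gamma> i unfolding smooth_curve_def by blast
    show "smooth_on ?S (\<lambda>t. X t i)" "smooth_on ?S (\<lambda>t. Y t i)"
      using X Y i by (simp_all add: tangent_field_def)
  qed (use area_bilinear[OF i] area_smooth[OF i] in auto)
  show "area M i ((chart M i \<circ> \<gamma>) t) (X t i) (Y t i) = bracket M (\<gamma> t) (X t) (Y t)" if "t \<in> ?S" for t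
    using bracket_field_in_chart[OF X Y i] that by simp
qed

text \<open>Because the area form is parallel, the derivative of its coefficients in a chart is expressed by
  Christoffel symbols. These are the terms that complete ordinary derivatives to covariant ones.\<close>

lemma bracket_leibniz:
  assumes I: "open I" and \<gamma>: "smooth_curve M \<gamma> I" and X: "tangent_field \<gamma> I X" and Y: "tangent_field \<gamma> I Y"
    and t: "t \<in> I"
  shows "((\<lambda>t. bracket M (\<gamma> t) (X t) (Y t)) has_real_derivative
    bracket M (\<gamma> t) (cov_deriv M \<gamma> X t) (Y t) + bracket M (\<gamma> t) (X t) (cov_deriv M \<gamma> Y t)) (at t)"
proof -
  obtain i where i: "i \<in> charts M" "\<gamma> t \<in> dom M i" using in_some_chart[OF curve_in_space[OF \<gamma> t]] .
  let ?x = "chart M i (\<gamma> t)" and ?v = "velocity M \<gamma> t i"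
  let ?X' = "vector_derivative (\<lambda>s. X s i) (at t)" and ?Y' = "vector_derivative (\<lambda>s. Y s i) (at t)"
  have x: "?x \<in> chart M i ` dom M i" using i by blast
  note bil = area_bilinear[OF i(1) x]
  have "((\<lambda>s. area M i ((chart M i \<circ> \<gamma>) s) (X s i) (Y s i)) has_vector_derivative
      frechet_derivative (\<lambda>y. area M i y (X t i) (Y t i)) (at ((chart M i \<circ> \<gamma>) t)) ?v
        + area M i ((chart M i \<circ> \<gamma>) t) ?X' (Y t i) + area M i ((chart M i \<circ> \<gamma>) t) (X t i) ?Y') (at t)"
    using i x
    by (intro has_vector_derivative_bilinear_field[where B = "area M i" and x = "chart M i \<circ> \<gamma>",
          OF chart_image_open[OF i(1)]] area_bilinear area_smooth
        chart_curve_derivative[OF I \<gamma> i(1) t] tangent_field_component_derivative[OF I \<gamma> X i(1) t]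
        tangent_field_component_derivative[OF I \<gamma> Y i(1) t]) auto
  then have "((\<lambda>s. area M i (chart M i (\<gamma> s)) (X s i) (Y s i)) has_real_derivative
      area M i ?x (cov_deriv M \<gamma> X t i) (Y t i) + area M i ?x (X t i) (cov_deriv M \<gamma> Y t i)) (at t)"
    using i area_parallel[OF i(1) x, of "X t i" "Y t i" ?v]
    by (simp add: has_real_derivative_iff_has_vector_derivative cov_deriv_def
        bilinear_ladd[OF bil] bilinear_radd[OF bil] algebra_simps)
  then have "((\<lambda>t. bracket M (\<gamma> t) (X t) (Y t)) has_real_derivative
      area M i ?x (cov_deriv M \<gamma> X t i) (Y t i) + area M i ?x (X t i) (cov_deriv M \<gamma> Y t i)) (at t)"
    by (rule has_field_derivative_transform_within_open[OF _ open_chart_times[OF I \<gamma> i(1)]])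
       (use t i bracket_field_in_chart[OF X Y i(1)] in auto)
  then show ?thesis
    using bracket_field_in_chart[OF tangent_field_cov_deriv[OF I \<gamma> X] Y i(1) t i(2)]
      bracket_field_in_chart[OF X tangent_field_cov_deriv[OF I \<gamma> Y] i(1) t i(2)] by simp
qed

lemma curve_deriv_Suc: "curve_deriv M \<gamma> (Suc (Suc n)) = cov_deriv M \<gamma> (curve_deriv M \<gamma> (Suc n))"
  by (simp add: curve_deriv_def)

lemma tangent_field_curve_deriv:
  assumes "open I" "smooth_curve M \<gamma> I"
  shows "tangent_field \<gamma> I (curve_deriv M \<gamma> (Suc n))"
proof (induction n)
  case 0
  then show ?case using tangent_field_velocity[OF assms] by (simp add: curve_deriv_def)
next
  case (Suc n)
  then show ?case using tangent_field_cov_deriv[OF assms] by (simp add: curve_deriv_Suc)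
qed

lemma br_derivative:
  assumes "open I" "smooth_curve M \<gamma> I" "t \<in> I"
  shows "(br M \<gamma> (Suc j) (Suc k) has_real_derivative
    br M \<gamma> (Suc (Suc j)) (Suc k) t + br M \<gamma> (Suc j) (Suc (Suc k)) t) (at t)"
  using bracket_leibniz[OF assms(1,2) tangent_field_curve_deriv[OF assms(1,2), of j]
      tangent_field_curve_deriv[OF assms(1,2), of k] assms(3)]
  unfolding br_def[abs_def] curve_deriv_Suc .

lemma br_smooth:
  assumes "open I" "smooth_curve M \<gamma> I" "i \<in> charts M"
  shows "smooth_on {t \<in> I. \<gamma> t \<in> dom M i} (br M \<gamma> (Suc j) (Suc k))"
  unfolding br_def[abs_def]
  by (rule smooth_on_bracket[OF assms(1,2) tangent_field_curve_deriv[OF assms(1,2)]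
      tangent_field_curve_deriv[OF assms(1,2)] assms(3)])

lemma br_self: "open I \<Longrightarrow> smooth_curve M \<gamma> I \<Longrightarrow> t \<in> I \<Longrightarrow> br M \<gamma> (Suc k) (Suc k) t = 0"
  unfolding br_def using tangent_field_curve_deriv[of I \<gamma> k] curve_in_space
  by (intro bracket_self) (auto simp: tangent_field_def)

end

section \<open>Local solutions of autonomous differential equations\<close>

lemma lipschitz_on_cball:
  fixes H :: "'a::euclidean_space \<Rightarrow> 'b::euclidean_space"
  assumes "cball y0 R \<subseteq> W" "higher_differentiable_on W H 1"
  obtains L where "L > 0" "\<And>x y. x \<in> cball y0 R \<Longrightarrow> y \<in> cball y0 R \<Longrightarrow> norm (H x - H y) \<le> L * norm (x - y)"
proof -
  let ?B = "cball y0 R" and ?D = "\<lambda>x. frechet_derivative H (at x)"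
  have D: "(H has_derivative ?D x) (at x)" if "x \<in> ?B" for x
    using assms that by (auto simp: frechet_derivative_works)
  have "\<exists>C. \<forall>x\<in>?B. norm (?D x b) \<le> C" for b
  proof -
    have "continuous_on ?B (\<lambda>x. ?D x b)"
      using assms by (auto intro: continuous_on_subset)
    then have "bounded ((\<lambda>x. ?D x b) ` ?B)"
      by (intro compact_imp_bounded compact_continuous_image) auto
    then show ?thesis by (auto simp: bounded_iff)
  qed
  then obtain C where C: "\<And>b x. x \<in> ?B \<Longrightarrow> norm (?D x b) \<le> C b" by metis
  define L where "L = (\<Sum>b\<in>Basis. \<bar>C b\<bar>) + 1"
  have bound: "onorm (?D x) \<le> L" if x: "x \<in> ?B" for x
  proof (rule onorm_le)
    fix v
    have "?D x v = (\<Sum>b\<in>Basis. (v \<bullet> b) *\<^sub>R ?D x b)"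
      by (rule linear_basis_expansion[OF has_derivative_linear[OF D[OF x]]])
    also have "norm \<dots> \<le> (\<Sum>b\<in>Basis. norm v * \<bar>C b\<bar>)"
    proof (rule sum_norm_le)
      fix b :: 'a assume "b \<in> Basis"
      then have "\<bar>v \<bullet> b\<bar> \<le> norm v" by (rule Basis_le_norm)
      moreover have "norm (?D x b) \<le> \<bar>C b\<bar>" using C[OF x, of b] by linarith
      ultimately show "norm ((v \<bullet> b) *\<^sub>R ?D x b) \<le> norm v * \<bar>C b\<bar>"
        by (simp add: mult_mono)
    qed
    also have "\<dots> \<le> L * norm v"
      by (simp add: L_def sum_distrib_left[symmetric] algebra_simps)
    finally show "norm (?D x v) \<le> L * norm v" .
  qed
  have "norm (H x - H y) \<le> L * norm (x - y)" if "x \<in> ?B" "y \<in> ?B" for x y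
    using D bound that
    by (intro differentiable_bound[of ?B H ?D]) (auto intro: has_derivative_at_withinI)
  moreover have "L > 0" unfolding L_def by (intro add_nonneg_pos sum_nonneg) auto
  ultimately show thesis by (rule that[rotated])
qed

lemma norm_integral_from_0_le:
  fixes f :: "real \<Rightarrow> 'a::euclidean_space"
  assumes f: "continuous_on {-r..r} f" and t: "t \<in> {-r..r}" and M: "\<And>s. norm (f s) \<le> M"
  shows "norm (integral {-r..t} f - integral {-r..0} f) \<le> M * r"
proof -
  have "norm (integral {-r..t} f - integral {-r..0} f) \<le> M * norm (t - 0)"
  proof (rule differentiable_bound)
    show "((\<lambda>t. integral {-r..t} f) has_derivative (\<lambda>h. h *\<^sub>R f s)) (at s within {-r..r})"
      if "s \<in> {-r..r}" for s
      using integral_has_vector_derivative[OF f that] by (simp add: has_vector_derivative_def)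
    show "onorm (\<lambda>h. h *\<^sub>R f s) \<le> M" for s
      using M[of s] by (intro onorm_le) (simp add: mult.commute[of M] mult_left_mono)
  qed (use t in auto)
  also have "\<dots> \<le> M * r"
    using t order_trans[OF norm_ge_zero M] by (intro mult_left_mono) auto
  finally show ?thesis .
qed

text \<open>The solution is the fixed point of the integral operator, which is a contraction of the space
  of continuous curves with values in a closed ball once the time interval is short. Curves are extended
  to all times by freezing them at the ends of the interval.\<close>

lemma picard_lindeloef:
  fixes H :: "'a::euclidean_space \<Rightarrow> 'a"
  assumes W: "open W" "y0 \<in> W" and H: "higher_differentiable_on W H 1"
  obtains e y where "0 < e" "y 0 = y0"
    "\<And>t. t \<in> {-e<..<e} \<Longrightarrow> y t \<in> W"
    "\<And>t. t \<in> {-e<..<e} \<Longrightarrow> (y has_vector_derivative H (y t)) (at t)"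
proof -
  obtain R where R: "R > 0" "cball y0 R \<subseteq> W"
    using W open_contains_cball by blast
  let ?B = "cball y0 R"
  obtain L where L: "L > 0"
    "\<And>x y. x \<in> ?B \<Longrightarrow> y \<in> ?B \<Longrightarrow> norm (H x - H y) \<le> L * norm (x - y)"
    using lipschitz_on_cball[OF R(2) H] by blast
  have cH: "continuous_on ?B H"
    using higher_differentiable_on_SucD[of W H 0] H R(2) by (auto intro: continuous_on_subset)
  then have "bounded (H ` ?B)" by (intro compact_imp_bounded compact_continuous_image) auto
  then obtain M where M: "M > 0" "\<And>x. x \<in> ?B \<Longrightarrow> norm (H x) \<le> M"
    unfolding bounded_pos by auto
  define r where "r = min (R / M) (1 / (2 * L))"
  have r: "r > 0" "M * r \<le> R" "L * r \<le> 1/2"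
    using R(1) M(1) L(1) by (auto simp: r_def field_simps min_def)
  define c where "c t = max (-r) (min r t)" for t
  have c: "continuous_on UNIV c" "c t \<in> {-r..r}" for t
    using r(1) by (auto simp: c_def[abs_def] intro!: continuous_intros)
  define J where "J \<phi> t = integral {-r..t} (\<lambda>s. H (\<phi> s)) - integral {-r..0} (\<lambda>s. H (\<phi> s))" for \<phi> t
  define S :: "(real \<Rightarrow>\<^sub>C 'a) set" where "S = PiC UNIV (\<lambda>_. ?B)"
  have S: "apply_bcontfun \<phi> t \<in> ?B" if "\<phi> \<in> S" for \<phi> t
    using that unfolding S_def mem_PiC_iff by auto
  have cH\<phi>: "continuous_on T (\<lambda>s. H (apply_bcontfun \<phi> s))" if "\<phi> \<in> S" for \<phi> T
    using S[OF that] by (intro continuous_on_compose2[OF cH]) auto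
  have J': "(J \<phi> has_vector_derivative H (apply_bcontfun \<phi> t)) (at t within {-r..r})"
    if "\<phi> \<in> S" "t \<in> {-r..r}" for \<phi> t
    using integral_has_vector_derivative[OF cH\<phi>[OF that(1)] that(2)]
    unfolding J_def by (auto intro!: derivative_eq_intros)
  have JR: "norm (J \<phi> t) \<le> R" if "\<phi> \<in> S" "t \<in> {-r..r}" for \<phi> t
    using order_trans[OF norm_integral_from_0_le[OF cH\<phi>[OF that(1)] that(2) M(2)[OF S[OF that(1)]]] r(2)]
    unfolding J_def .
  define T where "T \<phi> = Bcontfun (\<lambda>t. y0 + J \<phi> (c t))" for \<phi> :: "real \<Rightarrow>\<^sub>C 'a"
  have T: "apply_bcontfun (T \<phi>) t = y0 + J \<phi> (c t)" if "\<phi> \<in> S" for \<phi> t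
  proof -
    have "continuous_on {-r..r} (J \<phi>)"
      unfolding continuous_on_eq_continuous_within
      using has_vector_derivative_continuous[OF J'[OF that]] by blast
    then have "continuous_on UNIV (\<lambda>t. y0 + J \<phi> (c t))"
      using c by (intro continuous_intros continuous_on_compose2[of "{-r..r}" "J \<phi>" UNIV c]) auto
    moreover have "norm (y0 + J \<phi> (c t)) \<le> norm y0 + R" for t
      using norm_triangle_ineq[of y0 "J \<phi> (c t)"] JR[OF that c(2)[of t]] by linarith
    ultimately have "(\<lambda>t. y0 + J \<phi> (c t)) \<in> bcontfun" by (rule bcontfun_normI)
    then show ?thesis by (simp add: T_def Bcontfun_inverse)
  qed
  have "\<exists>!\<phi>\<in>S. T \<phi> = \<phi>"
  proof (rule Banach_fix)
    have "closed S" unfolding S_def by (rule closed_PiC) simp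
    then show "complete S" using complete_eq_closed by blast
    have "const_bcontfun y0 \<in> S" using R(1) by (simp add: S_def mem_PiC_iff)
    then show "S \<noteq> {}" by blast
    show "T ` S \<subseteq> S"
    proof
      fix \<psi> assume "\<psi> \<in> T ` S"
      then obtain \<phi> where \<phi>: "\<phi> \<in> S" "\<psi> = T \<phi>" by blast
      have "apply_bcontfun \<psi> t \<in> ?B" for t
        using JR[OF \<phi>(1) c(2)[of t]] by (simp add: \<phi>(2) T[OF \<phi>(1)] dist_norm)
      then show "\<psi> \<in> S" by (simp add: S_def mem_PiC_iff)
    qed
    fix \<phi> \<psi> assume \<phi>\<psi>: "\<phi> \<in> S" "\<psi> \<in> S"
    show "dist (T \<phi>) (T \<psi>) \<le> 1/2 * dist \<phi> \<psi>"
    proof (rule dist_bound)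
      fix t
      let ?f = "\<lambda>s. H (apply_bcontfun \<phi> s) - H (apply_bcontfun \<psi> s)"
      have int: "(\<lambda>s. H (apply_bcontfun \<phi> s)) integrable_on {-r..u}"
        "(\<lambda>s. H (apply_bcontfun \<psi> s)) integrable_on {-r..u}" for u
        using cH\<phi> \<phi>\<psi> by (auto intro: integrable_continuous_real)
      have "J \<phi> (c t) - J \<psi> (c t) = integral {-r..c t} ?f - integral {-r..0} ?f"
        unfolding J_def integral_diff[OF int] by simp
      also have "norm \<dots> \<le> (L * dist \<phi> \<psi>) * r"
      proof (rule norm_integral_from_0_le[OF _ c(2)])
        show "continuous_on {-r..r} ?f" using cH\<phi> \<phi>\<psi> by (auto intro: continuous_intros)
        show "norm (?f s) \<le> L * dist \<phi> \<psi>" for s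
        proof -
          have "norm (?f s) \<le> L * dist (apply_bcontfun \<phi> s) (apply_bcontfun \<psi> s)"
            using L(2) S \<phi>\<psi> by (simp add: dist_norm)
          also have "\<dots> \<le> L * dist \<phi> \<psi>"
            using L(1) dist_bounded by (intro mult_left_mono) auto
          finally show ?thesis .
        qed
      qed
      also have "\<dots> = (L * r) * dist \<phi> \<psi>" by simp
      also have "\<dots> \<le> 1/2 * dist \<phi> \<psi>" using r(3) by (intro mult_right_mono) auto
      finally show "dist (apply_bcontfun (T \<phi>) t) (apply_bcontfun (T \<psi>) t) \<le> 1/2 * dist \<phi> \<psi>"
        by (simp add: T \<phi>\<psi> dist_norm)
    qed
  qed auto
  then obtain \<phi> where \<phi>: "\<phi> \<in> S" "T \<phi> = \<phi>" by blast
  have eq: "apply_bcontfun \<phi> t = y0 + J \<phi> (c t)" for t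
    using T[OF \<phi>(1), of t] \<phi>(2) by simp
  show thesis
  proof (rule that[of r "apply_bcontfun \<phi>"])
    show "apply_bcontfun \<phi> 0 = y0" using eq[of 0] r(1) by (simp add: c_def J_def)
    show "apply_bcontfun \<phi> t \<in> W" for t using S[OF \<phi>(1)] R(2) by blast
    fix t assume t: "t \<in> {-r<..<r}"
    have "(J \<phi> has_vector_derivative H (apply_bcontfun \<phi> t)) (at t within {-r<..<r})"
      using J'[OF \<phi>(1), of t] t by (auto intro: has_vector_derivative_within_subset)
    then have "((\<lambda>t. y0 + J \<phi> t) has_vector_derivative H (apply_bcontfun \<phi> t)) (at t)"
      using t at_within_open[of t "{-r<..<r}"] by (auto intro!: derivative_eq_intros)
    then show "(apply_bcontfun \<phi> has_vector_derivative H (apply_bcontfun \<phi> t)) (at t)"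
      by (rule has_vector_derivative_transform_within_open[of _ _ _ "{-r<..<r}"])
         (use t in \<open>auto simp: eq[symmetric] c_def eq\<close>)
  qed (use r in auto)
qed

text \<open>Since the right-hand side is smooth, each order of regularity of a solution passes to its
  derivative.\<close>

lemma smooth_solution:
  fixes H :: "'a::euclidean_space \<Rightarrow> 'a"
  assumes "open W" "open I" "smooth_on W H" "y ` I \<subseteq> W"
    "\<And>t. t \<in> I \<Longrightarrow> (y has_vector_derivative H (y t)) (at t)"
  shows "smooth_on I y"
proof -
  have "higher_differentiable_on I y n" for n
  proof (induction n)
    case 0
    have "isCont y t" if "t \<in> I" for t
      using has_vector_derivative_continuous[OF assms(5)[OF that]] .
    then show ?case by (simp add: continuous_at_imp_continuous_on)
  next
    case (Suc n)
    have "higher_differentiable_on I (\<lambda>t. H (y t)) n"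
      by (rule higher_differentiable_on_compose[OF assms(2,1,4) Suc assms(3)[unfolded smooth_on_def, rule_format]])
    from higher_differentiable_on_vector_derivativeI[OF assms(2) assms(5) this] show ?case .
  qed
  then show ?thesis by (simp add: smooth_on_def)
qed

section \<open>Curves with prescribed curvature\<close>

lemma zero_derivative_imp_constant:
  fixes f :: "real \<Rightarrow> real"
  assumes "0 < e" "\<And>t. t \<in> {-e<..<e} \<Longrightarrow> (f has_real_derivative 0) (at t)" "t \<in> {-e<..<e}"
  shows "f t = f 0"
proof -
  have "\<exists>c. \<forall>t\<in>{-e<..<e}. f t = c"
    using assms(2) by (intro has_field_derivative_zero_constant)
      (auto intro: has_field_derivative_at_within)
  then show ?thesis using assms(1,3) by auto
qed

text \<open>The terms \<open>\<kappa>\<close> and \<open>- \<kappa>\<close> in the two frame equations make the system trace-free, so that the area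
  of the frame stays constant. Time is added as a coordinate to make the system autonomous.\<close>

lemma moving_frame_exists:
  fixes M :: "('m, 'i) equi_affine" and \<mu> a :: "real \<Rightarrow> real" and \<kappa> :: real
  assumes M: "equi_affine_2_manifold M" and i: "i \<in> charts M" "p \<in> dom M i" and \<eta>: "0 < \<eta>"
    and \<mu>: "smooth_on {-\<eta><..<\<eta>} \<mu>" and a: "smooth_on {-\<eta><..<\<eta>} a"
  obtains e x e1 e2 where "0 < e" "e \<le> \<eta>" "smooth_on {-e<..<e} x"
    "\<And>t. t \<in> {-e<..<e} \<Longrightarrow> x t \<in> chart M i ` dom M i"
    "\<And>t. t \<in> {-e<..<e} \<Longrightarrow> (x has_vector_derivative e1 t) (at t)"
    "\<And>t. t \<in> {-e<..<e} \<Longrightarrow> (e1 has_vector_derivative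
       \<kappa> *\<^sub>R e1 t + a t *\<^sub>R e2 t - christoffel M i (x t) (e1 t) (e1 t)) (at t)"
    "\<And>t. t \<in> {-e<..<e} \<Longrightarrow> (e2 has_vector_derivative
       \<mu> t *\<^sub>R e1 t - \<kappa> *\<^sub>R e2 t - christoffel M i (x t) (e1 t) (e2 t)) (at t)"
    "\<And>t. t \<in> {-e<..<e} \<Longrightarrow> area M i (x t) (e1 t) (e2 t) = 1"
proof -
  let ?U = "chart M i ` dom M i" and ?I = "{-\<eta><..<\<eta>}" and ?\<Gamma> = "christoffel M i"
  define W where "W = ?I \<times> ?U \<times> (UNIV :: (real^2) set) \<times> (UNIV :: (real^2) set)"
  define H where "H y = (1 :: real, fst (snd (snd y)),
      \<kappa> *\<^sub>R fst (snd (snd y)) + a (fst y) *\<^sub>R snd (snd (snd y))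
        - ?\<Gamma> (fst (snd y)) (fst (snd (snd y))) (fst (snd (snd y))),
      \<mu> (fst y) *\<^sub>R fst (snd (snd y)) - \<kappa> *\<^sub>R snd (snd (snd y))
        - ?\<Gamma> (fst (snd y)) (fst (snd (snd y))) (snd (snd (snd y))))"
    for y :: "real \<times> (real^2) \<times> (real^2) \<times> (real^2)"
  have U: "open ?U" by (rule chart_image_open[OF M i(1)])
  have W: "open W" unfolding W_def using U by (intro open_Times) auto
  have sub: "fst ` W \<subseteq> ?I" "(\<lambda>y. fst (snd y)) ` W \<subseteq> ?U" by (auto simp: W_def)
  note id = smooth_on_ident[OF W]
  note sn = smooth_on_linear[OF bounded_linear_snd W]
  note pr = smooth_on_linear[OF bounded_linear_fst W id] smooth_on_linear[OF bounded_linear_fst W sn[OF id]]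
    smooth_on_linear[OF bounded_linear_fst W sn[OF sn[OF id]]] sn[OF sn[OF sn[OF id]]]
  have c: "smooth_on W (\<lambda>y. a (fst y))" "smooth_on W (\<lambda>y. \<mu> (fst y))"
    by (rule smooth_on_compose[OF W _ sub(1) pr(1)]; (rule a \<mu> open_greaterThanLessThan))+
  note \<Gamma> = smooth_on_bilinear_field[where B = ?\<Gamma>, OF W U sub(2) christoffel_bilinear[OF M i(1)]
      christoffel_smooth[OF M i(1)] pr(2)]
  have H: "smooth_on W H"
    unfolding H_def[abs_def]
    by (intro smooth_on_Pair smooth_on_const smooth_on_diff smooth_on_add smooth_on_scaleR W pr c \<Gamma>)
  define A where "A = area M i (chart M i p) (axis 1 1) (axis 2 1)"
  have x0: "chart M i p \<in> ?U" using i by blast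
  have A: "A > 0" unfolding A_def by (rule area_pos[OF M i(1) x0])
  define y0 :: "real \<times> (real^2) \<times> (real^2) \<times> (real^2)"
    where "y0 = (0, chart M i p, axis 1 1, (1 / A) *\<^sub>R axis 2 1)"
  have y0: "y0 \<in> W" using \<eta> x0 by (simp add: y0_def W_def)
  obtain e y where e: "0 < e" and y0': "y 0 = y0" and yW: "\<And>t. t \<in> {-e<..<e} \<Longrightarrow> y t \<in> W"
    and y': "\<And>t. t \<in> {-e<..<e} \<Longrightarrow> (y has_vector_derivative H (y t)) (at t)"
    using picard_lindeloef[OF W y0, of H] H unfolding smooth_on_def by metis
  let ?J = "{-e<..<e}"
  have sy: "smooth_on ?J y"
    using yW y' by (intro smooth_solution[OF W _ H]) auto
  define x e1 e2 where "x t = fst (snd (y t))" and "e1 t = fst (snd (snd (y t)))"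
    and "e2 t = snd (snd (snd (y t)))" for t
  have d: "(fst \<circ> y has_vector_derivative 1) (at t)"
    "(x has_vector_derivative e1 t) (at t)"
    "(e1 has_vector_derivative
       \<kappa> *\<^sub>R e1 t + a (fst (y t)) *\<^sub>R e2 t - ?\<Gamma> (x t) (e1 t) (e1 t)) (at t)"
    "(e2 has_vector_derivative
       \<mu> (fst (y t)) *\<^sub>R e1 t - \<kappa> *\<^sub>R e2 t - ?\<Gamma> (x t) (e1 t) (e2 t)) (at t)"
    if t: "t \<in> ?J" for t
  proof -
    note s = bounded_linear.has_vector_derivative[OF bounded_linear_snd]
      and f = bounded_linear.has_vector_derivative[OF bounded_linear_fst]
    note Y = y'[OF t]
    show "(fst \<circ> y has_vector_derivative 1) (at t)"
      using f[OF Y] by (simp add: H_def comp_def)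
    show "(x has_vector_derivative e1 t) (at t)"
      using f[OF s[OF Y]] unfolding x_def[abs_def] e1_def by (simp add: H_def)
    show "(e1 has_vector_derivative
       \<kappa> *\<^sub>R e1 t + a (fst (y t)) *\<^sub>R e2 t - ?\<Gamma> (x t) (e1 t) (e1 t)) (at t)"
      using f[OF s[OF s[OF Y]]] unfolding x_def e1_def[abs_def] e2_def by (simp add: H_def)
    show "(e2 has_vector_derivative
       \<mu> (fst (y t)) *\<^sub>R e1 t - \<kappa> *\<^sub>R e2 t - ?\<Gamma> (x t) (e1 t) (e2 t)) (at t)"
      using s[OF s[OF s[OF Y]]] unfolding x_def e1_def e2_def[abs_def] by (simp add: H_def)
  qed
  have time: "fst (y t) = t" if "t \<in> ?J" for t
  proof -
    have "((\<lambda>t. (fst \<circ> y) t - t) has_real_derivative 1 - 1) (at s)" if "s \<in> ?J" for s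
      using d(1)[OF that] by (intro DERIV_diff) (auto simp: has_real_derivative_iff_has_vector_derivative comp_def)
    then have "(fst \<circ> y) t - t = (fst \<circ> y) 0 - 0"
      by (intro zero_derivative_imp_constant[OF e _ that]) simp
    then show ?thesis by (simp add: y0' y0_def)
  qed
  have xU: "x t \<in> ?U" if "t \<in> ?J" for t using yW[OF that] by (auto simp: W_def x_def mem_Times_iff)
  have "e \<le> \<eta>"
  proof (rule ccontr)
    assume "\<not> e \<le> \<eta>"
    then have "\<eta> \<in> ?J" using \<eta> by auto
    from yW[OF this] time[OF this] show False by (auto simp: W_def mem_Times_iff)
  qed
  moreover have "smooth_on ?J x"
    unfolding x_def[abs_def]
    by (intro smooth_on_linear[OF bounded_linear_fst] smooth_on_linear[OF bounded_linear_snd] sy) auto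
  moreover have "area M i (x t) (e1 t) (e2 t) = 1" if t: "t \<in> ?J" for t
  proof -
    have "((\<lambda>s. area M i (x s) (e1 s) (e2 s)) has_real_derivative 0) (at t)" if t: "t \<in> ?J" for t
    proof -
      note bil = area_bilinear[OF M i(1) xU[OF t]]
      show ?thesis
        using has_vector_derivative_bilinear_field[where B = "area M i" and x = x and t = t,
            OF U xU[OF t] area_bilinear[OF M i(1)] area_smooth[OF M i(1)] d(2)[OF t] d(3)[OF t] d(4)[OF t]]
        unfolding area_parallel[OF M i(1) xU[OF t]]
        by (simp add: bilinear_ladd[OF bil] bilinear_radd[OF bil] bilinear_lsub[OF bil] bilinear_rsub[OF bil]
            bilinear_lmul[OF bil] bilinear_rmul[OF bil] area_self[OF M i(1) xU[OF t]]
            has_real_derivative_iff_has_vector_derivative)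
    qed
    from zero_derivative_imp_constant[OF e this t]
    have "area M i (x t) (e1 t) (e2 t) = area M i (x 0) (e1 0) (e2 0)" .
    also have "\<dots> = 1"
      using A bilinear_rmul[OF area_bilinear[OF M i(1) x0]]
      by (simp add: x_def e1_def e2_def y0' y0_def A_def[symmetric])
    finally show ?thesis .
  qed
  ultimately show thesis
    using e xU d(2-4) time by (intro that[of e x e1 e2]) auto
qed

text \<open>The frame equations give the components of the derivatives of the curve in a frame of area \<open>1\<close>,
  so the brackets are determinants of these components. All of this can be done in the one chart in which
  the frame was constructed, since the curve stays there.\<close>

lemma curve_from_frame:
  fixes M :: "('m, 'i) equi_affine" and x e1 e2 :: "real \<Rightarrow> real^2" and a \<mu> :: "real \<Rightarrow> real"
  assumes M: "equi_affine_2_manifold M" and i: "i \<in> charts M" and e: "0 < e"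
    and x: "smooth_on {-e<..<e} x" "\<And>t. t \<in> {-e<..<e} \<Longrightarrow> x t \<in> chart M i ` dom M i"
    and x': "\<And>t. t \<in> {-e<..<e} \<Longrightarrow> (x has_vector_derivative e1 t) (at t)"
    and e1': "\<And>t. t \<in> {-e<..<e} \<Longrightarrow> (e1 has_vector_derivative
       \<kappa> *\<^sub>R e1 t + a t *\<^sub>R e2 t - christoffel M i (x t) (e1 t) (e1 t)) (at t)"
    and e2': "\<And>t. t \<in> {-e<..<e} \<Longrightarrow> (e2 has_vector_derivative
       \<mu> t *\<^sub>R e1 t - \<kappa> *\<^sub>R e2 t - christoffel M i (x t) (e1 t) (e2 t)) (at t)"
    and unit: "\<And>t. t \<in> {-e<..<e} \<Longrightarrow> area M i (x t) (e1 t) (e2 t) = 1"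
    and a': "\<And>t. t \<in> {-e<..<e} \<Longrightarrow> (a has_real_derivative a' t) (at t)"
  obtains \<gamma> where "regular_curve M \<gamma> {-e<..<e}"
    "\<And>t. t \<in> {-e<..<e} \<Longrightarrow> br M \<gamma> 1 2 t = a t"
    "\<And>t. t \<in> {-e<..<e} \<Longrightarrow> br M \<gamma> 1 3 t = a' t"
    "\<And>t. t \<in> {-e<..<e} \<Longrightarrow> br M \<gamma> 2 3 t = \<kappa> * a' t - a t * (\<kappa>\<^sup>2 + a t * \<mu> t)"
proof -
  let ?J = "{-e<..<e}" and ?U = "chart M i ` dom M i" and ?\<Gamma> = "christoffel M i"
  define \<gamma> where "\<gamma> t = inv_into (dom M i) (chart M i) (x t)" for t
  have dom: "\<gamma> t \<in> dom M i" and chart: "chart M i (\<gamma> t) = x t" if "t \<in> ?J" for t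
    using x(2)[OF that] unfolding \<gamma>_def by (auto intro: inv_into_into f_inv_into_f)
  have cont: "continuous_map (top_of_set ?J) (space_of M) \<gamma>"
  proof -
    obtain g where g: "homeomorphic_maps (subtopology (space_of M) (dom M i)) (top_of_set ?U) (chart M i) g"
      using chart_homeo[OF M i] unfolding homeomorphic_map_maps by blast
    then have "continuous_map (top_of_set ?U) (space_of M) g"
      unfolding homeomorphic_maps_def by (auto intro: continuous_map_into_fulltopology)
    moreover have "continuous_map (top_of_set ?J) (top_of_set ?U) x"
      using smooth_on_continuous[OF x(1)] x(2) by (auto simp: continuous_map_in_subtopology)
    ultimately have "continuous_map (top_of_set ?J) (space_of M) (g \<circ> x)"
      using continuous_map_compose by blast
    moreover have "(g \<circ> x) t = \<gamma> t" if "t \<in> topspace (top_of_set ?J)" for t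
    proof -
      have t: "t \<in> ?J" using that by simp
      have "topspace (subtopology (space_of M) (dom M i)) = dom M i"
        using openin_subset[OF chart_open[OF M i]] by (simp add: Int_absorb1)
      then have "g (chart M i (\<gamma> t)) = \<gamma> t"
        using g dom[OF t] unfolding homeomorphic_maps_def by blast
      then show ?thesis by (simp add: chart[OF t])
    qed
    ultimately show ?thesis by (rule continuous_map_eq)
  qed
  have smooth: "smooth_curve M \<gamma> ?J"
    unfolding smooth_curve_def
  proof (intro conjI ballI cont)
    fix j assume j: "j \<in> charts M"
    let ?S = "{t \<in> ?J. \<gamma> t \<in> dom M j}"
    have op: "open ?S"
    proof -
      have "openin (top_of_set ?J) {t \<in> topspace (top_of_set ?J). \<gamma> t \<in> dom M j}"
        by (rule openin_continuous_map_preimage[OF cont chart_open[OF M j]])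
      then show ?thesis by (simp add: openin_open_eq)
    qed
    have "x ` ?S \<subseteq> overlap M i j"
      using dom chart by (auto simp: overlap_def) (metis IntI greaterThanLessThan_iff imageI)
    moreover have "smooth_on ?S x" by (rule smooth_on_subset[OF x(1)]) auto
    ultimately have sm: "smooth_on ?S (\<lambda>t. transition M i j (x t))"
      by (intro smooth_on_compose[OF op overlap_open[OF M i j] _ _ transition_smooth[OF M i j]])
    show "smooth_on ?S (chart M j \<circ> \<gamma>)"
      by (rule smooth_on_cong[OF op _ sm]) (simp add: transition_chart[OF M i dom] flip: chart)
  qed
  note J = open_greaterThanLessThan[of "-e" e]
  have vel: "velocity M \<gamma> t i = e1 t" if t: "t \<in> ?J" for t
  proof -
    have "((chart M i \<circ> \<gamma>) has_vector_derivative e1 t) (at t)"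
      by (rule has_vector_derivative_transform_within_open[OF x'[OF t] J t]) (simp add: chart)
    then show ?thesis
      using dom[OF t] i by (simp add: velocity_def vector_derivative_at)
  qed
  have cov: "cov_deriv M \<gamma> X t i = X' + ?\<Gamma> (x t) (e1 t) (X t i)"
    if "t \<in> ?J" "((\<lambda>s. X s i) has_vector_derivative X') (at t)" for X X' t
    using that dom[OF that(1)] i by (simp add: cov_deriv_def chart vel vector_derivative_at)
  have \<Gamma>: "bilinear (?\<Gamma> (x t))" if "t \<in> ?J" for t
    by (rule christoffel_bilinear[OF M i x(2)[OF that]])
  have c1: "curve_deriv M \<gamma> 1 t i = e1 t" if "t \<in> ?J" for t
    using vel[OF that] by (simp add: curve_deriv_def)
  have c2: "curve_deriv M \<gamma> 2 t i = \<kappa> *\<^sub>R e1 t + a t *\<^sub>R e2 t" if t: "t \<in> ?J" for t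
  proof -
    have "((\<lambda>s. velocity M \<gamma> s i) has_vector_derivative
        \<kappa> *\<^sub>R e1 t + a t *\<^sub>R e2 t - ?\<Gamma> (x t) (e1 t) (e1 t)) (at t)"
      by (rule has_vector_derivative_transform_within_open[OF e1'[OF t] J t]) (simp add: vel)
    from cov[where X = "velocity M \<gamma>", OF t this] show ?thesis using vel[OF t] by (simp add: curve_deriv_def)
  qed
  have c3: "curve_deriv M \<gamma> 3 t i = (\<kappa>\<^sup>2 + a t * \<mu> t) *\<^sub>R e1 t + a' t *\<^sub>R e2 t" if t: "t \<in> ?J" for t
  proof -
    have "((\<lambda>s. \<kappa> *\<^sub>R e1 s + a s *\<^sub>R e2 s) has_vector_derivative
        \<kappa> *\<^sub>R (\<kappa> *\<^sub>R e1 t + a t *\<^sub>R e2 t - ?\<Gamma> (x t) (e1 t) (e1 t))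
        + (a t *\<^sub>R (\<mu> t *\<^sub>R e1 t - \<kappa> *\<^sub>R e2 t - ?\<Gamma> (x t) (e1 t) (e2 t)) + a' t *\<^sub>R e2 t)) (at t)"
      using e1'[OF t] e2'[OF t] a'[OF t]
      by (intro has_vector_derivative_add has_vector_derivative_scaleR
          bounded_linear.has_vector_derivative[OF bounded_linear_scaleR_right])
    then have "((\<lambda>s. curve_deriv M \<gamma> 2 s i) has_vector_derivative
        \<kappa> *\<^sub>R (\<kappa> *\<^sub>R e1 t + a t *\<^sub>R e2 t - ?\<Gamma> (x t) (e1 t) (e1 t))
        + (a t *\<^sub>R (\<mu> t *\<^sub>R e1 t - \<kappa> *\<^sub>R e2 t - ?\<Gamma> (x t) (e1 t) (e2 t)) + a' t *\<^sub>R e2 t)) (at t)"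
      by (rule has_vector_derivative_transform_within_open[OF _ J t]) (simp add: c2)
    from cov[where X = "curve_deriv M \<gamma> 2", OF t this] have "cov_deriv M \<gamma> (curve_deriv M \<gamma> 2) t i =
        (\<kappa>\<^sup>2 + a t * \<mu> t) *\<^sub>R e1 t + a' t *\<^sub>R e2 t"
      by (simp add: c2[OF t] bilinear_radd[OF \<Gamma>[OF t]] bilinear_rmul[OF \<Gamma>[OF t]] algebra_simps power2_eq_square)
    then show ?thesis
      using curve_deriv_Suc[OF M, of \<gamma> 1] by (simp add: numeral_2_eq_2 numeral_3_eq_3)
  qed
  have br: "br M \<gamma> (Suc j) (Suc k) t = area M i (x t) (curve_deriv M \<gamma> (Suc j) t i) (curve_deriv M \<gamma> (Suc k) t i)"
    if t: "t \<in> ?J" for j k t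
    unfolding br_def
    using bracket_field_in_chart[OF M tangent_field_curve_deriv[OF M J smooth]
        tangent_field_curve_deriv[OF M J smooth] i t dom[OF t]] chart[OF t] by simp
  have frame: "area M i (x t) (u1 *\<^sub>R e1 t + u2 *\<^sub>R e2 t) (w1 *\<^sub>R e1 t + w2 *\<^sub>R e2 t) = u1 * w2 - u2 * w1"
    if t: "t \<in> ?J" for t u1 u2 w1 w2
  proof -
    note bil = area_bilinear[OF M i x(2)[OF t]] and self = area_self[OF M i x(2)[OF t]]
    have "area M i (x t) (e2 t) (e1 t) = - 1"
      using self[of "e1 t + e2 t"] self[of "e1 t"] self[of "e2 t"] unit[OF t]
      by (simp add: bilinear_ladd[OF bil] bilinear_radd[OF bil])
    then show ?thesis
      using self unit[OF t]
      by (simp add: bilinear_ladd[OF bil] bilinear_radd[OF bil] bilinear_lmul[OF bil] bilinear_rmul[OF bil])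
  qed
  have c1': "curve_deriv M \<gamma> 1 t i = 1 *\<^sub>R e1 t + 0 *\<^sub>R e2 t" if "t \<in> ?J" for t
    using c1[OF that] by simp
  have "velocity M \<gamma> t j \<noteq> 0" if t: "t \<in> ?J" and j: "j \<in> charts M" "\<gamma> t \<in> dom M j" for t j
  proof
    assume 0: "velocity M \<gamma> t j = 0"
    have "chart M j (\<gamma> t) \<in> overlap M j i" using j dom[OF t] by (auto simp: overlap_def)
    then have "linear (dtransition M j i (chart M j (\<gamma> t)))" by (rule dtransition_linear[OF M j(1) i])
    moreover have "velocity M \<gamma> t i = dtransition M j i (chart M j (\<gamma> t)) (velocity M \<gamma> t j)"
      using tangent_field_velocity[OF M J smooth] t j i dom[OF t]
      unfolding tangent_field_def[OF M] tangent_vector_def by blast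
    ultimately have "e1 t = 0" using 0 vel[OF t] linear_0 by metis
    then show False
      using unit[OF t] bilinear_lzero[OF area_bilinear[OF M i x(2)[OF t]]] by simp
  qed
  then have "regular_curve M \<gamma> ?J" using smooth by (simp add: regular_curve_def)
  moreover have "br M \<gamma> 1 2 t = a t" if t: "t \<in> ?J" for t
    using br[OF t, of 0 1] frame[OF t, of 1 0 \<kappa> "a t"] c1'[OF t] c2[OF t] by (simp add: numeral_2_eq_2)
  moreover have "br M \<gamma> 1 3 t = a' t" if t: "t \<in> ?J" for t
    using br[OF t, of 0 2] frame[OF t, of 1 0 "\<kappa>\<^sup>2 + a t * \<mu> t" "a' t"] c1'[OF t] c3[OF t]
    by (simp add: numeral_3_eq_3 numeral_2_eq_2)
  moreover have "br M \<gamma> 2 3 t = \<kappa> * a' t - a t * (\<kappa>\<^sup>2 + a t * \<mu> t)" if t: "t \<in> ?J" for t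
    using br[OF t, of 1 2] frame[OF t, of \<kappa> "a t" "\<kappa>\<^sup>2 + a t * \<mu> t" "a' t"] c2[OF t] c3[OF t]
    by (simp add: numeral_3_eq_3 numeral_2_eq_2)
  ultimately show thesis by (rule that)
qed

lemma cube_root_moment_const: "cube_root_moment (\<lambda>_. c) t = 3/4 * c"
proof -
  have "cube_root_moment (\<lambda>_. c) = (\<lambda>_. cube_root_moment (\<lambda>_. c) 0)"
    by (simp add: cube_root_moment_def fun_eq_iff)
  then have "deriv (cube_root_moment (\<lambda>_. c)) t = 0" by (metis deriv_const)
  moreover have "t \<in> {- (\<bar>t\<bar> + 1)<..<\<bar>t\<bar> + 1}" by (simp add: abs_if)
  from cube_root_moment_ode[OF smooth_on_const this, of c]
  have "4/3 * cube_root_moment (\<lambda>_. c) t + t * deriv (cube_root_moment (\<lambda>_. c)) t = c" .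
  ultimately show ?thesis by simp
qed

text \<open>With \<open>a = (4/3)\<^sup>3 t\<close>, the equation says that \<open>b = \<kappa> a' - a (\<kappa>\<^sup>2 + a \<mu>)\<close> is the bracket of the second and
  third derivatives that the curvature \<open>f\<close> requires. The constant \<open>\<kappa>\<close> is chosen so that \<open>\<kappa> a' - b\<close> vanishes at
  \<open>0\<close>; the condition on the derivatives of \<open>f\<close> says precisely that \<open>\<kappa> a' - a \<kappa>\<^sup>2 - b\<close> then vanishes to second
  order, so that it is divisible by \<open>a\<^sup>2\<close>.\<close>

lemma frame_coefficients:
  fixes f :: "real \<Rightarrow> real"
  assumes \<eta>: "0 < \<eta>" and f: "smooth_on {-\<eta><..<\<eta>} f" "f 0 = - 5/16"
    and star: "32 * (deriv f 0)\<^sup>2 + 9 * deriv (deriv f) 0 = 0"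
  obtains \<kappa> \<mu> where "smooth_on {-\<eta><..<\<eta>} \<mu>"
    "\<And>t. t \<in> {-\<eta><..<\<eta>} \<Longrightarrow>
       t * (\<kappa> * (64/27) - 64/27 * t * (\<kappa>\<^sup>2 + 64/27 * t * \<mu> t)) = (4/3) ^ 5 * (f t + 5/16)"
proof -
  let ?I = "{-\<eta><..<\<eta>}"
  have I: "open ?I" "0 \<in> ?I" using \<eta> by auto
  obtain f1 where f1: "smooth_on ?I f1" "\<And>t. t \<in> ?I \<Longrightarrow> f t = f 0 + t * f1 t"
    using hadamard_quotient[OF f(1)] by blast
  obtain f2 where f2: "smooth_on ?I f2" "\<And>t. t \<in> ?I \<Longrightarrow> f1 t = f1 0 + t * f2 t"
    using hadamard_quotient[OF f1(1)] by blast
  obtain f3 where f3: "smooth_on ?I f3" "\<And>t. t \<in> ?I \<Longrightarrow> f2 t = f2 0 + t * f3 t"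
    using hadamard_quotient[OF f2(1)] by blast
  have const: "jet2 (\<lambda>t. c) c 0 0" for c
    using jet2_smooth[OF I, of "\<lambda>t. c"] by simp
  note j2 = jet2_smooth[OF I f2(1)]
  have "jet2 f1 (f1 0) (f2 0) (2 * deriv f2 0)"
    by (rule jet2_cong[OF I f2(2)[symmetric]])
       (auto intro: jet2_eqI[OF jet2_add[OF const jet2_mult[OF jet2_ident j2]]])
  then have "jet2 f (f 0) (f1 0) (2 * f2 0)"
    by (intro jet2_cong[OF I f1(2)[symmetric]])
       (auto intro: jet2_eqI[OF jet2_add[OF const jet2_mult[OF jet2_ident]]])
  from jet2_unique(2,3)[OF this] star have s: "32 * (f1 0)\<^sup>2 + 18 * f2 0 = 0" by simp
  \<comment> \<open>\<open>16/9 = (4/3)\<^sup>5 / (4/3)\<^sup>3\<close> and \<open>3/4 = (4/3)\<^sup>5 / ((4/3)\<^sup>3)\<^sup>2\<close>, from division by \<open>a'\<close> and by \<open>a\<^sup>2\<close>.\<close>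
  define \<kappa> where "\<kappa> = 16/9 * f1 0"
  define \<mu> where "\<mu> t = - (3/4) * f3 t" for t
  show thesis
  proof (rule that[of \<mu> \<kappa>])
    show "smooth_on ?I \<mu>"
      unfolding \<mu>_def[abs_def] by (intro smooth_on_mult smooth_on_const f3 I)
    fix t assume t: "t \<in> ?I"
    have "f t + 5/16 = t * (f1 0 + t * (f2 0 + t * f3 t))"
      using f1(2)[OF t] f2(2)[OF t] f3(2)[OF t] f(2) by simp
    moreover have "f2 0 = - (16/9) * (f1 0)\<^sup>2" using s by simp
    ultimately show "t * (\<kappa> * (64/27) - 64/27 * t * (\<kappa>\<^sup>2 + 64/27 * t * \<mu> t)) = (4/3) ^ 5 * (f t + 5/16)"
      unfolding \<kappa>_def \<mu>_def by algebra
  qed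
qed

text \<open>For \<open>a = (4/3)\<^sup>3 t\<close> the arclength integrand is \<open>4/3 * \<bar>u\<bar> powr (1/3)\<close>, so the \<open>3/4\<close>-arclength is \<open>t\<close>. Also
  \<open>a'' = 0\<close>, so the normalized curvature is an affine function of \<open>t b\<close>.\<close>

lemma curve_with_normalized_curvature:
  fixes M :: "('m, 'i) equi_affine"
  assumes M: "equi_affine_2_manifold M"
    and \<eta>: "0 < \<eta>" and f: "smooth_on {-\<eta><..<\<eta>} f" "f 0 = - 5/16"
    and star: "32 * (deriv f 0)\<^sup>2 + 9 * deriv (deriv f) 0 = 0"
  obtains \<gamma> \<epsilon> where "0 < \<epsilon>" "\<epsilon> \<le> \<eta>" "regular_curve M \<gamma> {-\<epsilon><..<\<epsilon>}" "generic_inflection M \<gamma> 0"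
    "\<And>t. t \<in> {-\<epsilon><..<\<epsilon>} \<Longrightarrow> arclength34 M \<gamma> t = t"
    "\<And>t. t \<in> {-\<epsilon><..<\<epsilon>} - {0} \<Longrightarrow> br M \<gamma> 1 2 t \<noteq> 0 \<and> normalized_curvature M \<gamma> t = f t"
proof -
  obtain \<kappa> \<mu> where \<mu>: "smooth_on {-\<eta><..<\<eta>} \<mu>"
    "\<And>t. t \<in> {-\<eta><..<\<eta>} \<Longrightarrow>
       t * (\<kappa> * (64/27) - 64/27 * t * (\<kappa>\<^sup>2 + 64/27 * t * \<mu> t)) = (4/3) ^ 5 * (f t + 5/16)"
    using frame_coefficients[OF \<eta> f star] by blast
  define a :: "real \<Rightarrow> real" where "a t = 64/27 * t" for t
  have sa: "smooth_on {-\<eta><..<\<eta>} a"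
    unfolding a_def[abs_def] by (intro smooth_on_mult smooth_on_const smooth_on_ident) auto
  have "topspace (space_of M) \<noteq> {}"
    using M by (simp add: equi_affine_2_manifold_def oriented_2_manifold_def)
  then obtain p where "p \<in> topspace (space_of M)" by blast
  then obtain i where i: "i \<in> charts M" "p \<in> dom M i" using in_some_chart[OF M] by blast
  obtain e x e1 e2 where e: "0 < e" "e \<le> \<eta>" and x: "smooth_on {-e<..<e} x"
    "\<And>t. t \<in> {-e<..<e} \<Longrightarrow> x t \<in> chart M i ` dom M i"
    "\<And>t. t \<in> {-e<..<e} \<Longrightarrow> (x has_vector_derivative e1 t) (at t)"
    "\<And>t. t \<in> {-e<..<e} \<Longrightarrow> (e1 has_vector_derivative
       \<kappa> *\<^sub>R e1 t + a t *\<^sub>R e2 t - christoffel M i (x t) (e1 t) (e1 t)) (at t)"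
    "\<And>t. t \<in> {-e<..<e} \<Longrightarrow> (e2 has_vector_derivative
       \<mu> t *\<^sub>R e1 t - \<kappa> *\<^sub>R e2 t - christoffel M i (x t) (e1 t) (e2 t)) (at t)"
    "\<And>t. t \<in> {-e<..<e} \<Longrightarrow> area M i (x t) (e1 t) (e2 t) = 1"
    using moving_frame_exists[OF M i \<eta> \<mu>(1) sa, of \<kappa>] by metis
  let ?J = "{-e<..<e}"
  have "(a has_real_derivative 64/27) (at t)" for t
    unfolding a_def by (auto intro!: derivative_eq_intros)
  then obtain \<gamma> where \<gamma>: "regular_curve M \<gamma> ?J"
    "\<And>t. t \<in> ?J \<Longrightarrow> br M \<gamma> 1 2 t = a t"
    "\<And>t. t \<in> ?J \<Longrightarrow> br M \<gamma> 1 3 t = 64/27"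
    "\<And>t. t \<in> ?J \<Longrightarrow> br M \<gamma> 2 3 t = \<kappa> * (64/27) - a t * (\<kappa>\<^sup>2 + a t * \<mu> t)"
    using curve_from_frame[OF M i(1) e(1) x, of "\<lambda>_. 64/27"] by metis
  have sm: "smooth_curve M \<gamma> ?J" using \<gamma>(1) by (simp add: regular_curve_def)
  have b14: "br M \<gamma> 1 4 t = - br M \<gamma> 2 3 t" if t: "t \<in> ?J" for t
  proof -
    have "(br M \<gamma> 1 3 has_real_derivative br M \<gamma> 2 3 t + br M \<gamma> 1 4 t) (at t)"
      using br_derivative[OF M open_greaterThanLessThan sm t, of 0 2]
      by (simp add: numeral_2_eq_2 numeral_3_eq_3 eval_nat_numeral)
    moreover have "(br M \<gamma> 1 3 has_real_derivative 0) (at t)"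
      by (rule has_field_derivative_transform_within_open[of "\<lambda>_. 64/27" 0 t ?J]) (use t \<gamma>(3) in auto)
    ultimately show ?thesis using DERIV_unique by fastforce
  qed
  have abs: "\<bar>br M \<gamma> 1 2 u\<bar> = \<bar>u\<bar> * (4/3) ^ 3" if "u \<in> ?J" for u
    using \<gamma>(2)[OF that] by (simp add: a_def abs_mult power3_eq_cube)
  note cube = affine_arclength_cube(2)[where g = "\<lambda>_. 4/3", OF smooth_on_const _ abs]
    normalized_curvature_cube[where g = "\<lambda>_. 4/3", OF smooth_on_const _ abs]
  show thesis
  proof (rule that[OF e \<gamma>(1)])
    show "generic_inflection M \<gamma> 0"
      using \<gamma>(2,3)[of 0] e(1) by (simp add: generic_inflection_def a_def)
    show "arclength34 M \<gamma> t = t" if "t \<in> ?J" for t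
      using cube(1)[OF _ _ that] by (simp add: cube_root_moment_const)
    fix t assume "t \<in> ?J - {0}"
    then have t: "t \<in> ?J" "t \<noteq> 0" by auto
    have b: "t * br M \<gamma> 2 3 t = (4/3) ^ 5 * (f t + 5/16)"
      using \<mu>(2)[of t] t(1) e(2) unfolding \<gamma>(4)[OF t(1)] a_def by auto
    have "normalized_curvature M \<gamma> t = (9 * (64/27) * (t * br M \<gamma> 2 3 t) - 5 * (64/27)\<^sup>2) / (9 * (4/3) ^ 8)"
      using cube(2)[OF _ _ t] unfolding b14[OF t(1)] \<gamma>(2,3)[OF t(1)]
      by (simp add: cube_root_moment_const a_def)
    also have "\<dots> = f t" unfolding b by (simp add: field_simps)
    finally show "br M \<gamma> 1 2 t \<noteq> 0 \<and> normalized_curvature M \<gamma> t = f t"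
      using \<gamma>(2)[OF t(1)] t(2) by (simp add: a_def)
  qed
qed

section \<open>Normalized curvature functions of generic inflection points\<close>

theorem theorem4p7:
  fixes M :: "('m, 'i) equi_affine"
  assumes "equi_affine_2_manifold M"
  shows
    "(\<forall>\<gamma> \<delta>. 0 < \<delta> \<and> regular_curve M \<gamma> {-\<delta><..<\<delta>} \<and> generic_inflection M \<gamma> 0 \<longrightarrow>
        (\<exists>\<epsilon> F \<theta>. 0 < \<epsilon> \<and> \<epsilon> \<le> \<delta> \<and>
           coordinate_on {-\<epsilon><..<\<epsilon>} (arclength34 M \<gamma>) \<theta> \<and>
           (\<forall>t\<in>{-\<epsilon><..<\<epsilon>} - {0}. br M \<gamma> 1 2 t \<noteq> 0 \<and> F t = normalized_curvature M \<gamma> t) \<and>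
           smooth_on {-\<epsilon><..<\<epsilon>} F \<and>
           smooth_on (arclength34 M \<gamma> ` {-\<epsilon><..<\<epsilon>}) (F \<circ> \<theta>) \<and>
           - (9/7) * ((br M \<gamma> 1 4 0 + br M \<gamma> 2 3 0) / br M \<gamma> 1 3 0) * deriv F 0
             + 32 * (deriv F 0)\<^sup>2 + 9 * (deriv ^^ 2) F 0 = 0 \<and>
           F 0 = - 5/16 \<and>
           32 * (deriv (F \<circ> \<theta>) 0)\<^sup>2 + 9 * (deriv ^^ 2) (F \<circ> \<theta>) 0 = 0 \<and>
           ((\<forall>\<^sub>F t in nhds 0. arclength34 M \<gamma> t = t) \<longrightarrow>
              32 * (deriv F 0)\<^sup>2 + 9 * (deriv ^^ 2) F 0 = 0)) \<and>
        (normalized_curvature M \<gamma> \<longlongrightarrow> - 5/16) (at 0) \<and>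
        ((\<lambda>t. (normalized_curvature M \<gamma> t + 5/16) / arclength34 M \<gamma> t) \<longlongrightarrow>
           - (3 * root 4 3 / (28 * sqrt 2)) * inflectional_curvature M \<gamma>) (at 0)) \<and>
     (\<forall>f \<eta>. 0 < \<eta> \<and> smooth_on {-\<eta><..<\<eta>} f \<and> f 0 = - 5/16 \<and>
          32 * (deriv f 0)\<^sup>2 + 9 * (deriv ^^ 2) f 0 = 0 \<longrightarrow>
        (\<exists>\<gamma> \<epsilon>. 0 < \<epsilon> \<and> \<epsilon> \<le> \<eta> \<and>
           regular_curve M \<gamma> {-\<epsilon><..<\<epsilon>} \<and> generic_inflection M \<gamma> 0 \<and>
           (\<forall>\<tau>\<in>{-\<epsilon><..<\<epsilon>}. arclength34 M \<gamma> \<tau> = \<tau>) \<and>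
           (\<forall>\<tau>\<in>{-\<epsilon><..<\<epsilon>} - {0}. br M \<gamma> 1 2 \<tau> \<noteq> 0 \<and> normalized_curvature M \<gamma> \<tau> = f \<tau>)))"
proof (intro conjI allI impI)
  fix \<gamma> :: "real \<Rightarrow> 'm" and \<delta> :: real
  assume A: "0 < \<delta> \<and> regular_curve M \<gamma> {-\<delta><..<\<delta>} \<and> generic_inflection M \<gamma> 0"
  note M = assms
  let ?I = "{-\<delta><..<\<delta>}"
  have \<delta>: "0 < \<delta>" "0 \<in> ?I" and sm: "smooth_curve M \<gamma> ?I"
    and infl: "br M \<gamma> 1 2 0 = 0" "br M \<gamma> 1 3 0 \<noteq> 0"
    using A by (auto simp: regular_curve_def generic_inflection_def)
  note I = open_greaterThanLessThan[of "-\<delta>" \<delta>]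
  obtain i where i: "i \<in> charts M" "\<gamma> 0 \<in> dom M i"
    using in_some_chart[OF M curve_in_space[OF M sm \<delta>(2)]] .
  let ?S = "{t \<in> ?I. \<gamma> t \<in> dom M i}"
  have "open ?S" "0 \<in> ?S" using open_chart_times[OF M I sm i(1)] i(2) \<delta>(2) by auto
  then obtain d where d: "0 < d" "ball 0 d \<subseteq> ?S" using open_contains_ball by blast
  have ball: "{-d<..<d} \<subseteq> ?S" using d(2) by (auto simp: ball_def dist_real_def subset_iff abs_less_iff)
  have "d \<le> \<delta>"
  proof (rule ccontr)
    assume "\<not> d \<le> \<delta>"
    then have "\<delta> \<in> {-d<..<d}" using \<delta> by auto
    with ball show False by auto
  qed
  note br' = br_derivative[OF M I sm]
  have n: "Suc 0 = 1" "Suc 1 = 2" "Suc 2 = 3" "Suc 3 = 4" by simp_all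
  have a': "(br M \<gamma> 1 2 has_real_derivative br M \<gamma> 1 3 t) (at t)" if "t \<in> {-d<..<d}" for t
    using br'[of t 0 1] br_self[OF M I sm, of t 1] that ball unfolding n by auto
  have q': "(br M \<gamma> 1 3 has_real_derivative br M \<gamma> 2 3 t + br M \<gamma> 1 4 t) (at t)"
    if "t \<in> {-d<..<d}" for t
    using br'[of t 0 2] that ball unfolding n by auto
  have r': "(br M \<gamma> 2 3 has_real_derivative br M \<gamma> 2 4 0) (at 0)"
    using br'[of 0 1 2] br_self[OF M I sm \<delta>(2), of 2] \<delta>(2) unfolding n by simp
  have sm12: "smooth_on {-d<..<d} (br M \<gamma> 1 2)" "smooth_on {-d<..<d} (br M \<gamma> 2 3)"
    using br_smooth[OF M I sm i(1), of 0 1] br_smooth[OF M I sm i(1), of 1 2] smooth_on_subset[OF _ ball]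
    unfolding n by blast+
  have tv: "tangent_vector M (\<gamma> 0) (curve_deriv M \<gamma> (Suc k) 0)" for k
    using tangent_field_curve_deriv[OF M I sm, of k] \<delta>(2) unfolding tangent_field_def[OF M] by blast
  \<comment> \<open>The remaining term of the Pluecker relation contains the factor \<open>br M \<gamma> 1 2 0 = 0\<close>.\<close>
  have pl: "br M \<gamma> 1 3 0 * br M \<gamma> 2 4 0 = br M \<gamma> 2 3 0 * br M \<gamma> 1 4 0"
    using bracket_pluecker[OF M curve_in_space[OF M sm \<delta>(2)] tv[of 0] tv[of 1] tv[of 2] tv[of 3]] infl(1)
    unfolding n br_def by (simp add: mult.commute)
  note main = normalized_curvature_at_inflection[OF d(1) sm12 a' q' r' infl pl]
  show "\<exists>\<epsilon> F \<theta>. 0 < \<epsilon> \<and> \<epsilon> \<le> \<delta> \<and>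
      coordinate_on {-\<epsilon><..<\<epsilon>} (arclength34 M \<gamma>) \<theta> \<and>
      (\<forall>t\<in>{-\<epsilon><..<\<epsilon>} - {0}. br M \<gamma> 1 2 t \<noteq> 0 \<and> F t = normalized_curvature M \<gamma> t) \<and>
      smooth_on {-\<epsilon><..<\<epsilon>} F \<and>
      smooth_on (arclength34 M \<gamma> ` {-\<epsilon><..<\<epsilon>}) (F \<circ> \<theta>) \<and>
      - (9/7) * ((br M \<gamma> 1 4 0 + br M \<gamma> 2 3 0) / br M \<gamma> 1 3 0) * deriv F 0
        + 32 * (deriv F 0)\<^sup>2 + 9 * (deriv ^^ 2) F 0 = 0 \<and>
      F 0 = - 5/16 \<and>
      32 * (deriv (F \<circ> \<theta>) 0)\<^sup>2 + 9 * (deriv ^^ 2) (F \<circ> \<theta>) 0 = 0 \<and>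
      ((\<forall>\<^sub>F t in nhds 0. arclength34 M \<gamma> t = t) \<longrightarrow>
         32 * (deriv F 0)\<^sup>2 + 9 * (deriv ^^ 2) F 0 = 0)"
    using main(1) order_trans[OF _ \<open>d \<le> \<delta>\<close>] by blast
  show "(normalized_curvature M \<gamma> \<longlongrightarrow> - 5/16) (at 0)" by (rule main(2))
  show "((\<lambda>t. (normalized_curvature M \<gamma> t + 5/16) / arclength34 M \<gamma> t) \<longlongrightarrow>
      - (3 * root 4 3 / (28 * sqrt 2)) * inflectional_curvature M \<gamma>) (at 0)" by (rule main(3))
next
  fix f :: "real \<Rightarrow> real" and \<eta> :: real
  assume A: "0 < \<eta> \<and> smooth_on {-\<eta><..<\<eta>} f \<and> f 0 = - 5/16 \<and>
      32 * (deriv f 0)\<^sup>2 + 9 * (deriv ^^ 2) f 0 = 0"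
  then have "32 * (deriv f 0)\<^sup>2 + 9 * deriv (deriv f) 0 = 0" by (simp add: numeral_2_eq_2)
  with A obtain \<gamma> \<epsilon> where "0 < \<epsilon>" "\<epsilon> \<le> \<eta>" "regular_curve M \<gamma> {-\<epsilon><..<\<epsilon>}" "generic_inflection M \<gamma> 0"
    "\<And>t. t \<in> {-\<epsilon><..<\<epsilon>} \<Longrightarrow> arclength34 M \<gamma> t = t"
    "\<And>t. t \<in> {-\<epsilon><..<\<epsilon>} - {0} \<Longrightarrow> br M \<gamma> 1 2 t \<noteq> 0 \<and> normalized_curvature M \<gamma> t = f t"
    using curve_with_normalized_curvature[OF assms, of \<eta> f] by metis
  then show "\<exists>\<gamma> \<epsilon>. 0 < \<epsilon> \<and> \<epsilon> \<le> \<eta> \<and>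
      regular_curve M \<gamma> {-\<epsilon><..<\<epsilon>} \<and> generic_inflection M \<gamma> 0 \<and>
      (\<forall>\<tau>\<in>{-\<epsilon><..<\<epsilon>}. arclength34 M \<gamma> \<tau> = \<tau>) \<and>
      (\<forall>\<tau>\<in>{-\<epsilon><..<\<epsilon>} - {0}. br M \<gamma> 1 2 \<tau> \<noteq> 0 \<and> normalized_curvature M \<gamma> \<tau> = f \<tau>)"
    by blast
qed

end
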